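(* Let $\mathbf{w}\in\mathcal{V}$ and let $t$ be the number of ladders $\mathcal{L}^1,\dots,\mathcal{L}^t$ of $\widehat P(\mathbf{w})$. The connected component of the flip graph of $\mathcal{O}(Q_{\mathbf{w}})$ containing all regular triangulations admits a $\mathbb{Z}_2^t$ action given by twists; that is, $(\tau,\mathcal{T})\mapsto\tau(\mathcal{T})$ defines an action of the twist group $\mathfrak{T}(\mathbf{w})\cong\mathbb{Z}_2^t$ on this component (respecting adjacency by flips).
   Context: A generalized snake word of length $k\ge 0$ is a word $\mathbf{w}=w_0w_1\cdots w_k$ where $w_0=\varepsilon$ is the empty letter and $w_i\in\{L,R\}$ for $1\le i\le k$. $\mathcal{V}$ is the set of generalized snake words that do not contain $LRL$ or $RLR$ as a (contiguous) substring. The generalized snake poset $P(\mathbf{w})$ is defined recursively ($\prec$ denotes a cover relation). $P(\varepsilon)$ is the poset on $\{0,1,2,3\}$ with cover relations $1\prec 0$, $2\prec 0$, $3\prec 1$, $3\prec 2$. For $n\ge 1$, $P(w_0\cdots w_n)$ is $P(w_0\cdots w_{n-1})\cup\{2n+2,2n+3\}$ with the added cover relations $2n+3\prec 2n+1$, $2n+3\prec 2n+2$, and: $2n+2\prec 2n-1$ if ($n=1$ and $w_n=L$) or ($n\ge2$ and $w_{n-1}w_n\in\{RL,LR\}$); $2n+2\prec 2n$ if ($n=1$ and $w_n=R$) or ($n\ge 2$ and $w_{n-1}w_n\in\{LL,RR\}$). $\widehat{P}(\mathbf{w})$ is $P(\mathbf{w})$ with a new minimum $\widehat 0$ and a new maximum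 $\widehat 1$ adjoined; it is a distributive lattice. $Q_{\mathbf{w}}$ is the poset of meet-irreducible elements of $\widehat P(\mathbf{w})$ (elements $\ne\widehat 1$ covered by exactly one element), with the induced order. The order polytope is $\mathcal{O}(Q)=\{x\in[0,1]^Q: x_i\le x_j \text{ whenever } i<_Q j\}$; its vertices are the indicator vectors of the filters of $Q$. Let $V_0$ be the set of elements of $\widehat P(\mathbf{w})$; identify $x\in V_0$ with the filter $\{q\in Q_{\mathbf{w}}: q\ge x\}$ and hence with a vertex of $\mathcal{O}(Q_{\mathbf{w}})$ (a bijection). Squares and ladders. $\mathrm{Sq}(w_0)=\{0,1,2,3\}$; for $i\ge1$, $\mathrm{Sq}(w_i)=\{y,2i+1,2i+2,2i+3\}$, where $y$ is the element covering $2i+2$ in $P(\mathbf{w})$. Let $c_1<\dots<c_{t-1}$ be the indices $c$ with $1\le c\le k-1$ and $w_c\ne w_{c+1}$, and put $c_0=0$, $c_t=k$. For $1\le r\le t$ the ladder $\mathcal{L}^r$ is the subposet of $\widehat P(\mathbf{w})$ on $\bigcup_{j=c_{r-1}}^{c_r}\mathrm{Sq}(w_j)$. Label its elements $x_1,\dots,x_s$ so that its cover relations are exactly $x_{j+2}\prec x_j$ for $1\le j\le s-2$ and $x_{2j}\prec x_{2j-1}$ for $1\le j\le s/2$ (this determines the labeling if the ladder has at least two squares; if $\mathbf{w}=\varepsilon$, take $x_1=0,x_2=1,x_3=2,x_4=3$). The elementary twist $\tau_r$ is the permutation of $V_0$ that exchanges $x_{2j-1}$ and $x_{2j}$ for $1\le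 j\le s/2$ and fixes all other elements. The twist group $\mathfrak{T}(\mathbf{w})$ is the group of permutations of $V_0$ generated by $\tau_1,\dots,\tau_t$, and is isomorphic to $\mathbb{Z}_2^t$; its elements are called twists. For a triangulation $\mathcal{T}$, $\tau(\mathcal{T})$ is the collection of subsets obtained by applying $\tau$ to the vertex set of every simplex of $\mathcal{T}$. Triangulations of $\mathcal{O}(Q_{\mathbf{w}})$ are triangulations of its vertex set; a triangulation is regular if it is the projection of the lower envelope of a lifting of the vertices by a height function. A circuit $Z$ is a minimal affinely dependent set of vertices, partitioned as $Z=Z_+\sqcup Z_-$ by the signs in its affine dependence; its two triangulations $\mathcal{T}_Z^{\pm}$ have maximal simplices $Z\setminus\{z\}$, $z\in Z_\pm$. Two triangulations $\mathcal{T}_1,\mathcal{T}_2$ (viewed as simplicial complexes) differ by a flip if for some circuit $Z$ (suitably oriented) $\mathcal{T}_1\supseteq\mathcal{T}_Z^+$, all maximal simplices of $\mathcal{T}_Z^+$ have the same link $\mathrm{L}$ in $\mathcal{T}_1$, and $\mathcal{T}_2$ is obtained by replacing $\mathcal{T}_Z^+*\mathrm{L}$ by $\mathcal{T}_Z^-*\mathrm{L}$. The flip graph has all triangulations as vertices and edges between those that differ by a flip; all regular triangulations lie in one connected component. *)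

theory Defs
  imports
    "HOL-Analysis.Analysis"
    "HOL-Analysis.Finite_Function_Topology"
    "HOL-Algebra.Algebra"
    "HOL-Library.Sublist"
begin

section \<open>Generalized snake words and posets\<close>

datatype letter = L | R

text \<open>
  A word \<open>w\<^sub>0 w\<^sub>1 \<dots> w\<^sub>k\<close> is the list of its letters \<open>w\<^sub>1, \<dots>, w\<^sub>k\<close>; the empty letter \<open>w\<^sub>0\<close> is left
  implicit, so that \<open>k\<close> is the length of the list.
\<close>

type_synonym word = "letter list"

definition word_letter :: "word \<Rightarrow> nat \<Rightarrow> letter" where
  "word_letter w i = w ! (i - 1)"

definition \<V> :: "word set" where
  "\<V> = {w. \<not> sublist [L, R, L] w \<and> \<not> sublist [R, L, R] w}"

text \<open>
  \<open>snake_rel w n\<close> consists of the pairs \<open>(a, b)\<close> with \<open>a \<prec> b\<close> in the poset of the prefix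
  \<open>w\<^sub>0 \<dots> w\<^sub>n\<close>.
\<close>

fun snake_rel :: "word \<Rightarrow> nat \<Rightarrow> nat rel" where
  "snake_rel w 0 = {(1, 0), (2, 0), (3, 1), (3, 2)}"
| "snake_rel w (Suc m) = (let n = Suc m in
     snake_rel w m \<union>
     {(2*n+3, 2*n+1), (2*n+3, 2*n+2)} \<union>
     (if (n = 1 \<and> word_letter w n = L) \<or> (n \<ge> 2 \<and> word_letter w (n-1) \<noteq> word_letter w n)
      then {(2*n+2, 2*n-1)} else {(2*n+2, 2*n)}))"

datatype elt = Zero_hat | Elt nat | One_hat

definition P_elts :: "word \<Rightarrow> elt set" where
  "P_elts w = Elt ` {0..2 * length w + 3}"

definition V0 :: "word \<Rightarrow> elt set" where
  "V0 w = insert Zero_hat (insert One_hat (P_elts w))"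

definition hat_le :: "word \<Rightarrow> elt \<Rightarrow> elt \<Rightarrow> bool" where
  "hat_le w x y \<longleftrightarrow> x \<in> V0 w \<and> y \<in> V0 w \<and>
     (x = Zero_hat \<or> y = One_hat \<or>
      (\<exists>a b. x = Elt a \<and> y = Elt b \<and> (a, b) \<in> (snake_rel w (length w))\<^sup>*))"

definition hat_less :: "word \<Rightarrow> elt \<Rightarrow> elt \<Rightarrow> bool" where
  "hat_less w x y \<longleftrightarrow> hat_le w x y \<and> x \<noteq> y"

definition covered_in :: "word \<Rightarrow> elt set \<Rightarrow> elt \<Rightarrow> elt \<Rightarrow> bool" where
  "covered_in w S x y \<longleftrightarrow> x \<in> S \<and> y \<in> S \<and> hat_less w x y \<and>
     \<not> (\<exists>z\<in>S. hat_less w x z \<and> hat_less w z y)"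

definition Q_elts :: "word \<Rightarrow> elt set" where
  "Q_elts w = {x \<in> V0 w. x \<noteq> One_hat \<and> (\<exists>!y. covered_in w (V0 w) x y)}"


section \<open>The order polytope\<close>

text \<open>
  The space \<open>\<real>\<^sup>Q\<close> is realised as the vectors of \<^typ>\<open>elt \<Rightarrow>\<^sub>0 real\<close> whose support lies in \<open>Q\<close>.
\<close>

definition order_polytope :: "word \<Rightarrow> (elt \<Rightarrow>\<^sub>0 real) set" where
  "order_polytope w = {x. Poly_Mapping.keys x \<subseteq> Q_elts w \<and>
     (\<forall>i\<in>Q_elts w. 0 \<le> Poly_Mapping.lookup x i \<and> Poly_Mapping.lookup x i \<le> 1) \<and>
     (\<forall>i\<in>Q_elts w. \<forall>j\<in>Q_elts w. hat_less w i j \<longrightarrow> Poly_Mapping.lookup x i \<le> Poly_Mapping.lookup x j)}"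

definition polytope_vertices :: "word \<Rightarrow> (elt \<Rightarrow>\<^sub>0 real) set" where
  "polytope_vertices w = {v. v extreme_point_of order_polytope w}"

text \<open>The indicator vector of the filter \<open>{q \<in> Q. q \<ge> x}\<close>, which identifies \<open>V\<^sub>0\<close> with the vertices.\<close>

definition vertex_of :: "word \<Rightarrow> elt \<Rightarrow> (elt \<Rightarrow>\<^sub>0 real)" where
  "vertex_of w x = (\<Sum>q\<in>{q \<in> Q_elts w. hat_le w x q}. Poly_Mapping.single q 1)"


section \<open>Ladders and twists\<close>

definition Sq :: "word \<Rightarrow> nat \<Rightarrow> elt set" where
  "Sq w i = (if i = 0 then Elt ` {0, 1, 2, 3}
     else {THE y. covered_in w (P_elts w) (Elt (2*i+2)) y} \<union> Elt ` {2*i+1, 2*i+2, 2*i+3})"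

definition turns :: "word \<Rightarrow> nat list" where
  "turns w = sorted_list_of_set
     {c. 1 \<le> c \<and> c + 1 \<le> length w \<and> word_letter w c \<noteq> word_letter w (c + 1)}"

definition breakpoints :: "word \<Rightarrow> nat list" where  \<comment> \<open>\<open>[c\<^sub>0, c\<^sub>1, \<dots>, c\<^sub>t]\<close>\<close>
  "breakpoints w = 0 # turns w @ [length w]"

definition num_ladders :: "word \<Rightarrow> nat" where
  "num_ladders w = length (turns w) + 1"

definition ladder :: "word \<Rightarrow> nat \<Rightarrow> elt set" where
  "ladder w r = (\<Union>j\<in>{breakpoints w ! (r - 1)..breakpoints w ! r}. Sq w j)"

definition is_ladder_labeling :: "word \<Rightarrow> nat \<Rightarrow> (nat \<Rightarrow> elt) \<Rightarrow> bool" where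
  "is_ladder_labeling w r x \<longleftrightarrow>
     bij_betw x {1..card (ladder w r)} (ladder w r) \<and>
     (\<forall>a\<in>{1..card (ladder w r)}. \<forall>b\<in>{1..card (ladder w r)}.
        covered_in w (ladder w r) (x a) (x b) \<longleftrightarrow> a = b + 2 \<or> (odd b \<and> a = b + 1))"

text \<open>
  For nonempty words the labeling \<open>x\<^sub>1, \<dots>, x\<^sub>s\<close> is unique on \<open>{1..s}\<close>; its values elsewhere are
  irrelevant.  A single square has two such labelings, whence the convention for the empty word.
\<close>

definition ladder_labeling :: "word \<Rightarrow> nat \<Rightarrow> nat \<Rightarrow> elt" where
  "ladder_labeling w r =
     (if w = [] then (\<lambda>i. Elt (i - 1)) else (SOME x. is_ladder_labeling w r x))"

definition elementary_twist :: "word \<Rightarrow> nat \<Rightarrow> elt \<Rightarrow> elt" where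
  "elementary_twist w r = (\<lambda>v\<in>V0 w.
     let x = ladder_labeling w r; s = card (ladder w r) in
     if v \<in> x ` {1..s}
     then (let i = the_inv_into {1..s} x v in if odd i then x (i + 1) else x (i - 1))
     else v)"

definition twist_group :: "word \<Rightarrow> (elt \<Rightarrow> elt) monoid" where
  "twist_group w = subgroup_generated (BijGroup (V0 w)) (elementary_twist w ` {1..num_ladders w})"


section \<open>Triangulations and flips of point configurations\<close>

text \<open>
  A triangulation of a finite point configuration \<open>A\<close> is given as an abstract simplicial complex:
  the collection of the vertex sets of all its simplices, including the empty one.
\<close>

definition triangulation_of :: "'a::real_vector set \<Rightarrow> 'a set set \<Rightarrow> bool" where
  "triangulation_of A T \<longleftrightarrow>
     (\<forall>\<sigma>\<in>T. \<sigma> \<subseteq> A \<and> \<not> affine_dependent \<sigma>) \<and>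
     (\<forall>\<sigma>\<in>T. \<forall>\<rho>. \<rho> \<subseteq> \<sigma> \<longrightarrow> \<rho> \<in> T) \<and>
     (\<Union>\<sigma>\<in>T. convex hull \<sigma>) = convex hull A \<and>
     (\<forall>\<sigma>\<in>T. \<forall>\<rho>\<in>T. convex hull \<sigma> \<inter> convex hull \<rho> = convex hull (\<sigma> \<inter> \<rho>))"

definition lifted_polytope :: "'a::real_vector set \<Rightarrow> ('a \<Rightarrow> real) \<Rightarrow> ('a \<times> real) set" where
  "lifted_polytope A h = convex hull ((\<lambda>a. (a, h a)) ` A)"

definition lower_envelope :: "'a::real_vector set \<Rightarrow> ('a \<Rightarrow> real) \<Rightarrow> ('a \<times> real) set" where
  "lower_envelope A h = {(x, y) \<in> lifted_polytope A h. \<forall>y'. (x, y') \<in> lifted_polytope A h \<longrightarrow> y \<le> y'}"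

definition regular_triangulation :: "'a::real_vector set \<Rightarrow> 'a set set \<Rightarrow> bool" where
  "regular_triangulation A T \<longleftrightarrow> triangulation_of A T \<and>
     (\<exists>h. (\<lambda>\<sigma>. convex hull \<sigma>) ` T =
          (\<lambda>F. fst ` F) ` {F. F face_of lifted_polytope A h \<and> F \<subseteq> lower_envelope A h})"

text \<open>\<open>Zp\<close> and \<open>Zm\<close> are the positive and negative part of an oriented circuit \<open>Zp \<union> Zm\<close>.\<close>

definition signed_circuit :: "'a::real_vector set \<Rightarrow> 'a set \<Rightarrow> 'a set \<Rightarrow> bool" where
  "signed_circuit A Zp Zm \<longleftrightarrow>
     (let Z = Zp \<union> Zm in
       Z \<subseteq> A \<and> affine_dependent Z \<and> (\<forall>Y. Y \<subset> Z \<longrightarrow> \<not> affine_dependent Y) \<and>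
       (\<exists>u. sum u Z = 0 \<and> (\<Sum>z\<in>Z. u z *\<^sub>R z) = 0 \<and>
            Zp = {z\<in>Z. u z > 0} \<and> Zm = {z\<in>Z. u z < 0}))"

definition circuit_triangulation_facets :: "'a set \<Rightarrow> 'a set \<Rightarrow> 'a set set" where
  "circuit_triangulation_facets Zp Zm = {(Zp \<union> Zm) - {z} |z. z \<in> Zp}"

definition circuit_triangulation :: "'a set \<Rightarrow> 'a set \<Rightarrow> 'a set set" where
  "circuit_triangulation Zp Zm = {\<sigma>. \<exists>\<rho>\<in>circuit_triangulation_facets Zp Zm. \<sigma> \<subseteq> \<rho>}"

definition simplex_link :: "'a set set \<Rightarrow> 'a set \<Rightarrow> 'a set set" where
  "simplex_link T \<sigma> = {\<rho>\<in>T. \<rho> \<inter> \<sigma> = {} \<and> \<rho> \<union> \<sigma> \<in> T}"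

definition simplicial_join :: "'a set set \<Rightarrow> 'a set set \<Rightarrow> 'a set set" where
  "simplicial_join K M = {\<sigma> \<union> \<rho> |\<sigma> \<rho>. \<sigma> \<in> K \<and> \<rho> \<in> M}"

definition flip_move :: "'a::real_vector set \<Rightarrow> 'a set set \<Rightarrow> 'a set set \<Rightarrow> bool" where
  "flip_move A T1 T2 \<longleftrightarrow>
     (\<exists>Zp Zm K. signed_circuit A Zp Zm \<and>
        circuit_triangulation Zp Zm \<subseteq> T1 \<and>
        (\<forall>\<sigma>\<in>circuit_triangulation_facets Zp Zm. simplex_link T1 \<sigma> = K) \<and>
        T2 = (T1 - simplicial_join (circuit_triangulation Zp Zm) K)
             \<union> simplicial_join (circuit_triangulation Zm Zp) K)"

definition flip_adjacent :: "'a::real_vector set \<Rightarrow> 'a set set \<Rightarrow> 'a set set \<Rightarrow> bool" where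
  "flip_adjacent A T1 T2 \<longleftrightarrow> triangulation_of A T1 \<and> triangulation_of A T2 \<and>
     (flip_move A T1 T2 \<or> flip_move A T2 T1)"

definition flip_graph_component :: "'a::real_vector set \<Rightarrow> 'a set set set \<Rightarrow> bool" where
  "flip_graph_component A C \<longleftrightarrow>
     (\<exists>T. triangulation_of A T \<and> C = {S. (flip_adjacent A)\<^sup>*\<^sup>* T S})"


section \<open>The action of twists on triangulations\<close>

definition twist_vertex :: "word \<Rightarrow> (elt \<Rightarrow> elt) \<Rightarrow> (elt \<Rightarrow>\<^sub>0 real) \<Rightarrow> (elt \<Rightarrow>\<^sub>0 real)" where
  "twist_vertex w \<tau> v = vertex_of w (\<tau> (the_inv_into (V0 w) (vertex_of w) v))"

definition twist_triangulation ::
    "word \<Rightarrow> (elt \<Rightarrow> elt) \<Rightarrow> (elt \<Rightarrow>\<^sub>0 real) set set \<Rightarrow> (elt \<Rightarrow>\<^sub>0 real) set set" where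
  "twist_triangulation w \<tau> T = (\<lambda>\<sigma>. twist_vertex w \<tau> ` \<sigma>) ` T"

end

(*
  The twists are induced by linear symmetries of the order polytope. Writing y(i) for the top of the
  square Sq(w_i), the only affine relations between the vertices are generated by the square relations
    v(2i+3) + v(y(i)) = v(2i+1) + v(2i+2),
  one for each square. An elementary twist negates the relations of the squares of its ladder and adds
  to the relation of an adjacent square the relation of the square shared by the two ladders; here the
  exclusion of LRL and RLR ensures that ladders which are not consecutive do not meet. Hence every
  twist extends to a linear automorphism of the space that permutes the vertices, and so it preserves
  triangulations, circuits, flips and regularity. Since a regular triangulation exists (take a generic
  height function) and is mapped to a regular triangulation, twists preserve the component.
*)

theory Submission
  imports Defs
begin

section \<open>Existence of regular triangulations\<close>

text \<open>The ambient type \<open>elt \<Rightarrow>\<^sub>0 real\<close> is larger than R^Q and of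
  infinite dimension. A twist is therefore represented by two linear maps \<open>g\<close> and
  \<open>g'\<close> that invert each other on the vertices, hence on their span, and most facts
  about hulls, faces and envelopes are proved in arbitrary real vector spaces. Linear maps suffice
  instead of affine ones because every twist fixes \<open>One_hat\<close>, whose vertex is the
  origin. The component \<open>C\<close> is given only as one that contains all regular
  triangulations, so it takes an actual regular triangulation to tie \<open>C\<close> to its twisted
  image. The labelling of a ladder is selected by a choice operator; explicit formulas for the
  twists become available only once the labelling is shown to be unique. The isomorphism with Z_2^t
  needs more than commuting involutions: no product of distinct elementary twists may be trivial.
  This is a triangularity argument: the top of the first square of ladder \<open>r\<close> is moved
  by twist \<open>r\<close> and fixed by the twists of all later ladders.\<close>

lemma generic_height_exists:
  fixes u :: "'b \<Rightarrow> 'a \<Rightarrow> real"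
  assumes "finite A" "finite I" and nz: "\<And>i. i \<in> I \<Longrightarrow> \<exists>a\<in>A. u i a \<noteq> 0"
  shows "\<exists>h. \<forall>i\<in>I. (\<Sum>a\<in>A. u i a * h a) \<noteq> 0"
proof -
  obtain e :: "'a \<Rightarrow> nat" where e: "inj_on e A"
    using finite_imp_inj_to_nat_seg[OF assms(1)] by blast
  \<comment> \<open>With heights \<open>M ^ e a\<close> at pairwise distinct exponents, the sum for
    \<open>i\<close> is the value of \<open>p i\<close> at \<open>M\<close>. Distinct
    \<open>a\<close> contribute to distinct coefficients, so \<open>p i\<close> is not the zero
    polynomial, and any \<open>M\<close> outside the finitely many roots works.\<close>
  define p where "p i = (\<Sum>a\<in>A. Polynomial.monom (u i a) (e a))" for i
  have "p i \<noteq> 0" if i: "i \<in> I" for i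
  proof -
    obtain a where a: "a \<in> A" "u i a \<noteq> 0" using nz[OF i] by blast
    have "Polynomial.coeff (p i) (e a) = (\<Sum>b\<in>A. if b = a then u i a else 0)"
      unfolding p_def Polynomial.coeff_sum using e a by (intro sum.cong) (auto simp: inj_on_eq_iff)
    then have "Polynomial.coeff (p i) (e a) = u i a" using a assms(1) by simp
    then show ?thesis using a by auto
  qed
  then have "finite (\<Union>i\<in>I. {x. poly (p i) x = 0})"
    using assms(2) poly_roots_finite by blast
  then obtain M :: real where M: "M \<notin> (\<Union>i\<in>I. {x. poly (p i) x = 0})"
    using ex_new_if_finite infinite_UNIV_char_0 by blast
  have "(\<Sum>a\<in>A. u i a * M ^ e a) = poly (p i) M" for i
    by (simp add: p_def poly_sum poly_monom)
  then show ?thesis using M by (intro exI[of _ "\<lambda>a. M ^ e a"]) auto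
qed

text \<open>For finite \<open>S\<close> the condition says that the heights on an affinely dependent
  \<open>S\<close> are not the values of an affine function: some dependence of \<open>S\<close>
  does not survive lifting.\<close>

definition generic_height :: "'a::real_vector set \<Rightarrow> ('a \<Rightarrow> real) \<Rightarrow> bool" where
  "generic_height A h \<longleftrightarrow> (\<forall>S\<subseteq>A. affine_dependent S \<longrightarrow>
     (\<exists>u. sum u S = 0 \<and> (\<Sum>a\<in>S. u a *\<^sub>R a) = 0 \<and> (\<Sum>a\<in>S. u a * h a) \<noteq> 0))"

lemma ex_generic_height:
  fixes A :: "'a::real_vector set"
  assumes "finite A"
  shows "\<exists>h. generic_height A h"
proof -
  define D where "D = {S. S \<subseteq> A \<and> affine_dependent S}"
  have "\<forall>S\<in>D. \<exists>u. sum u S = 0 \<and> (\<exists>v\<in>S. u v \<noteq> 0) \<and> (\<Sum>v\<in>S. u v *\<^sub>R v) = 0"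
  proof
    fix S assume "S \<in> D"
    then have "finite S" "affine_dependent S" unfolding D_def using assms finite_subset by auto
    then show "\<exists>u. sum u S = 0 \<and> (\<exists>v\<in>S. u v \<noteq> 0) \<and> (\<Sum>v\<in>S. u v *\<^sub>R v) = 0"
      by (simp add: affine_dependent_explicit_finite)
  qed
  from bchoice[OF this] obtain u where u: "\<And>S. S \<in> D \<Longrightarrow>
      sum (u S) S = 0 \<and> (\<exists>v\<in>S. u S v \<noteq> 0) \<and> (\<Sum>v\<in>S. u S v *\<^sub>R v) = 0" by blast
  have fD: "finite D" unfolding D_def using assms by simp
  have "\<exists>a\<in>A. (if a \<in> S then u S a else 0) \<noteq> 0" if "S \<in> D" for S
    using u[OF that] that unfolding D_def by auto
  then have "\<exists>h. \<forall>S\<in>D. (\<Sum>a\<in>A. (if a \<in> S then u S a else 0) * h a) \<noteq> 0"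
    by (intro generic_height_exists[OF assms fD])
  then
  obtain h where h: "\<And>S. S \<in> D \<Longrightarrow> (\<Sum>a\<in>A. (if a \<in> S then u S a else 0) * h a) \<noteq> 0" by blast
  have "(\<Sum>a\<in>S. u S a * h a) \<noteq> 0" if S: "S \<in> D" for S
  proof -
    have "(\<Sum>a\<in>A. (if a \<in> S then u S a else 0) * h a) = (\<Sum>a\<in>S. u S a * h a)"
      using S assms unfolding D_def by (intro sum.mono_neutral_cong_right) auto
    then show ?thesis using h[OF S] by simp
  qed
  moreover have "S \<in> D" if "S \<subseteq> A" "affine_dependent S" for S using that unfolding D_def by simp
  ultimately have "generic_height A h" unfolding generic_height_def using u by blast
  then show ?thesis by blast
qed

section \<open>Lower envelopes and faces of lifted point sets\<close>

lemma lower_envelope_unique: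
  assumes "(x, y) \<in> lower_envelope A h" "(x, y') \<in> lower_envelope A h"
  shows "y = y'"
  using assms unfolding lower_envelope_def by force

lemma lower_envelope_subset: "lower_envelope A h \<subseteq> lifted_polytope A h"
  unfolding lower_envelope_def by auto

lemma fst_convex_hull_lift: "fst ` (convex hull ((\<lambda>a. (a, h a)) ` S)) = convex hull S"
proof -
  have "fst ` (convex hull ((\<lambda>a. (a, h a)) ` S)) = convex hull (fst ` (\<lambda>a. (a, h a)) ` S)"
    by (rule convex_hull_linear_image) (rule linear_fst)
  then show ?thesis by (simp add: image_image)
qed

lemma convex_hull_lift:
  assumes "finite S" "\<And>a. a \<in> S \<Longrightarrow> 0 \<le> u a" "sum u S = 1"
  shows "((\<Sum>a\<in>S. u a *\<^sub>R a), (\<Sum>a\<in>S. u a * h a)) \<in> convex hull ((\<lambda>a. (a, h a)) ` S)"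
proof -
  have "((\<Sum>a\<in>S. u a *\<^sub>R a), (\<Sum>a\<in>S. u a * h a)) = (\<Sum>a\<in>S. u a *\<^sub>R (a, h a))"
    by (simp add: prod_eq_iff fst_sum snd_sum)
  moreover have "(\<Sum>a\<in>S. u a *\<^sub>R (a, h a)) \<in> convex hull ((\<lambda>a. (a, h a)) ` S)"
    using assms by (intro convex_sum) (auto intro: hull_inc)
  ultimately show ?thesis by simp
qed

text \<open>If \<open>S\<close> were dependent, its barycentre could be written with two sets of
  weights, uniform ones and their perturbation along a dependence \<open>u\<close>. Both lifts would
  lie in the envelope over the same point, at different heights.\<close>

lemma generic_lower_imp_independent:
  fixes A :: "'a::real_vector set"
  assumes "finite A" "generic_height A h" "S \<subseteq> A"
    and low: "convex hull ((\<lambda>a. (a, h a)) ` S) \<subseteq> lower_envelope A h"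
  shows "\<not> affine_dependent S"
proof
  assume dep: "affine_dependent S"
  then obtain u where u: "sum u S = 0" "(\<Sum>a\<in>S. u a *\<^sub>R a) = 0" "(\<Sum>a\<in>S. u a * h a) \<noteq> 0"
    using assms unfolding generic_height_def by blast
  have fin: "finite S" using assms finite_subset by blast
  have ne: "S \<noteq> {}" using u by auto
  define n where "n = real (card S)"
  have n: "n > 0" using fin ne n_def by (simp add: card_gt_0_iff)
  define N where "N = (\<Sum>a\<in>S. \<bar>u a\<bar>)"
  have N: "N \<ge> 0" unfolding N_def by (simp add: sum_nonneg)
  \<comment> \<open>Small enough that \<open>1 / n + e * u a\<close> is nonnegative for every
    \<open>a\<close>, since \<open>N\<close> bounds each absolute value of \<open>u\<close>; the
    summand 1 keeps the denominator positive.\<close>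
  define e where "e = 1 / (n * (1 + N))"
  have e: "e > 0" unfolding e_def using n N by simp
  define v where "v a = 1 / n + e * u a" for a
  have "0 \<le> v a" if "a \<in> S" for a
  proof -
    have "\<bar>u a\<bar> \<le> N" unfolding N_def using fin that by (intro member_le_sum) auto
    then have "e * \<bar>u a\<bar> \<le> e * (1 + N)" using e by simp
    also have "\<dots> = 1 / n" unfolding e_def using n N by simp
    finally have "\<bar>e * u a\<bar> \<le> 1 / n" using e by (simp add: abs_mult)
    then show ?thesis unfolding v_def by linarith
  qed
  moreover have "sum v S = 1"
    using n ne fin u(1) unfolding v_def n_def by (simp add: sum.distrib sum_distrib_left[symmetric])
  ultimately have 1: "((\<Sum>a\<in>S. v a *\<^sub>R a), (\<Sum>a\<in>S. v a * h a)) \<in> lower_envelope A h"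
    using low convex_hull_lift[OF fin] by blast
  have "((\<Sum>a\<in>S. (1/n) *\<^sub>R a), (\<Sum>a\<in>S. (1/n) * h a)) \<in> convex hull ((\<lambda>a. (a, h a)) ` S)"
    using n unfolding n_def by (intro convex_hull_lift fin) auto
  with low have 2: "((\<Sum>a\<in>S. (1/n) *\<^sub>R a), (\<Sum>a\<in>S. (1/n) * h a)) \<in> lower_envelope A h" by blast
  have "(\<Sum>a\<in>S. v a *\<^sub>R a) = (\<Sum>a\<in>S. (1/n) *\<^sub>R a) + e *\<^sub>R (\<Sum>a\<in>S. u a *\<^sub>R a)"
    unfolding v_def by (simp add: scaleR_add_left sum.distrib scaleR_sum_right)
  then have "(\<Sum>a\<in>S. v a * h a) = (\<Sum>a\<in>S. (1/n) * h a)"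
    using lower_envelope_unique 1 2 u(2) by (metis add_0_right scaleR_zero_right)
  moreover have "(\<Sum>a\<in>S. v a * h a) = (\<Sum>a\<in>S. (1/n) * h a) + e * (\<Sum>a\<in>S. u a * h a)"
    unfolding v_def by (simp add: sum.distrib sum_distrib_left distrib_right mult.assoc)
  ultimately show False using e u(3) by simp
qed

text \<open>A convex combination that represents a point \<open>x\<close> of the face uses only
  generators in the face: if \<open>b\<close> has weight strictly between 0 and 1, then either
  \<open>x = b\<close> or \<open>x\<close> lies in the open segment between \<open>b\<close> and the
  normalized combination \<open>r\<close> of the other generators.\<close>

lemma face_of_convex_hull_finite:
  fixes B :: "'a::real_vector set"
  assumes "finite B" "F face_of convex hull B"
  shows "F = convex hull (F \<inter> B)"
proof
  show "convex hull (F \<inter> B) \<subseteq> F"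
    using assms(2) by (intro hull_minimal) (auto dest: face_of_imp_convex)
  show "F \<subseteq> convex hull (F \<inter> B)"
  proof
    fix x assume x: "x \<in> F"
    then have "x \<in> convex hull B" using assms(2) face_of_imp_subset by blast
    then obtain u where u: "\<And>b. b \<in> B \<Longrightarrow> 0 \<le> u b" "sum u B = 1" "(\<Sum>b\<in>B. u b *\<^sub>R b) = x"
      unfolding convex_hull_finite[OF assms(1)] by blast
    have in_F: "b \<in> F" if b: "b \<in> B" "u b > 0" for b
    proof (cases "u b = 1")
      case True
      have s: "sum u (B - {b}) = 0" using u(2) True b(1) assms(1) by (simp add: sum_diff1)
      have "u c = 0" if "c \<in> B - {b}" for c
        using s u(1) that assms(1) by (subst (asm) sum_nonneg_eq_0_iff) auto
      then have "(\<Sum>c\<in>B - {b}. u c *\<^sub>R c) = 0" by simp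
      then have "x = b" using u(3) True sum.remove[OF assms(1) b(1), of "\<lambda>c. u c *\<^sub>R c"] by simp
      then show ?thesis using x by simp
    next
      case False
      have s: "sum u (B - {b}) = 1 - u b" using u(2) b(1) assms(1) by (simp add: sum_diff1)
      moreover have "sum u (B - {b}) \<ge> 0" using u(1) by (auto intro: sum_nonneg)
      ultimately have ub: "0 < u b" "u b < 1" using b False by auto
      define r where "r = (\<Sum>c\<in>B - {b}. (u c / (1 - u b)) *\<^sub>R c)"
      have "r \<in> convex hull B" unfolding r_def
        using assms(1) u(1) ub s by (intro convex_sum) (auto simp: hull_inc sum_divide_distrib[symmetric])
      moreover have xr: "x = (1 - u b) *\<^sub>R r + u b *\<^sub>R b"
        using u(3) ub sum.remove[OF assms(1) b(1), of "\<lambda>c. u c *\<^sub>R c"]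
        unfolding r_def scaleR_sum_right by (simp add: add.commute)
      moreover have "x = b" if "r = b"
        unfolding xr that by (simp add: scaleR_left_distrib[symmetric])
      ultimately show ?thesis
        using face_ofD[OF assms(2), of x r b] x ub b(1) hull_inc[of b B]
        by (cases "r = b") (auto simp: in_segment)
    qed
    have "x = (\<Sum>b\<in>F \<inter> B. u b *\<^sub>R b)"
      unfolding u(3)[symmetric] using assms(1) in_F u(1)
      by (intro sum.mono_neutral_right) (force simp: less_le)+
    moreover have "sum u (F \<inter> B) = sum u B"
      using assms(1) in_F u(1) by (intro sum.mono_neutral_left) (force simp: less_le)+
    moreover have "(\<Sum>b\<in>F \<inter> B. u b *\<^sub>R b) \<in> convex hull (F \<inter> B)" if "sum u (F \<inter> B) = 1"
      using assms(1) u(1) that by (intro convex_sum) (auto intro: hull_inc)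
    ultimately show "x \<in> convex hull (F \<inter> B)" using u(2) by simp
  qed
qed

text \<open>The points \<open>z\<close> from which the segment to \<open>p\<close> can be prolonged
  beyond \<open>p\<close> inside \<open>P\<close> form the smallest face through \<open>p\<close>.
  This produces a face through a given point without any argument on dimension.\<close>

lemma minimal_face_of:
  fixes P :: "'a::real_vector set"
  assumes "convex P" "p \<in> P"
  shows "{z \<in> P. \<exists>e>0. p + e *\<^sub>R (p - z) \<in> P} face_of P"
proof -
  let ?F = "{z \<in> P. \<exists>e>0. p + e *\<^sub>R (p - z) \<in> P}"
  have shrink: "p + d *\<^sub>R (p - z) \<in> P" if "p + e *\<^sub>R (p - z) \<in> P" "0 < d" "d \<le> e" for d e z
  proof -
    have "(1 - d/e) *\<^sub>R p + (d/e) *\<^sub>R (p + e *\<^sub>R (p - z)) \<in> P"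
      using assms(2) that by (intro convexD[OF assms(1)]) simp_all
    moreover have "(1 - d/e) *\<^sub>R p + (d/e) *\<^sub>R (p + e *\<^sub>R (p - z)) = p + d *\<^sub>R (p - z)"
      using that by (simp add: algebra_simps)
    ultimately show ?thesis by simp
  qed
  have "convex ?F"
  proof (rule convexI)
    fix x y and s t :: real
    assume x: "x \<in> ?F" and y: "y \<in> ?F" and st: "0 \<le> s" "0 \<le> t" "s + t = 1"
    obtain e1 e2 where e: "e1 > 0" "e2 > 0" "p + e1 *\<^sub>R (p - x) \<in> P" "p + e2 *\<^sub>R (p - y) \<in> P"
      using x y by auto
    define e where "e = min e1 e2"
    have e0: "e > 0" using e e_def by simp
    have "s *\<^sub>R (p + e *\<^sub>R (p - x)) + t *\<^sub>R (p + e *\<^sub>R (p - y)) \<in> P"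
      using shrink[OF e(3) e0] shrink[OF e(4) e0] st by (intro convexD[OF assms(1)]) (simp_all add: e_def)
    moreover have "s *\<^sub>R (p + e *\<^sub>R (p - x)) + t *\<^sub>R (p + e *\<^sub>R (p - y))
        = (s + t) *\<^sub>R p + e *\<^sub>R ((s + t) *\<^sub>R p - (s *\<^sub>R x + t *\<^sub>R y))"
      by (simp add: algebra_simps)
    ultimately have "p + e *\<^sub>R (p - (s *\<^sub>R x + t *\<^sub>R y)) \<in> P" using st by simp
    moreover have "s *\<^sub>R x + t *\<^sub>R y \<in> P" using x y st by (intro convexD[OF assms(1)]) simp_all
    ultimately show "s *\<^sub>R x + t *\<^sub>R y \<in> ?F" using e0 by blast
  qed
  moreover have *: "a \<in> ?F" if a: "a \<in> P" and b: "b \<in> P" and z: "z \<in> ?F"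
    and zs: "z = (1 - s) *\<^sub>R a + s *\<^sub>R b" "0 < s" "s < 1" for a b z s
  proof -
    obtain e where e: "e > 0" "p + e *\<^sub>R (p - z) \<in> P" using z by auto
    \<comment> \<open>The prolonged point \<open>p + e *\<^sub>R (p - z)\<close> and
      \<open>b\<close> get the weights \<open>th\<close> and \<open>1 - th\<close>. The choice
      \<open>th = 1 / c\<close> makes the contribution of \<open>b\<close> inside \<open>z\<close>
      cancel and gives \<open>p\<close> total weight 1, so that a point beyond \<open>p\<close> on
      the line from \<open>a\<close> remains.\<close>
    define c where "c = 1 + e * s"
    have c: "c > 0" unfolding c_def using e zs by (simp add: add_pos_pos)
    define th where "th = 1 / c"
    have th: "th * c = 1" "th > 0" using c th_def by auto
    have "0 < e * s" using e zs by simp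
    then have "th \<le> 1" unfolding th_def c_def by (simp add: divide_le_eq_1)
    then have "th *\<^sub>R (p + e *\<^sub>R (p - z)) + (1 - th) *\<^sub>R b \<in> P"
      using e b th by (intro convexD[OF assms(1)]) simp_all
    moreover have "1 - th = th * e * s"
      using th(1) unfolding c_def by (simp add: algebra_simps)
    moreover have "th *\<^sub>R (p + e *\<^sub>R (p - z)) + (th * e * s) *\<^sub>R b
         = (th * c) *\<^sub>R p + (th * e * (1 - s)) *\<^sub>R (p - a)"
      unfolding zs c_def by (simp add: algebra_simps)
    ultimately have "p + (th * e * (1 - s)) *\<^sub>R (p - a) \<in> P" using th by simp
    moreover have "th * e * (1 - s) > 0" using th e zs by simp
    ultimately show ?thesis using a by blast
  qed
  moreover have "a \<in> ?F \<and> b \<in> ?F" if a: "a \<in> P" and b: "b \<in> P" and z: "z \<in> ?F" "z \<in> open_segment a b" for a b z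
  proof -
    obtain s where s: "z = (1 - s) *\<^sub>R a + s *\<^sub>R b" "0 < s" "s < 1"
      using z(2) by (auto simp: in_segment)
    have "z = (1 - (1 - s)) *\<^sub>R b + (1 - s) *\<^sub>R a" "0 < 1 - s" "1 - s < 1" using s by simp_all
    from *[OF b a z(1) this] *[OF a b z(1) s] show ?thesis by simp
  qed
  ultimately show ?thesis unfolding face_of_def by blast
qed

text \<open>The smallest face through \<open>p\<close> stays in the envelope: a point of the
  polytope below some \<open>z\<close> of this face, averaged with the point prolonged beyond
  \<open>p\<close>, would lie below \<open>p\<close>.\<close>

lemma lower_envelope_in_face:
  assumes p: "p \<in> lower_envelope A h"
  shows "\<exists>F. F face_of lifted_polytope A h \<and> F \<subseteq> lower_envelope A h \<and> p \<in> F"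
proof -
  let ?P = "lifted_polytope A h"
  let ?F = "{z \<in> ?P. \<exists>e>0. p + e *\<^sub>R (p - z) \<in> ?P}"
  have cP: "convex ?P" unfolding lifted_polytope_def by simp
  have pP: "p \<in> ?P" using p lower_envelope_subset by blast
  have "?F \<subseteq> lower_envelope A h"
  proof
    fix z assume z: "z \<in> ?F"
    then obtain e where e: "e > 0" "p + e *\<^sub>R (p - z) \<in> ?P" by auto
    obtain x y where zxy: "z = (x, y)" by force
    obtain px py where pp: "p = (px, py)" by force
    have "y \<le> y'" if y': "(x, y') \<in> ?P" for y'
    proof -
      \<comment> \<open>These weights bring the base point back to \<open>px\<close>. The height
        becomes \<open>py + e / (1+e) * (y' - y)\<close>, and minimality of \<open>py\<close> forces
        \<open>y \<le> y'\<close>.\<close>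
      have "(1 / (1+e)) *\<^sub>R (p + e *\<^sub>R (p - z)) + (e / (1+e)) *\<^sub>R (x, y') \<in> ?P"
        using e y' by (intro convexD[OF cP]) (simp_all add: field_simps)
      moreover have "(1 / (1+e)) *\<^sub>R (p + e *\<^sub>R (p - z)) + (e / (1+e)) *\<^sub>R (x, y')
          = (1 / (1+e)) *\<^sub>R ((p + e *\<^sub>R (p - z)) + e *\<^sub>R (x, y'))"
        unfolding scaleR_add_right by simp
      moreover have "(p + e *\<^sub>R (p - z)) + e *\<^sub>R (x, y') = ((1+e) *\<^sub>R px, (1+e) * py + e * (y' - y))"
        unfolding zxy pp by (simp add: algebra_simps)
      moreover have "(1 / (1+e)) *\<^sub>R ((1+e) *\<^sub>R px, (1+e) * py + e * (y' - y)) = (px, py + e / (1+e) * (y' - y))"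
      proof -
        have "1 + e \<noteq> 0" using e by simp
        then show ?thesis by (simp add: distrib_left scaleR_add_left[symmetric] add_divide_distrib[symmetric])
      qed
      ultimately have "(px, py + e / (1+e) * (y' - y)) \<in> ?P" by simp
      then have "py \<le> py + e / (1+e) * (y' - y)" using p unfolding pp lower_envelope_def by blast
      then have "0 \<le> e / (1+e) * (y' - y)" by simp
      then show ?thesis using e by (simp add: zero_le_mult_iff zero_le_divide_iff)
    qed
    then show "z \<in> lower_envelope A h" using z unfolding lower_envelope_def zxy by auto
  qed
  moreover have "p \<in> ?F" using pP by (auto intro!: exI[of _ 1])
  ultimately show ?thesis using minimal_face_of[OF cP pP] by blast
qed

text \<open>The part of the lifted polytope over \<open>x\<close> is compact, so the height attains
  its minimum there.\<close>

lemma lower_envelope_over: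
  fixes A :: "'a::real_normed_vector set"
  assumes "finite A" "x \<in> convex hull A"
  shows "\<exists>y. (x, y) \<in> lower_envelope A h"
proof -
  let ?P = "lifted_polytope A h"
  have "compact ?P" unfolding lifted_polytope_def using assms(1) by (intro finite_imp_compact_convex_hull) simp
  moreover have "closed (fst -` {x} :: ('a \<times> real) set)"
    by (intro closed_vimage closed_singleton continuous_on_fst continuous_on_id)
  ultimately have "compact (?P \<inter> fst -` {x})" by (rule compact_Int_closed)
  moreover have "x \<in> fst ` ?P" unfolding lifted_polytope_def fst_convex_hull_lift using assms(2) .
  then have "?P \<inter> fst -` {x} \<noteq> {}" by auto
  ultimately obtain p where p: "p \<in> ?P \<inter> fst -` {x}" "\<And>q. q \<in> ?P \<inter> fst -` {x} \<Longrightarrow> snd p \<le> snd q"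
    using continuous_attains_inf[of "?P \<inter> fst -` {x}" snd] continuous_on_snd[OF continuous_on_id] by blast
  have "p = (x, snd p)" using p(1) by (auto simp: prod_eq_iff)
  moreover have "snd p \<le> y'" if "(x, y') \<in> ?P" for y' using p(2)[of "(x, y')"] that by simp
  ultimately have "(x, snd p) \<in> lower_envelope A h" unfolding lower_envelope_def using p(1) by auto
  then show ?thesis by blast
qed

lemma affine_independent_hulls_disjoint:
  fixes S :: "'a::real_vector set"
  assumes "\<not> affine_dependent S" "finite S" "T \<subseteq> S"
  shows "affine hull T \<inter> affine hull (S - T) = {}"
proof (rule ccontr)
  assume "\<not> ?thesis"
  then obtain x where x: "x \<in> affine hull T" "x \<in> affine hull (S - T)" by auto
  have fin: "finite T" "finite (S - T)" using assms finite_subset by auto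
  obtain u v where u: "sum u T = 1" "(\<Sum>a\<in>T. u a *\<^sub>R a) = x"
    and v: "sum v (S - T) = 1" "(\<Sum>a\<in>S - T. v a *\<^sub>R a) = x"
    using x unfolding affine_hull_finite[OF fin(1)] affine_hull_finite[OF fin(2)] by blast
  define c where "c a = (if a \<in> T then u a else - v a)" for a
  have split: "sum f S = sum f T + sum f (S - T)" for f :: "'a \<Rightarrow> 'c::comm_monoid_add"
    using assms sum.subset_diff[of T S f] by (simp add: add.commute)
  have "sum c S = 0" unfolding split using u(1) v(1) by (simp add: c_def sum_negf)
  moreover have "(\<Sum>a\<in>S. c a *\<^sub>R a) = 0" unfolding split using u(2) v(2) by (simp add: c_def sum_negf)
  moreover have "\<exists>a\<in>S. c a \<noteq> 0"
  proof -
    obtain a where "a \<in> T" "u a \<noteq> 0" using u(1) by (metis sum.neutral zero_neq_one)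
    then show ?thesis using assms(3) unfolding c_def by auto
  qed
  ultimately show False using assms affine_dependent_explicit_finite by blast
qed

text \<open>The cells are the sets whose lifted hull is a face inside the envelope of a generic
  height. Genericity makes them simplices. As \<open>fst\<close> is injective on the envelope,
  intersections of lower faces project to intersections of cells, and the cells cover because every
  lower point lies in a lower face.\<close>

lemma exists_regular_triangulation:
  fixes A :: "'a::real_normed_vector set"
  assumes fin: "finite A"
  shows "\<exists>T. regular_triangulation A T"
proof -
  obtain h where h: "generic_height A h" using ex_generic_height[OF fin] by blast
  let ?l = "\<lambda>a. (a, h a)"
  let ?P = "lifted_polytope A h" and ?E = "lower_envelope A h"
  define T where "T = {S. S \<subseteq> A \<and> convex hull (?l ` S) face_of ?P \<and> convex hull (?l ` S) \<subseteq> ?E}"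
  have inj: "inj_on fst ?E" 
  proof (rule inj_onI)
    fix p q assume "p \<in> ?E" "q \<in> ?E" "fst p = fst q"
    then show "p = q" using lower_envelope_unique[of "fst p" "snd p" A h "snd q"] by (cases p, cases q) simp
  qed
  have indep: "\<not> affine_dependent S" if "S \<in> T" for S
    using generic_lower_imp_independent[OF fin h] that unfolding T_def by blast
  have face: "\<exists>S\<in>T. F = convex hull (?l ` S) \<and> S = {a \<in> A. ?l a \<in> F}"
    if F: "F face_of ?P" "F \<subseteq> ?E" for F
  proof -
    have "F = convex hull (F \<inter> ?l ` A)"
      using face_of_convex_hull_finite[of "?l ` A" F] fin F(1) unfolding lifted_polytope_def by simp
    moreover have "F \<inter> ?l ` A = ?l ` {a \<in> A. ?l a \<in> F}" by auto
    ultimately have "F = convex hull (?l ` {a \<in> A. ?l a \<in> F})" by simp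
    moreover from this have "{a \<in> A. ?l a \<in> F} \<in> T" using F unfolding T_def by simp
    ultimately show ?thesis by blast
  qed
  \<comment> \<open>No further point of \<open>A\<close> is lifted into the face over
    \<open>S\<close>: adding such an \<open>a\<close> to \<open>S\<close> would not change the
    lifted hull, so \<open>insert a S\<close> would be independent although \<open>a\<close> lies in
    the hull of \<open>S\<close>.\<close>
  have mem: "a \<in> S" if S: "S \<in> T" and a: "a \<in> A" "?l a \<in> convex hull (?l ` S)" for S a
  proof (rule ccontr)
    assume na: "a \<notin> S"
    have "convex hull (?l ` insert a S) = convex hull (?l ` S)"
      using a by (simp add: hull_redundant)
    then have "\<not> affine_dependent (insert a S)"
      using generic_lower_imp_independent[OF fin h, of "insert a S"] S a unfolding T_def by auto
    moreover have "a \<in> convex hull S"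
      using imageI[OF a(2), of fst] unfolding fst_convex_hull_lift by simp
    then have "a \<in> affine hull S" using convex_hull_subset_affine_hull by blast
    then have "a \<in> affine hull (insert a S - {a})" using na by simp
    ultimately show False unfolding affine_dependent_def by blast
  qed
  \<comment> \<open>For independent \<open>S\<close> the affine hulls of \<open>R\<close> and
    \<open>S - R\<close> are disjoint. This carries over to the lifts and makes the lift of
    \<open>R\<close> span a face of the lifted simplex.\<close>
  have sub: "R \<in> T" if S: "S \<in> T" and R: "R \<subseteq> S" for S R
  proof -
    have finS: "finite S" using S fin finite_subset unfolding T_def by blast
    have "convex hull (?l ` R) face_of convex hull (?l ` S)"
    proof (rule face_of_convex_hulls)
      show "finite (?l ` S)" "?l ` R \<subseteq> ?l ` S" using finS R by auto
      show "affine hull (?l ` R) \<inter> convex hull (?l ` S - ?l ` R) = {}"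
      proof -
        have "affine hull R \<inter> affine hull (S - R) = {}"
          using indep[OF S] R finS by (intro affine_independent_hulls_disjoint)
        moreover have "fst ` (affine hull (?l ` R)) = affine hull R" "fst ` (affine hull (?l ` (S - R))) = affine hull (S - R)"
          by (simp_all add: affine_hull_linear_image bounded_linear_fst image_image)
        moreover have "?l ` S - ?l ` R \<subseteq> ?l ` (S - R)" by auto
        then have "convex hull (?l ` S - ?l ` R) \<subseteq> affine hull (?l ` (S - R))"
          by (meson convex_hull_subset_affine_hull hull_mono order_trans)
        ultimately show ?thesis by blast
      qed
    qed
    moreover from S have "convex hull (?l ` S) face_of ?P" "convex hull (?l ` S) \<subseteq> ?E" "S \<subseteq> A"
      unfolding T_def by simp_all
    moreover have "convex hull (?l ` R) \<subseteq> convex hull (?l ` S)" using R by (intro hull_mono) auto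
    ultimately have "convex hull (?l ` R) face_of ?P" "convex hull (?l ` R) \<subseteq> ?E" "R \<subseteq> A"
      using R by (meson face_of_trans order_trans)+
    then show ?thesis unfolding T_def by simp
  qed
  have "triangulation_of A T"
    unfolding triangulation_of_def
  proof (intro conjI ballI allI impI)
    fix S R assume ST: "S \<in> T" and RT: "R \<in> T"
    let ?F = "convex hull (?l ` S)" and ?G = "convex hull (?l ` R)"
    have FG: "?F \<inter> ?G face_of ?P" "?F \<inter> ?G \<subseteq> ?E"
      using ST RT unfolding T_def by (auto intro: face_of_Int)
    from face[OF this]
    obtain Q where Q: "Q \<in> T" "?F \<inter> ?G = convex hull (?l ` Q)" "Q = {a \<in> A. ?l a \<in> ?F \<inter> ?G}"
      by blast
    have "Q = S \<inter> R"
    proof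
      show "Q \<subseteq> S \<inter> R"
      proof
        fix a assume "a \<in> Q"
        then have "a \<in> A" "?l a \<in> ?F" "?l a \<in> ?G" using Q(3) by simp_all
        then show "a \<in> S \<inter> R" using mem[OF ST] mem[OF RT] by simp
      qed
      show "S \<inter> R \<subseteq> Q"
      proof
        fix a assume a: "a \<in> S \<inter> R"
        then have "?l a \<in> ?F" "?l a \<in> ?G" by (simp_all add: hull_inc)
        moreover have "a \<in> A" using a ST unfolding T_def by auto
        ultimately show "a \<in> Q" using Q(3) by simp
      qed
    qed
    then have "fst ` (?F \<inter> ?G) = convex hull (S \<inter> R)"
      using Q(2) fst_convex_hull_lift by metis
    moreover have "fst ` (?F \<inter> ?G) = fst ` ?F \<inter> fst ` ?G"
      by (rule inj_on_image_Int[OF inj]) (use ST RT in \<open>simp_all add: T_def\<close>)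
    ultimately show "convex hull S \<inter> convex hull R = convex hull (S \<inter> R)"
      by (simp add: fst_convex_hull_lift)
  next
    show "(\<Union>S\<in>T. convex hull S) = convex hull A"
    proof
      show "(\<Union>S\<in>T. convex hull S) \<subseteq> convex hull A"
      proof (rule UN_least)
        fix S assume "S \<in> T"
        then show "convex hull S \<subseteq> convex hull A" unfolding T_def by (intro hull_mono) simp
      qed
      show "convex hull A \<subseteq> (\<Union>S\<in>T. convex hull S)"
      proof
        fix x assume "x \<in> convex hull A"
        then obtain y where "(x, y) \<in> ?E" using lower_envelope_over[OF fin] by blast
        then obtain F where F: "F face_of ?P" "F \<subseteq> ?E" "(x, y) \<in> F" using lower_envelope_in_face by blast
        then obtain S where S: "S \<in> T" "F = convex hull (?l ` S)" using face[of F] by auto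
        then have "x \<in> convex hull S" using imageI[OF F(3), of fst] by (simp add: fst_convex_hull_lift)
        then show "x \<in> (\<Union>S\<in>T. convex hull S)" using S by blast
      qed
    qed
  next
    fix S assume S: "S \<in> T"
    show "S \<subseteq> A" using S unfolding T_def by simp
    show "\<not> affine_dependent S" by (rule indep[OF S])
    fix R assume "R \<subseteq> S"
    then show "R \<in> T" by (rule sub[OF S])
  qed
  moreover have "(\<lambda>\<sigma>. convex hull \<sigma>) ` T = (\<lambda>F. fst ` F) ` {F. F face_of ?P \<and> F \<subseteq> ?E}"
  proof -
    have "(\<lambda>S. convex hull (?l ` S)) ` T = {F. F face_of ?P \<and> F \<subseteq> ?E}"
    proof
      show "(\<lambda>S. convex hull (?l ` S)) ` T \<subseteq> {F. F face_of ?P \<and> F \<subseteq> ?E}" by (auto simp: T_def)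
      show "{F. F face_of ?P \<and> F \<subseteq> ?E} \<subseteq> (\<lambda>S. convex hull (?l ` S)) ` T"
      proof
        fix F assume "F \<in> {F. F face_of ?P \<and> F \<subseteq> ?E}"
        then obtain S where "S \<in> T" "F = convex hull (?l ` S)" using face[of F] by auto
        then show "F \<in> (\<lambda>S. convex hull (?l ` S)) ` T" by simp
      qed
    qed
    then have "(\<lambda>F. fst ` F) ` {F. F face_of ?P \<and> F \<subseteq> ?E} = (\<lambda>F. fst ` F) ` (\<lambda>S. convex hull (?l ` S)) ` T"
      by simp
    also have "\<dots> = (\<lambda>\<sigma>. convex hull \<sigma>) ` T"
      by (simp add: image_image fst_convex_hull_lift)
    finally show ?thesis by simp
  qed
  ultimately show ?thesis unfolding regular_triangulation_def by blast
qed

section \<open>Linear symmetries of point configurations\<close>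

lemma triangulation_Pow:
  assumes "triangulation_of A T"
  shows "T \<subseteq> Pow A"
proof
  fix S assume "S \<in> T"
  moreover have "\<forall>S\<in>T. S \<subseteq> A \<and> \<not> affine_dependent S"
    using assms unfolding triangulation_of_def by (elim conjE)
  ultimately show "S \<in> Pow A" by simp
qed

text \<open>The two maps invert each other on \<open>A\<close> only. The linear extensions used
  later are controlled only on the span of the vertices and may collapse coordinates outside Q, so
  every argument takes place in \<open>span A\<close>.\<close>

locale linear_symmetry =
  fixes A :: "'a::real_vector set" and g g' :: "'a \<Rightarrow> 'a"
  assumes lin: "linear g" and lin': "linear g'"
    and gA: "\<And>a. a \<in> A \<Longrightarrow> g a \<in> A" and g'A: "\<And>a. a \<in> A \<Longrightarrow> g' a \<in> A"
    and g'g: "\<And>a. a \<in> A \<Longrightarrow> g' (g a) = a" and gg': "\<And>a. a \<in> A \<Longrightarrow> g (g' a) = a"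
begin

lemma g'g_span: "x \<in> span A \<Longrightarrow> g' (g x) = x"
  using linear_eq_on[of "g' \<circ> g" id x A] linear_compose[OF lin lin'] g'g by (auto simp: linear_id)

lemma inj_on_span: "inj_on g (span A)"
  using g'g_span by (metis inj_on_inverseI)

lemma inj: "inj_on g A"
  using g'g by (metis inj_on_inverseI)

lemma image_A: "g ` A = A"
  using gA g'A gg' by force

lemma hull_subset_span: "S \<subseteq> A \<Longrightarrow> convex hull S \<subseteq> span A"
  by (meson convex_hull_subset_span order_trans span_mono)

lemma convex_hull_image: "convex hull (g ` S) = g ` (convex hull S)"
  using convex_hull_linear_image[OF lin, of S] by simp

lemma image_Int: "S \<subseteq> A \<Longrightarrow> U \<subseteq> A \<Longrightarrow> g ` (S \<inter> U) = g ` S \<inter> g ` U"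
  using inj_on_image_Int[OF inj] by blast

lemma sub_image: "U \<subseteq> g ` S \<Longrightarrow> \<exists>Q\<subseteq>S. U = g ` Q"
  by (rule subset_imageE) auto

lemma sum_image:
  assumes "S \<subseteq> A"
  shows "(\<Sum>x\<in>g ` S. u (g' x) *\<^sub>R x) = g (\<Sum>x\<in>S. u x *\<^sub>R x)" "(\<Sum>x\<in>g ` S. u (g' x)) = sum u S"
proof -
  have i: "inj_on g S" using inj assms inj_on_subset by blast
  have gg: "\<And>x. x \<in> S \<Longrightarrow> g' (g x) = x" using assms g'g by blast
  show "(\<Sum>x\<in>g ` S. u (g' x) *\<^sub>R x) = g (\<Sum>x\<in>S. u x *\<^sub>R x)"
    by (simp add: sum.reindex[OF i] linear_sum[OF lin] linear_cmul[OF lin] gg)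
  show "(\<Sum>x\<in>g ` S. u (g' x)) = sum u S"
    by (simp add: sum.reindex[OF i] gg)
qed

lemma affine_dependent_image:
  assumes "S \<subseteq> A" "affine_dependent S"
  shows "affine_dependent (g ` S)"
proof -
  obtain x where x: "x \<in> S" "x \<in> affine hull (S - {x})" using assms(2) unfolding affine_dependent_def by blast
  have "g x \<in> g ` (affine hull (S - {x}))" using x by blast
  also have "\<dots> \<subseteq> affine hull (g ` (S - {x}))"
  proof (rule image_subsetI)
    fix y assume "y \<in> affine hull (S - {x})"
    then obtain F u where F: "finite F" "F \<noteq> {}" "F \<subseteq> S - {x}" "sum u F = 1" "(\<Sum>v\<in>F. u v *\<^sub>R v) = y"
      unfolding affine_hull_explicit by blast
    have "F \<subseteq> A" using F assms by blast
    then have "(\<Sum>v\<in>g ` F. u (g' v) *\<^sub>R v) = g y" "(\<Sum>v\<in>g ` F. u (g' v)) = 1"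
      using sum_image[of F u] F by simp_all
    then show "g y \<in> affine hull (g ` (S - {x}))"
      unfolding affine_hull_explicit using F
      by (intro CollectI exI[of _ "g ` F"] exI[of _ "\<lambda>v. u (g' v)"]) auto
  qed
  also have "g ` (S - {x}) = g ` S - {g x}"
    using inj_on_image_set_diff[OF inj, of S "{x}"] assms x by auto
  finally show ?thesis unfolding affine_dependent_def using x by blast
qed

end

lemma linear_symmetry_sym: "linear_symmetry A g g' \<Longrightarrow> linear_symmetry A g' g"
  unfolding linear_symmetry_def by auto

context linear_symmetry begin

lemma image_image_inv: "S \<subseteq> A \<Longrightarrow> g' ` g ` S = S"
  using g'g by force

lemma affine_dependent_image_iff: "S \<subseteq> A \<Longrightarrow> affine_dependent (g ` S) \<longleftrightarrow> affine_dependent S"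
  using affine_dependent_image[of S] linear_symmetry.affine_dependent_image[OF linear_symmetry_sym[OF linear_symmetry_axioms], of "g ` S"]
    image_image_inv[of S] gA by fastforce

lemma triangulation_image:
  assumes T: "triangulation_of A T"
  shows "triangulation_of A ((`) g ` T)"
proof -
  have TA: "\<And>S. S \<in> T \<Longrightarrow> S \<subseteq> A" and ind: "\<And>S. S \<in> T \<Longrightarrow> \<not> affine_dependent S"
    and dn: "\<And>S U. S \<in> T \<Longrightarrow> U \<subseteq> S \<Longrightarrow> U \<in> T"
    and cov: "(\<Union>\<sigma>\<in>T. convex hull \<sigma>) = convex hull A"
    and int: "\<And>S U. S \<in> T \<Longrightarrow> U \<in> T \<Longrightarrow> convex hull S \<inter> convex hull U = convex hull (S \<inter> U)"
    using T unfolding triangulation_of_def by simp_all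
  show ?thesis unfolding triangulation_of_def
  proof (intro conjI ballI allI impI)
    fix S assume S: "S \<in> (`) g ` T"
    then obtain S0 where S0: "S0 \<in> T" "S = g ` S0" by blast
    show "S \<subseteq> A" using S0 TA gA by blast
    show "\<not> affine_dependent S"
      unfolding S0(2) affine_dependent_image_iff[OF TA[OF S0(1)]] by (rule ind[OF S0(1)])
    show "U \<in> (`) g ` T" if "U \<subseteq> S" for U
    proof -
      have "\<exists>Q\<subseteq>S0. U = g ` Q" by (rule sub_image) (use that S0(2) in simp)
      then obtain Q where Q: "Q \<subseteq> S0" "U = g ` Q" by (elim exE conjE)
      then show ?thesis using dn[OF S0(1) Q(1)] by simp
    qed
    fix U assume U: "U \<in> (`) g ` T"
    then obtain U0 where U0: "U0 \<in> T" "U = g ` U0" by blast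
    \<comment> \<open>Hulls leave \<open>A\<close> but stay in \<open>span A\<close>, where
      \<open>g\<close> is injective; this is why images commute with the intersection.\<close>
    have "convex hull S \<inter> convex hull U = g ` (convex hull S0 \<inter> convex hull U0)"
      unfolding S0 U0 convex_hull_image
      using inj_on_image_Int[OF inj_on_span hull_subset_span hull_subset_span] TA S0 U0 by simp
    also have "\<dots> = g ` (convex hull (S0 \<inter> U0))" by (simp only: int[OF S0(1) U0(1)])
    also have "\<dots> = convex hull (S \<inter> U)"
      unfolding S0 U0 convex_hull_image[symmetric] using image_Int TA S0 U0 by simp
    finally show "convex hull S \<inter> convex hull U = convex hull (S \<inter> U)" .
  next
    have "(\<Union>\<sigma>\<in>(`) g ` T. convex hull \<sigma>) = g ` (\<Union>\<sigma>\<in>T. convex hull \<sigma>)"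
      by (auto simp: convex_hull_image)
    also have "\<dots> = g ` (convex hull A)" by (simp only: cov)
    finally show "(\<Union>\<sigma>\<in>(`) g ` T. convex hull \<sigma>) = convex hull A"
      by (simp add: convex_hull_image[symmetric] image_A)
  qed
qed

section \<open>Circuits, links and flips under a symmetry\<close>

lemma signed_circuitE:
  assumes "signed_circuit A Zp Zm"
  obtains u where "Zp \<union> Zm \<subseteq> A" "affine_dependent (Zp \<union> Zm)"
    "\<forall>Y. Y \<subset> Zp \<union> Zm \<longrightarrow> \<not> affine_dependent Y"
    "sum u (Zp \<union> Zm) = 0" "(\<Sum>z\<in>Zp \<union> Zm. u z *\<^sub>R z) = 0"
    "Zp = {z\<in>Zp \<union> Zm. u z > 0}" "Zm = {z\<in>Zp \<union> Zm. u z < 0}"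
  using assms unfolding signed_circuit_def Let_def by (elim conjE exE) (rule that; assumption)

lemma signed_circuit_image:
  assumes "signed_circuit A Zp Zm"
  shows "signed_circuit A (g ` Zp) (g ` Zm)"
proof -
  let ?Z = "Zp \<union> Zm"
  from assms obtain u where Z: "?Z \<subseteq> A" "affine_dependent ?Z" "\<forall>Y. Y \<subset> ?Z \<longrightarrow> \<not> affine_dependent Y"
    and u: "sum u ?Z = 0" "(\<Sum>z\<in>?Z. u z *\<^sub>R z) = 0" "Zp = {z\<in>?Z. u z > 0}" "Zm = {z\<in>?Z. u z < 0}"
    by (rule signed_circuitE)
  have im: "g ` Zp \<union> g ` Zm = g ` ?Z" by blast
  have uz: "u (g' (g z)) = u z" if "z \<in> ?Z" for z using that Z(1) g'g by auto
  have "\<not> affine_dependent Y" if Y: "Y \<subset> g ` ?Z" for Y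
  proof -
    obtain Q where Q: "Q \<subseteq> ?Z" "Y = g ` Q" using sub_image[of Y ?Z] Y by blast
    then have "Q \<subset> ?Z" using Y by blast
    then have "\<not> affine_dependent Q" using Z(3) by simp
    moreover have "Q \<subseteq> A" using Q(1) Z(1) by (rule order_trans)
    ultimately show ?thesis unfolding Q(2) by (simp add: affine_dependent_image_iff)
  qed
  moreover have "sum (u \<circ> g') (g ` ?Z) = 0" "(\<Sum>z\<in>g ` ?Z. (u \<circ> g') z *\<^sub>R z) = 0"
    using sum_image[OF Z(1), of u] u(1,2) linear_0[OF lin] by simp_all
  moreover have "g ` Zp = {z \<in> g ` ?Z. (u \<circ> g') z > 0}"
  proof -
    have "{z \<in> g ` ?Z. (u \<circ> g') z > 0} = g ` {z \<in> ?Z. u z > 0}" using uz by auto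
    then show ?thesis using u(3) by simp
  qed
  moreover have "g ` Zm = {z \<in> g ` ?Z. (u \<circ> g') z < 0}"
  proof -
    have "{z \<in> g ` ?Z. (u \<circ> g') z < 0} = g ` {z \<in> ?Z. u z < 0}" using uz by auto
    then show ?thesis using u(4) by simp
  qed
  moreover have "g ` ?Z \<subseteq> A" using Z(1) gA by blast
  ultimately show ?thesis
    unfolding signed_circuit_def Let_def im using affine_dependent_image[OF Z(1,2)] by blast
qed

lemma facets_image:
  assumes "Zp \<union> Zm \<subseteq> A"
  shows "circuit_triangulation_facets (g ` Zp) (g ` Zm) = (`) g ` circuit_triangulation_facets Zp Zm"
proof -
  have "g ` Zp \<union> g ` Zm - {g z} = g ` (Zp \<union> Zm - {z})" if "z \<in> Zp" for z
    using inj_on_image_set_diff[OF inj, of "Zp \<union> Zm" "{z}"] assms that by auto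
  then show ?thesis unfolding circuit_triangulation_facets_def by (auto simp: image_iff) metis+
qed

lemma circuit_triangulation_sub: "\<sigma> \<in> circuit_triangulation Zp Zm \<Longrightarrow> \<sigma> \<subseteq> Zp \<union> Zm"
  unfolding circuit_triangulation_def circuit_triangulation_facets_def by blast

lemma circuit_triangulation_image:
  assumes "Zp \<union> Zm \<subseteq> A"
  shows "circuit_triangulation (g ` Zp) (g ` Zm) = (`) g ` circuit_triangulation Zp Zm"
proof
  show "circuit_triangulation (g ` Zp) (g ` Zm) \<subseteq> (`) g ` circuit_triangulation Zp Zm"
  proof
    fix \<sigma> assume "\<sigma> \<in> circuit_triangulation (g ` Zp) (g ` Zm)"
    then obtain \<rho> where "\<rho> \<in> circuit_triangulation_facets Zp Zm" "\<sigma> \<subseteq> g ` \<rho>"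
      unfolding circuit_triangulation_def facets_image[OF assms] by blast
    then show "\<sigma> \<in> (`) g ` circuit_triangulation Zp Zm"
      using sub_image[of \<sigma> \<rho>] unfolding circuit_triangulation_def by blast
  qed
  show "(`) g ` circuit_triangulation Zp Zm \<subseteq> circuit_triangulation (g ` Zp) (g ` Zm)"
    unfolding circuit_triangulation_def facets_image[OF assms] by blast
qed

lemma inj_on_image_Pow: "inj_on ((`) g) (Pow A)"
  using inj inj_on_image_eq_iff by (metis PowD inj_onI)

lemma link_image:
  assumes T: "T \<subseteq> Pow A" and S: "S \<subseteq> A"
  shows "simplex_link ((`) g ` T) (g ` S) = (`) g ` simplex_link T S"
proof -
  have "g ` U \<inter> g ` S = {} \<longleftrightarrow> U \<inter> S = {}" if "U \<in> T" for U
    using image_Int[of U S] that T S by (metis PowD image_is_empty subsetD)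
  moreover have "g ` U \<union> g ` S \<in> (`) g ` T \<longleftrightarrow> U \<union> S \<in> T" if "U \<in> T" for U
  proof -
    have "U \<union> S \<in> Pow A" using that T S by blast
    then have "g ` (U \<union> S) \<in> (`) g ` T \<longleftrightarrow> U \<union> S \<in> T"
      using inj_on_image_mem_iff[OF inj_on_image_Pow] T by blast
    then show ?thesis by (simp add: image_Un)
  qed
  moreover have "simplex_link ((`) g ` T) (g ` S)
      = (`) g ` {U \<in> T. g ` U \<inter> g ` S = {} \<and> g ` U \<union> g ` S \<in> (`) g ` T}"
    unfolding simplex_link_def by blast
  ultimately show ?thesis unfolding simplex_link_def by (simp cong: conj_cong)
qed

lemma join_image: "simplicial_join ((`) g ` K) ((`) g ` M) = (`) g ` simplicial_join K M"
  unfolding simplicial_join_def by (auto simp: image_iff image_Un) (metis image_Un)+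

lemma flip_move_image:
  assumes T1: "T1 \<subseteq> Pow A" and F: "flip_move A T1 T2"
  shows "flip_move A ((`) g ` T1) ((`) g ` T2)"
proof -
  obtain Zp Zm K where c: "signed_circuit A Zp Zm" and sub: "circuit_triangulation Zp Zm \<subseteq> T1"
    and l: "\<And>\<sigma>. \<sigma> \<in> circuit_triangulation_facets Zp Zm \<Longrightarrow> simplex_link T1 \<sigma> = K"
    and T2: "T2 = (T1 - simplicial_join (circuit_triangulation Zp Zm) K)
             \<union> simplicial_join (circuit_triangulation Zm Zp) K"
    using F unfolding flip_move_def by blast
  have Z: "Zp \<union> Zm \<subseteq> A" "Zm \<union> Zp \<subseteq> A" using c by (auto elim!: signed_circuitE)
  have fsub: "\<sigma> \<subseteq> A" if "\<sigma> \<in> circuit_triangulation_facets Zp Zm" for \<sigma>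
    using that Z unfolding circuit_triangulation_facets_def by blast
  \<comment> \<open>Without a positive element there would be no facet and \<open>K\<close> would be
    an arbitrary collection. One facet makes \<open>K\<close> a link, hence part of
    \<open>T1\<close>, so that all sets involved are subsets of \<open>A\<close>, where taking
    images under \<open>g\<close> is injective.\<close>
  have "Zp \<noteq> {}"
  proof
    assume e: "Zp = {}"
    from c obtain u where z: "Zp \<union> Zm \<subseteq> A" "affine_dependent (Zp \<union> Zm)"
      "\<forall>Y. Y \<subset> Zp \<union> Zm \<longrightarrow> \<not> affine_dependent Y"
      "sum u (Zp \<union> Zm) = 0" "(\<Sum>z\<in>Zp \<union> Zm. u z *\<^sub>R z) = 0"
      "Zp = {z\<in>Zp \<union> Zm. u z > 0}" "Zm = {z\<in>Zp \<union> Zm. u z < 0}"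
      by (rule signed_circuitE)
    note u = z(4,7,2)[unfolded e Un_empty_left]
    have ne: "Zm \<noteq> {}" using u(3) unfolding affine_dependent_def by blast
    \<comment> \<open>A sum over an infinite set is 0 by convention, so finiteness must be
      established first. It follows from minimality: a dependent set has a finite dependent
      subset.\<close>
    have "finite Zm"
    proof -
      obtain F v where F: "finite F" "F \<subseteq> Zm" "sum v F = 0" "\<exists>z\<in>F. v z \<noteq> 0" "(\<Sum>z\<in>F. v z *\<^sub>R z) = 0"
        using u(3) unfolding affine_dependent_explicit by blast
      then have "affine_dependent F" using affine_dependent_explicit_finite[OF F(1)] by blast
      then have "\<not> F \<subset> Zm" using z(3) unfolding e by auto
      then have "F = Zm" using F(2) by (simp add: psubset_eq)
      then show ?thesis using F(1) by simp
    qed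
    moreover have "u z < 0" if "z \<in> Zm" for z using that u(2) by blast
    ultimately have "sum u Zm < (\<Sum>z\<in>Zm. 0)" using ne by (intro sum_strict_mono)
    then show False using u(1) by simp
  qed
  then obtain \<sigma>0 where s0: "\<sigma>0 \<in> circuit_triangulation_facets Zp Zm"
    unfolding circuit_triangulation_facets_def by blast
  then have K: "K \<subseteq> T1" using l unfolding simplex_link_def by blast
  have "simplicial_join (circuit_triangulation Zp Zm) K \<subseteq> Pow A"
    using circuit_triangulation_sub[of _ Zp Zm] K T1 Z unfolding simplicial_join_def by blast
  then have "(`) g ` (T1 - simplicial_join (circuit_triangulation Zp Zm) K)
     = (`) g ` T1 - (`) g ` simplicial_join (circuit_triangulation Zp Zm) K"
    using inj_on_image_set_diff[OF inj_on_image_Pow] T1 by (metis Diff_subset order_trans)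
  then have "(`) g ` T2 = ((`) g ` T1 - simplicial_join (circuit_triangulation (g ` Zp) (g ` Zm)) ((`) g ` K))
      \<union> simplicial_join (circuit_triangulation (g ` Zm) (g ` Zp)) ((`) g ` K)"
    unfolding T2 by (simp add: image_Un circuit_triangulation_image[OF Z(1)] circuit_triangulation_image[OF Z(2)] join_image)
  moreover have "circuit_triangulation (g ` Zp) (g ` Zm) \<subseteq> (`) g ` T1"
    using sub by (simp add: circuit_triangulation_image[OF Z(1)] image_mono)
  moreover have "\<forall>\<sigma>\<in>circuit_triangulation_facets (g ` Zp) (g ` Zm). simplex_link ((`) g ` T1) \<sigma> = (`) g ` K"
    using link_image[OF T1] l fsub by (auto simp: facets_image[OF Z(1)])
  ultimately show ?thesis unfolding flip_move_def using signed_circuit_image[OF c] by blast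
qed

lemma flip_adjacent_image:
  assumes "flip_adjacent A T1 T2"
  shows "flip_adjacent A ((`) g ` T1) ((`) g ` T2)"
proof -
  have t: "triangulation_of A T1" "triangulation_of A T2" and m: "flip_move A T1 T2 \<or> flip_move A T2 T1"
    using assms unfolding flip_adjacent_def by simp_all
  have "T1 \<subseteq> Pow A" "T2 \<subseteq> Pow A"
    using t by (simp_all only: triangulation_Pow)
  then have "flip_move A ((`) g ` T1) ((`) g ` T2) \<or> flip_move A ((`) g ` T2) ((`) g ` T1)"
    using m flip_move_image by (elim disjE) simp_all
  then show ?thesis
    unfolding flip_adjacent_def using t[THEN triangulation_image] by simp
qed

section \<open>Regularity under a symmetry\<close>

lemma lifted_polytope_image:
  "lifted_polytope A (h \<circ> g') = map_prod g id ` lifted_polytope A h"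
proof -
  have l: "linear (map_prod g id :: 'a \<times> real \<Rightarrow> 'a \<times> real)"
    using lin by (intro linearI) (auto simp: linear_add linear_cmul)
  have "(\<lambda>a. (a, (h \<circ> g') a)) ` A = (\<lambda>a. (a, (h \<circ> g') a)) ` g ` A" by (simp add: image_A)
  also have "\<dots> = map_prod g id ` (\<lambda>a. (a, h a)) ` A" using g'g by (force simp: image_image)
  finally show ?thesis unfolding lifted_polytope_def by (simp add: convex_hull_linear_image[OF l])
qed

lemma lifted_polytope_span: "lifted_polytope A h \<subseteq> span A \<times> UNIV"
proof -
  have "(\<lambda>a. (a, h a)) ` A \<subseteq> span A \<times> UNIV" by (auto intro: span_base)
  moreover have "convex (span A \<times> (UNIV :: real set))"
    by (intro convex_Times) (auto intro: subspace_imp_convex)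
  ultimately show ?thesis unfolding lifted_polytope_def by (intro hull_minimal)
qed

lemma lower_envelope_image:
  "lower_envelope A (h \<circ> g') = map_prod g id ` lower_envelope A h"
proof -
  have m: "(g x, y) \<in> lifted_polytope A (h \<circ> g') \<longleftrightarrow> (x, y) \<in> lifted_polytope A h" if "x \<in> span A" for x y
    unfolding lifted_polytope_image using that lifted_polytope_span[of h] inj_on_span
    by (force simp: inj_on_eq_iff)
  show ?thesis
  proof (intro equalityI subsetI)
    fix p assume p: "p \<in> lower_envelope A (h \<circ> g')"
    then have "p \<in> map_prod g id ` lifted_polytope A h"
      unfolding lower_envelope_def lifted_polytope_image by auto
    then obtain x y where xy: "p = (g x, y)" "(x, y) \<in> lifted_polytope A h" by auto
    have "x \<in> span A" using xy lifted_polytope_span by blast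
    then have "(x, y) \<in> lower_envelope A h"
      using p xy m unfolding lower_envelope_def by auto
    then show "p \<in> map_prod g id ` lower_envelope A h" using xy by force
  next
    fix p assume "p \<in> map_prod g id ` lower_envelope A h"
    then obtain x y where xy: "p = (g x, y)" "(x, y) \<in> lower_envelope A h" by auto
    have "x \<in> span A" using xy lifted_polytope_span unfolding lower_envelope_def by blast
    then show "p \<in> lower_envelope A (h \<circ> g')" using xy m unfolding lower_envelope_def by auto
  qed
qed

text \<open>An open segment in the image can be pulled back, because \<open>map_prod g id\<close> is
  linear and injective on \<open>span A \<times> UNIV\<close>, which contains the lifted
  polytope.\<close>

lemma face_image:
  assumes F: "F face_of lifted_polytope A h"
  shows "map_prod g id ` F face_of lifted_polytope A (h \<circ> g')"
proof -
  let ?G = "map_prod g id :: 'a \<times> real \<Rightarrow> 'a \<times> real" and ?P = "lifted_polytope A h"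
  have l: "linear ?G"
    using lin by (intro linearI) (auto simp: linear_add linear_cmul)
  have inj: "inj_on ?G (span A \<times> UNIV)"
    using inj_on_span by (auto simp: inj_on_def)
  have sP: "?P \<subseteq> span A \<times> UNIV" by (rule lifted_polytope_span)
  have FP: "F \<subseteq> ?P" and cF: "convex F" using F by (auto simp: face_of_def)
  have cP: "convex ?P" unfolding lifted_polytope_def by simp
  show ?thesis unfolding face_of_def lifted_polytope_image
  proof (intro conjI ballI impI)
    show "?G ` F \<subseteq> ?G ` ?P" using FP by blast
    show "convex (?G ` F)" using convex_linear_image[OF l cF] .
    fix a b x assume a: "a \<in> ?G ` ?P" and b: "b \<in> ?G ` ?P" and x: "x \<in> ?G ` F" and s: "x \<in> open_segment a b"
    from a obtain a0 where a0: "a0 \<in> ?P" "a = ?G a0" by (rule imageE)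
    from b obtain b0 where b0: "b0 \<in> ?P" "b = ?G b0" by (rule imageE)
    from x obtain x0 where x0: "x0 \<in> F" "x = ?G x0" by (rule imageE)
    note 0 = a0 b0 x0
    obtain u where u: "0 < u" "u < 1" "x = (1 - u) *\<^sub>R a + u *\<^sub>R b" "a \<noteq> b"
      using s by (auto simp: in_segment)
    have "?G x0 = ?G ((1 - u) *\<^sub>R a0 + u *\<^sub>R b0)"
      using u(3) 0 by (simp add: linear_add[OF l] linear_cmul[OF l])
    moreover have "(1 - u) *\<^sub>R a0 + u *\<^sub>R b0 \<in> ?P" using 0 u by (intro convexD[OF cP]) simp_all
    ultimately have "x0 = (1 - u) *\<^sub>R a0 + u *\<^sub>R b0"
      using inj_onD[OF inj] 0(5) FP sP by blast
    moreover have "a0 \<noteq> b0" using u(4) 0 by blast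
    ultimately have "x0 \<in> open_segment a0 b0" using u by (auto simp: in_segment)
    then have "a0 \<in> F \<and> b0 \<in> F" using face_ofD[OF F _ 0(1,3,5)] by blast
    then show "a \<in> ?G ` F" "b \<in> ?G ` F" using 0 by blast+
  qed
qed

lemma regular_image_aux:
  assumes "F face_of lifted_polytope A h" "F \<subseteq> lower_envelope A h"
  shows "\<exists>F'. F' face_of lifted_polytope A (h \<circ> g') \<and> F' \<subseteq> lower_envelope A (h \<circ> g') \<and> fst ` F' = g ` fst ` F"
  using face_image[OF assms(1)] assms(2) lower_envelope_image[of h]
  by (intro exI[of _ "map_prod g id ` F"]) (auto simp: image_image)

lemma regular_image_aux':
  assumes "F face_of lifted_polytope A (h \<circ> g')" "F \<subseteq> lower_envelope A (h \<circ> g')"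
  shows "\<exists>F'. F' face_of lifted_polytope A h \<and> F' \<subseteq> lower_envelope A h \<and> g ` fst ` F' = fst ` F"
proof -
  interpret s: linear_symmetry A g' g using linear_symmetry_sym linear_symmetry_axioms .
  \<comment> \<open>The functions \<open>h \<circ> g' \<circ> g\<close> and \<open>h\<close> may
    differ outside \<open>A\<close>, but a lift depends only on the heights on
    \<open>A\<close>.\<close>
  have eq: "lifted_polytope A (h \<circ> g' \<circ> g) = lifted_polytope A h"
    using g'g unfolding lifted_polytope_def by (intro arg_cong[where f="(hull) convex"] image_cong) auto
  then have eq': "lower_envelope A (h \<circ> g' \<circ> g) = lower_envelope A h"
    unfolding lower_envelope_def by simp
  obtain F' where F': "F' face_of lifted_polytope A h" "F' \<subseteq> lower_envelope A h" "fst ` F' = g' ` fst ` F"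
    using s.regular_image_aux[OF assms] unfolding eq eq' by blast
  have "fst ` F \<subseteq> span A" using face_of_imp_subset[OF assms(1)] lifted_polytope_span by force
  then have "g ` g' ` fst ` F = fst ` F" using s.g'g_span by force
  then show ?thesis using F' by (intro exI[of _ F']) simp
qed

text \<open>The transported height \<open>h \<circ> g'\<close> is a witness: with it the symmetry
  acts on lifted points by \<open>g\<close> on the base and leaves heights unchanged, so lower faces
  go to lower faces and, by the inverse symmetry, every lower face arises in this way.\<close>

lemma regular_image:
  assumes "regular_triangulation A T"
  shows "regular_triangulation A ((`) g ` T)"
proof -
  have T: "triangulation_of A T" using assms unfolding regular_triangulation_def by simp
  obtain h where h: "(\<lambda>\<sigma>. convex hull \<sigma>) ` T =
          (\<lambda>F. fst ` F) ` {F. F face_of lifted_polytope A h \<and> F \<subseteq> lower_envelope A h}"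
    using assms unfolding regular_triangulation_def by blast
  define \<F> where "\<F> = (\<lambda>k. {F. F face_of lifted_polytope A k \<and> F \<subseteq> lower_envelope A k})"
  have e1: "(\<lambda>\<sigma>. convex hull \<sigma>) ` (`) g ` T = (`) g ` (`) fst ` \<F> h"
    unfolding \<F>_def h[symmetric] by (simp add: image_image convex_hull_image)
  have e2: "(`) g ` (`) fst ` \<F> h \<subseteq> (`) fst ` \<F> (h \<circ> g')"
  proof
    fix W assume "W \<in> (`) g ` (`) fst ` \<F> h"
    then obtain F where F: "F \<in> \<F> h" "W = g ` fst ` F" by blast
    then obtain F' where "F' \<in> \<F> (h \<circ> g')" "fst ` F' = g ` fst ` F"
      using regular_image_aux[of F h] unfolding \<F>_def by blast
    then show "W \<in> (`) fst ` \<F> (h \<circ> g')" using F(2) by blast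
  qed
  have e3: "(`) fst ` \<F> (h \<circ> g') \<subseteq> (`) g ` (`) fst ` \<F> h"
  proof
    fix W assume "W \<in> (`) fst ` \<F> (h \<circ> g')"
    then obtain F where F: "F \<in> \<F> (h \<circ> g')" "W = fst ` F" by blast
    then obtain F' where "F' \<in> \<F> h" "g ` fst ` F' = fst ` F"
      using regular_image_aux'[of F h] unfolding \<F>_def by blast
    then show "W \<in> (`) g ` (`) fst ` \<F> h" using F(2) by blast
  qed
  have "(\<lambda>\<sigma>. convex hull \<sigma>) ` (`) g ` T = (`) fst ` \<F> (h \<circ> g')"
    unfolding e1 by (rule subset_antisym[OF e2 e3])
  then show ?thesis
    unfolding regular_triangulation_def \<F>_def by (intro conjI triangulation_image[OF T] exI)
qed

end

section \<open>The lattice and its order polytope\<close>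

text \<open>The element \<open>y\<close> of \<open>Sq(w\<^sub>i)\<close>, with the convention that the square \<open>Sq(w\<^sub>0)\<close> has top 0.\<close>

definition ytop :: "word \<Rightarrow> nat \<Rightarrow> nat" where
  "ytop w i = (if i = 0 then 0
     else if (i = 1 \<and> word_letter w 1 = L) \<or> (i \<ge> 2 \<and> word_letter w (i - 1) \<noteq> word_letter w i)
     then 2 * i - 1 else 2 * i)"

text \<open>The recursion of \<open>snake_rel\<close> solved for the smaller element
  \<open>a\<close> of a cover pair, with no bound on the numbers. Numbers grow downwards in the
  poset, and each prefix of the word is obtained by bounding \<open>a\<close>.\<close>

definition cov :: "word \<Rightarrow> nat \<Rightarrow> nat \<Rightarrow> bool" where
  "cov w a b \<longleftrightarrow> (odd a \<and> a \<ge> 3 \<and> (b = a - 1 \<or> b = a - 2)) \<or> (a = 1 \<and> b = 0)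
     \<or> (even a \<and> a \<ge> 2 \<and> b = ytop w (a div 2 - 1))"

lemma ytop_0 [simp]: "ytop w 0 = 0" by (simp add: ytop_def)

lemma ytop_cases: "i \<ge> 1 \<Longrightarrow> ytop w i = 2 * i - 1 \<or> ytop w i = 2 * i"
  by (simp add: ytop_def)

lemma ytop_le: "ytop w i \<le> 2 * i"
  by (simp add: ytop_def)

lemma ytop_ge: "2 * i - 1 \<le> ytop w i"
  by (simp add: ytop_def)

lemma cov_odd: "cov w (2 * i + 3) b \<longleftrightarrow> b = 2 * i + 2 \<or> b = 2 * i + 1"
  unfolding cov_def by auto

lemma cov_even: "cov w (2 * i + 2) b \<longleftrightarrow> b = ytop w i"
  unfolding cov_def by auto

lemma cov_0: "\<not> cov w 0 b" and cov_1: "cov w 1 b \<longleftrightarrow> b = 0"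
  unfolding cov_def by auto

lemma cov_2: "cov w (Suc (Suc 0)) b \<longleftrightarrow> b = 0"
  unfolding cov_def by auto

lemmas cov_simps = cov_2 cov_odd cov_0 cov_even cov_even[simplified] cov_1 cov_1[simplified]

text \<open>Square \<open>i\<close> contributes the new elements \<open>2 * i + 2\<close> and
  \<open>2 * i + 3\<close>; square 0 has in addition 0 and 1.\<close>

lemma nat_shapes: obtains "a = 0" | "a = 1" | i where "a = 2 * i + 2" | i where "a = 2 * i + (3::nat)"
proof -
  have "a = 0 \<or> a = 1 \<or> (a \<ge> 2 \<and> even a) \<or> (a \<ge> 3 \<and> odd a)" by presburger
  then consider "a = 0" | "a = 1" | "a \<ge> 2" "even a" | "a \<ge> 3" "odd a" by blast
  then show thesis
  proof cases
    case 3
    then have "a = 2 * (a div 2 - 1) + 2" by presburger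
    then show thesis using that(3) by blast
  next
    case 4
    then have "a = 2 * (a div 2 - 1) + 3" by presburger
    then show thesis using that(4) by blast
  qed (use that in auto)
qed

lemma cov_less: "cov w a b \<Longrightarrow> b < a"
proof (cases a rule: nat_shapes)
  case (3 i)
  then show "cov w a b \<Longrightarrow> b < a" using ytop_le[of w i] by (simp add: cov_simps)
qed (auto simp: cov_simps)

lemma snake_rel_iff: "(a, b) \<in> snake_rel w n \<longleftrightarrow> a \<le> 2 * n + 3 \<and> cov w a b"
proof (induction n)
  case 0
  show ?case
  proof (cases a rule: nat_shapes)
    case (3 i)
    then show ?thesis by (cases "i = 0") (auto simp: cov_simps)
  qed (auto simp: cov_simps)
next
  case (Suc m)
  have y: "ytop w (Suc m) = (if (Suc m = 1 \<and> word_letter w (Suc m) = L)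
     \<or> (Suc m \<ge> 2 \<and> word_letter w (Suc m - 1) \<noteq> word_letter w (Suc m)) then 2 * Suc m - 1 else 2 * Suc m)"
    unfolding ytop_def by auto
  have "(a, b) \<in> snake_rel w (Suc m) \<longleftrightarrow> (a, b) \<in> snake_rel w m
      \<or> (a = 2 * Suc m + 3 \<and> (b = 2 * Suc m + 1 \<or> b = 2 * Suc m + 2))
      \<or> (a = 2 * Suc m + 2 \<and> b = ytop w (Suc m))"
    unfolding y by (auto simp: Let_def)
  also have "\<dots> \<longleftrightarrow> (a \<le> 2 * m + 3 \<and> cov w a b)
      \<or> (a = 2 * Suc m + 3 \<and> cov w a b) \<or> (a = 2 * Suc m + 2 \<and> cov w a b)"
    unfolding Suc.IH using cov_odd[of w "Suc m" b] cov_even[of w "Suc m" b] by blast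
  also have "\<dots> \<longleftrightarrow> a \<le> 2 * Suc m + 3 \<and> cov w a b" by auto
  finally show ?case .
qed

section \<open>The order in terms of the numbering\<close>

definition ple :: "word \<Rightarrow> nat \<Rightarrow> nat \<Rightarrow> bool" where
  "ple w a b \<longleftrightarrow> (a, b) \<in> (snake_rel w (length w))\<^sup>*"

lemma ple_refl [simp]: "ple w a a" by (simp add: ple_def)

lemma ple_unfold: "a \<le> 2 * length w + 3 \<Longrightarrow> ple w a b \<longleftrightarrow> a = b \<or> (\<exists>c. cov w a c \<and> ple w c b)"
  unfolding ple_def by (auto elim: converse_rtranclE simp: snake_rel_iff intro: converse_rtrancl_into_rtrancl)

lemma ple_le: "ple w a b \<Longrightarrow> b \<le> a"
  unfolding ple_def by (induction rule: rtrancl_induct) (auto simp: snake_rel_iff dest!: cov_less)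

lemma ple_0 [simp]: "ple w 0 b \<longleftrightarrow> b = 0"
  using ple_le[of w 0 b] by auto

text \<open>Element \<open>2 * i + 3\<close> lies below \<open>2 * i + 1\<close> and
  \<open>2 * i + 2\<close>, so by induction it lies below everything added before it.\<close>

lemma ple_odd: "odd a \<Longrightarrow> a \<le> 2 * length w + 3 \<Longrightarrow> ple w a b \<longleftrightarrow> b \<le> a"
proof (induction a arbitrary: b rule: less_induct)
  case (less a)
  show ?case
  proof (cases a rule: nat_shapes)
    case 2
    then show ?thesis using ple_unfold[of 1 w b] by (auto simp: cov_simps le_Suc_eq)
  next
    case (4 i)
    have "ple w (2 * i + 1) c \<longleftrightarrow> c \<le> 2 * i + 1" for c
    proof -
      have "2 * i + 1 < a" "odd (2 * i + 1)" "2 * i + 1 \<le> 2 * length w + 3" using 4 less.prems by simp_all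
      from less.IH[OF this] show ?thesis .
    qed
    moreover have "ple w a b \<longleftrightarrow> a = b \<or> ple w (2 * i + 2) b \<or> ple w (2 * i + 1) b"
      using ple_unfold[OF less.prems(2)] unfolding 4 cov_odd by blast
    ultimately have *: "ple w a b \<longleftrightarrow> a = b \<or> ple w (2 * i + 2) b \<or> b \<le> 2 * i + 1" by blast
    show ?thesis
    proof
      assume "b \<le> a"
      then consider "b = a" | "b = 2 * i + 2" | "b \<le> 2 * i + 1" using 4 by linarith
      then show "ple w a b" unfolding * by cases (blast, metis ple_refl, blast)
    qed (rule ple_le)
  qed (use less.prems in auto)
qed

lemma ple_even: "i \<le> length w \<Longrightarrow> ple w (2 * i + 2) b \<longleftrightarrow> b = 2 * i + 2 \<or> ple w (ytop w i) b"
  using ple_unfold[of "2 * i + 2" w b] by (auto simp: cov_simps)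

lemma ple_zero: "a \<le> 2 * length w + 3 \<Longrightarrow> ple w a 0"
proof (induction a rule: less_induct)
  case (less a)
  show ?case
  proof (cases a rule: nat_shapes)
    case (3 i)
    then have "ple w (ytop w i) 0" using ytop_le[of w i] less.prems by (intro less.IH) auto
    then show ?thesis using ple_even[of i w 0] less.prems unfolding 3 by simp
  qed (use less.prems in \<open>auto simp: ple_odd\<close>)
qed

lemma hat_le_Elt [simp]: "hat_le w (Elt a) (Elt b) \<longleftrightarrow> a \<le> 2 * length w + 3 \<and> ple w a b"
  unfolding hat_le_def V0_def P_elts_def ple_def[symmetric] using ple_le by fastforce

lemma hat_le_simps [simp]:
  "hat_le w Zero_hat x \<longleftrightarrow> x \<in> V0 w" "hat_le w x One_hat \<longleftrightarrow> x \<in> V0 w"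
  "hat_le w x Zero_hat \<longleftrightarrow> x = Zero_hat" "hat_le w One_hat x \<longleftrightarrow> x = One_hat"
  unfolding hat_le_def V0_def P_elts_def by auto

lemma V0_simps [simp]: "Zero_hat \<in> V0 w" "One_hat \<in> V0 w" "Elt n \<in> V0 w \<longleftrightarrow> n \<le> 2 * length w + 3"
  unfolding V0_def P_elts_def by auto

lemma finite_V0 [simp]: "finite (V0 w)" unfolding V0_def P_elts_def by simp

lemma P_elts_iff [simp]: "Elt n \<in> P_elts w \<longleftrightarrow> n \<le> 2 * length w + 3" "Zero_hat \<notin> P_elts w" "One_hat \<notin> P_elts w"
  unfolding P_elts_def by auto

lemma hat_le_antisym: "hat_le w x y \<Longrightarrow> hat_le w y x \<Longrightarrow> x = y"
  by (cases x; cases y) (auto dest: ple_le intro: order_antisym)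

lemma hat_le_refl: "x \<in> V0 w \<Longrightarrow> hat_le w x x"
  by (cases x) auto

section \<open>Covers and meet-irreducible elements\<close>

lemma covered_in_principal:
  assumes "S \<subseteq> V0 w" "x \<in> S" "y \<in> S" "\<And>z. z \<in> S \<Longrightarrow> hat_less w x z \<longleftrightarrow> hat_le w y z"
  shows "covered_in w S x z \<longleftrightarrow> z = y"
proof -
  have "hat_le w y y" using assms hat_le_refl by blast
  then show ?thesis using assms hat_le_antisym unfolding covered_in_def hat_less_def by blast
qed

lemma hat_less_even:
  "i \<le> length w \<Longrightarrow> z \<in> V0 w \<Longrightarrow> hat_less w (Elt (2 * i + 2)) z \<longleftrightarrow> hat_le w (Elt (ytop w i)) z"
proof -
  assume i: "i \<le> length w" and z: "z \<in> V0 w"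
  have y: "ytop w i \<le> 2 * i" by (rule ytop_le)
  show ?thesis
  proof (cases z)
    case (Elt b)
    then show ?thesis unfolding hat_less_def using ple_even[OF i, of b] y i ple_le[of w "ytop w i" b] by auto
  qed (use i y in \<open>auto simp: hat_less_def\<close>)
qed

lemma covered_even_P: "i \<le> length w \<Longrightarrow> covered_in w (P_elts w) (Elt (2 * i + 2)) z \<longleftrightarrow> z = Elt (ytop w i)"
  using ytop_le[of w i] by (intro covered_in_principal hat_less_even) (auto simp: V0_def)

text \<open>On a meet-irreducible element this is its unique cover.\<close>

definition up :: "word \<Rightarrow> elt \<Rightarrow> elt" where
  "up w x = (case x of Zero_hat \<Rightarrow> Elt (2 * length w + 3) | One_hat \<Rightarrow> One_hat
     | Elt n \<Rightarrow> if n = 0 then One_hat else if n = 1 then Elt 0 else Elt (ytop w (n div 2 - 1)))"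

lemma covered_even_V0: "i \<le> length w \<Longrightarrow> covered_in w (V0 w) (Elt (2 * i + 2)) z \<longleftrightarrow> z = Elt (ytop w i)"
  using ytop_le[of w i] by (intro covered_in_principal hat_less_even) auto

lemma covered_Zero: "covered_in w (V0 w) Zero_hat z \<longleftrightarrow> z = Elt (2 * length w + 3)"
proof (intro covered_in_principal)
  fix z assume "z \<in> V0 w"
  then show "hat_less w Zero_hat z \<longleftrightarrow> hat_le w (Elt (2 * length w + 3)) z"
    by (cases z) (auto simp: hat_less_def ple_odd)
qed auto

lemma covered_Elt0: "covered_in w (V0 w) (Elt 0) z \<longleftrightarrow> z = One_hat"
proof (intro covered_in_principal)
  fix z assume "z \<in> V0 w"
  then show "hat_less w (Elt 0) z \<longleftrightarrow> hat_le w One_hat z"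
    by (cases z) (auto simp: hat_less_def)
qed auto

lemma covered_Elt1: "covered_in w (V0 w) (Elt 1) z \<longleftrightarrow> z = Elt 0"
proof (intro covered_in_principal)
  fix z assume "z \<in> V0 w"
  then show "hat_less w (Elt 1) z \<longleftrightarrow> hat_le w (Elt 0) z"
    by (cases z) (auto simp: hat_less_def ple_odd)
qed auto

lemma covered_odd:
  assumes "i \<le> length w"
  shows "covered_in w (V0 w) (Elt (2 * i + 3)) (Elt (2 * i + 2))" "covered_in w (V0 w) (Elt (2 * i + 3)) (Elt (2 * i + 1))"
proof -
  have "\<not> (hat_less w (Elt (2 * i + 3)) z \<and> hat_less w z (Elt (2 * i + 2)))" for z
    by (cases z) (auto simp: hat_less_def dest!: ple_le)
  then show "covered_in w (V0 w) (Elt (2 * i + 3)) (Elt (2 * i + 2))"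
    using assms by (auto simp: covered_in_def hat_less_def ple_odd)
  have "\<not> (hat_less w (Elt (2 * i + 3)) z \<and> hat_less w z (Elt (2 * i + 1)))" for z
  proof (cases z)
    case (Elt b)
    show ?thesis
    proof
      assume "hat_less w (Elt (2 * i + 3)) z \<and> hat_less w z (Elt (2 * i + 1))"
      then have b: "b \<le> 2 * i + 3" "b \<noteq> 2 * i + 3" "2 * i + 1 \<le> b" "b \<noteq> 2 * i + 1" and p: "ple w b (2 * i + 1)"
        unfolding Elt hat_less_def by (auto dest: ple_le)
      then have "b = 2 * i + 2" by linarith
      then show False using p ple_even[OF assms, of "2 * i + 1"] ple_le[of w "ytop w i" "2 * i + 1"] ytop_le[of w i] by auto
    qed
  qed (auto simp: hat_less_def)
  then show "covered_in w (V0 w) (Elt (2 * i + 3)) (Elt (2 * i + 1))"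
    using assms by (auto simp: covered_in_def hat_less_def ple_odd)
qed

text \<open>The bottom \<open>2 * i + 3\<close> of a square has two covers, while an even element
  has the single cover \<open>ytop\<close>; 0, 1 and \<open>Zero_hat\<close> have one cover
  each.\<close>

lemma Q_elts_iff [simp]:
  "Zero_hat \<in> Q_elts w" "One_hat \<notin> Q_elts w"
  "Elt n \<in> Q_elts w \<longleftrightarrow> n \<le> 2 * length w + 3 \<and> (n = 1 \<or> even n)"
proof -
  show "Zero_hat \<in> Q_elts w" "One_hat \<notin> Q_elts w" unfolding Q_elts_def by (auto simp: covered_Zero)
  show "Elt n \<in> Q_elts w \<longleftrightarrow> n \<le> 2 * length w + 3 \<and> (n = 1 \<or> even n)"
  proof (cases n rule: nat_shapes)
    case (4 i)
    have "\<not> (\<exists>!y. covered_in w (V0 w) (Elt (2 * i + 3)) y)" if "i \<le> length w"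
      using covered_odd[OF that] by (metis elt.inject n_not_Suc_n add_Suc_right One_nat_def Suc_1)
    then show ?thesis unfolding Q_elts_def using 4 by auto
  next
    case (3 i)
    then show ?thesis unfolding Q_elts_def using covered_even_V0[of i w] by auto
  qed (auto simp: Q_elts_def covered_Elt0 covered_Elt1[simplified])
qed

lemma Q_subset_V0: "Q_elts w \<subseteq> V0 w" unfolding Q_elts_def by blast

lemma finite_Q [simp]: "finite (Q_elts w)" using finite_subset[OF Q_subset_V0] by simp

section \<open>Vertices, square relations and linear extension\<close>

lemma lookup_vertex_of:
  "Poly_Mapping.lookup (vertex_of w x) q = (if q \<in> Q_elts w \<and> hat_le w x q then 1 else 0)"
proof -
  have "Poly_Mapping.lookup (vertex_of w x) q
     = (\<Sum>p\<in>{q \<in> Q_elts w. hat_le w x q}. if p = q then 1 else 0)"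
    unfolding vertex_of_def lookup_sum by (intro sum.cong) (auto simp: lookup_single when_def)
  then show ?thesis by simp
qed

lemma vertex_of_One [simp]: "vertex_of w One_hat = 0"
  by (intro poly_mapping_eqI) (auto simp: lookup_vertex_of)

text \<open>This is inclusion-exclusion for filters: \<open>2 * i + 3\<close> is the meet and
  \<open>ytop w i\<close> the join of \<open>2 * i + 1\<close> and \<open>2 * i + 2\<close>, and a
  meet-irreducible element of a distributive lattice is above a meet only if it is above one of the
  two terms.\<close>

lemma square_relation:
  assumes "i \<le> length w"
  shows "vertex_of w (Elt (2 * i + 3)) + vertex_of w (Elt (ytop w i))
       = vertex_of w (Elt (2 * i + 1)) + vertex_of w (Elt (2 * i + 2))"
proof (intro poly_mapping_eqI)
  fix q
  show "Poly_Mapping.lookup (vertex_of w (Elt (2 * i + 3)) + vertex_of w (Elt (ytop w i))) q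
      = Poly_Mapping.lookup (vertex_of w (Elt (2 * i + 1)) + vertex_of w (Elt (2 * i + 2))) q"
  proof (cases "q \<in> Q_elts w")
    case True
    show ?thesis
    proof (cases q)
      case (Elt n)
      have n: "n = 1 \<or> even n" using True Elt by simp
      have y: "ytop w i \<le> 2 * i" by (rule ytop_le)
      have 1: "ple w (2 * i + 3) n \<longleftrightarrow> n \<le> 2 * i + 2"
      proof -
        have "n \<noteq> 2 * i + 3" using n by auto
        then show ?thesis using ple_odd[of "2 * i + 3" w n] assms by auto
      qed
      have 2: "ple w (2 * i + 1) n \<longleftrightarrow> n \<le> 2 * i + 1" using ple_odd[of "2 * i + 1" w n] assms by auto
      have 3: "ple w (2 * i + 2) n \<longleftrightarrow> n = 2 * i + 2 \<or> ple w (ytop w i) n" by (rule ple_even[OF assms])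
      have 4: "n \<le> 2 * i" if "ple w (ytop w i) n" using ple_le[OF that] y by simp
      have le: "2 * i + 3 \<le> 2 * length w + 3" "2 * i + 2 \<le> 2 * length w + 3" "2 * i + 1 \<le> 2 * length w + 3"
        "ytop w i \<le> 2 * length w + 3" using assms y by simp_all
      consider "n \<le> 2 * i + 1" | "n = 2 * i + 2" | "n > 2 * i + 2" by linarith
      then show ?thesis
        unfolding lookup_add lookup_vertex_of Elt hat_le_Elt 1 2 3 using True Elt le 4 by cases auto
    qed (use True in \<open>auto simp: lookup_add lookup_vertex_of\<close>)
  qed (simp add: lookup_add lookup_vertex_of)
qed

lemma lookup_scaleR [simp]:
  "Poly_Mapping.lookup (r *\<^sub>R x) i = r * Poly_Mapping.lookup x i" for x :: "'a \<Rightarrow>\<^sub>0 real"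
proof -
  have "finite {i. r * Poly_Mapping.lookup x i \<noteq> 0}"
    by (rule finite_subset[OF _ finite_keys[of x]]) (auto simp: in_keys_iff)
  then show ?thesis unfolding scaleR_poly_mapping_def by (simp add: Abs_poly_mapping_inverse)
qed

lemma Q_elts_cases:
  assumes "q \<in> Q_elts w"
  obtains "q = Zero_hat" | "q = Elt 0" | "q = Elt 1" | i where "i \<le> length w" "q = Elt (2 * i + 2)"
proof (cases q)
  case (Elt n)
  show thesis
  proof (cases n rule: nat_shapes)
    case (3 i)
    then have "i \<le> length w" using assms Elt by simp
    then show thesis using that(4) Elt 3 by blast
  next
    case (4 i)
    then show thesis using assms Elt by simp
  qed (use that Elt in auto)
qed (use that assms in auto)

lemma up_even: "up w (Elt (2 * i + 2)) = Elt (ytop w i)"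
  by (simp add: up_def)

lemma hat_le_up:
  assumes "q \<in> Q_elts w" "p \<in> Q_elts w"
  shows "hat_le w q p \<longleftrightarrow> p = q \<or> hat_le w (up w q) p"
proof -
  have p: "p \<in> V0 w" using assms(2) Q_subset_V0 by blast
  from assms(1) show ?thesis
  proof (cases q rule: Q_elts_cases)
    case 1
    then show ?thesis using p by (cases p) (auto simp: up_def ple_odd)
  next
    case 2
    then show ?thesis using assms(2) by (cases p) (auto simp: up_def)
  next
    case 3
    then show ?thesis using assms(2) by (cases p) (auto simp: up_def ple_odd)
  next
    case (4 i)
    have "ytop w i \<le> 2 * i" by (rule ytop_le)
    moreover have "hat_le w q p \<longleftrightarrow> p = q \<or> hat_less w q p"
      using hat_le_refl[OF p] unfolding hat_less_def by auto
    ultimately show ?thesis unfolding 4 up_even using hat_less_even[OF 4(1) p] by blast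
  qed
qed

lemma not_hat_le_up: assumes "q \<in> Q_elts w" shows "\<not> hat_le w (up w q) q"
  using assms
proof (cases q rule: Q_elts_cases)
  case (4 i)
  then show ?thesis unfolding 4 up_even using ytop_le[of w i] by (auto dest: ple_le)
qed (auto simp: up_def)

lemma vertex_of_up:
  assumes "q \<in> Q_elts w"
  shows "vertex_of w q = Poly_Mapping.single q 1 + vertex_of w (up w q)"
proof (intro poly_mapping_eqI)
  fix p
  show "Poly_Mapping.lookup (vertex_of w q) p
     = Poly_Mapping.lookup (Poly_Mapping.single q 1 + vertex_of w (up w q)) p"
    using assms hat_le_up[OF assms, of p] not_hat_le_up[OF assms]
    by (auto simp: lookup_add lookup_vertex_of lookup_single when_def)
qed

text \<open>
  A map of \<open>V\<^sub>0\<close> that preserves the square relations extends to a linear map of \<open>\<real>\<^sup>Q\<close>: the unit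
  vector of a meet-irreducible element is the difference of the vertices of the element and its cover.
\<close>

lemma linear_extension:
  assumes one: "\<tau> One_hat = One_hat"
    and sq: "\<And>i. i \<le> length w \<Longrightarrow> vertex_of w (\<tau> (Elt (2 * i + 3))) + vertex_of w (\<tau> (Elt (ytop w i)))
       = vertex_of w (\<tau> (Elt (2 * i + 1))) + vertex_of w (\<tau> (Elt (2 * i + 2)))"
  shows "\<exists>g. linear g \<and> (\<forall>x\<in>V0 w. g (vertex_of w x) = vertex_of w (\<tau> x))"
proof -
  define g where "g x = (\<Sum>q\<in>Q_elts w. Poly_Mapping.lookup x q *\<^sub>R
     (vertex_of w (\<tau> q) - vertex_of w (\<tau> (up w q))))" for x :: "elt \<Rightarrow>\<^sub>0 real"
  have lin: "linear g"
    by (intro linearI)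
      (simp_all add: g_def lookup_add scaleR_add_left sum.distrib scaleR_sum_right)
  have single: "g (Poly_Mapping.single q 1) = vertex_of w (\<tau> q) - vertex_of w (\<tau> (up w q))"
    if "q \<in> Q_elts w" for q
  proof -
    have "g (Poly_Mapping.single q 1) = (\<Sum>p\<in>Q_elts w. if p = q then
        vertex_of w (\<tau> p) - vertex_of w (\<tau> (up w p)) else 0)"
      unfolding g_def by (intro sum.cong) (auto simp: lookup_single when_def)
    then show ?thesis using that by simp
  qed
  have Q: "g (vertex_of w q) = vertex_of w (\<tau> q)"
    if "q \<in> Q_elts w" "g (vertex_of w (up w q)) = vertex_of w (\<tau> (up w q))" for q
    using that single unfolding vertex_of_up[OF that(1)] linear_add[OF lin] by simp
  have One: "g (vertex_of w One_hat) = vertex_of w (\<tau> One_hat)"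
    by (simp add: one linear_0[OF lin])
  have E: "g (vertex_of w (Elt n)) = vertex_of w (\<tau> (Elt n))" if "n \<le> 2 * length w + 3" for n
    using that
  proof (induction n rule: less_induct)
    case (less n)
    show ?case
    proof (cases n rule: nat_shapes)
      case 1
      then show ?thesis using Q[of "Elt 0"] One by (simp add: up_def)
    next
      case 2
      then show ?thesis using Q[of "Elt 1"] less.IH[of 0] by (simp add: up_def)
    next
      case (3 i)
      then have i: "i \<le> length w" using less.prems by simp
      have "g (vertex_of w (Elt (ytop w i))) = vertex_of w (\<tau> (Elt (ytop w i)))"
        using ytop_le[of w i] less.prems 3 by (intro less.IH) auto
      then have "g (vertex_of w (up w (Elt (2 * i + 2)))) = vertex_of w (\<tau> (up w (Elt (2 * i + 2))))"
        by (simp only: up_even)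
      then show ?thesis unfolding 3 by (rule Q[rotated]) (use i in simp)
    next
      \<comment> \<open>These elements are not meet-irreducible. Their vertices are determined by
        the square relation, which holds both for the vertices and for their images under
        \<tau>.\<close>
      case (4 i)
      then have i: "i \<le> length w" using less.prems by simp
      have "g (vertex_of w (Elt (ytop w i))) = vertex_of w (\<tau> (Elt (ytop w i)))"
        using ytop_le[of w i] less.prems 4 by (intro less.IH; simp)
      moreover have "g (vertex_of w (Elt (2 * i + 1))) = vertex_of w (\<tau> (Elt (2 * i + 1)))"
        using less.prems 4 by (intro less.IH; simp)
      moreover have "g (vertex_of w (Elt (2 * i + 2))) = vertex_of w (\<tau> (Elt (2 * i + 2)))"
        using less.prems 4 by (intro less.IH; simp)
      moreover have "g (vertex_of w (Elt (2 * i + 3))) + g (vertex_of w (Elt (ytop w i)))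
         = g (vertex_of w (Elt (2 * i + 1))) + g (vertex_of w (Elt (2 * i + 2)))"
        unfolding linear_add[OF lin, symmetric] square_relation[OF i] ..
      ultimately show ?thesis unfolding 4 using sq[OF i] by (metis add_right_cancel)
    qed
  qed
  have "g (vertex_of w x) = vertex_of w (\<tau> x)" if "x \<in> V0 w" for x
  proof (cases x)
    case Zero_hat
    have "up w Zero_hat = Elt (2 * length w + 3)" by (simp add: up_def)
    then show ?thesis unfolding Zero_hat using E[of "2 * length w + 3"] Q[of Zero_hat] by simp
  qed (use that One E in auto)
  then show ?thesis using lin by blast
qed

text \<open>The witness \<open>e\<close> is what separates the filters of \<open>2 * i + 2\<close>
  and \<open>2 * i + 3\<close>. Along a straight run, where the top is the preceding even element,
  \<open>e\<close> is inherited; where the top is odd, \<open>e\<close> is the preceding even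
  element itself. At the start \<open>e\<close> is 1.\<close>

lemma missing_elt:
  assumes "i \<le> length w"
  shows "\<exists>e \<le> 2 * i + 2. (e = 1 \<or> even e) \<and>
    (\<forall>n \<le> 2 * i + 2. n = 1 \<or> even n \<longrightarrow> (ple w (2 * i + 2) n \<longleftrightarrow> n \<noteq> e))"
  using assms
proof (induction i)
  case 0
  have "ple w (2 * 0 + 2) n \<longleftrightarrow> n \<noteq> 1" if "n \<le> 2 * 0 + 2" for n
    using ple_even[of 0 w n] that by (auto simp: numeral_2_eq_2 le_Suc_eq)
  then show ?case by (intro exI[of _ 1] conjI allI impI) simp_all
next
  case (Suc i)
  have pe: "ple w (2 * Suc i + 2) n \<longleftrightarrow> n = 2 * Suc i + 2 \<or> ple w (ytop w (Suc i)) n" for n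
    using ple_even[OF Suc.prems] .
  consider "ytop w (Suc i) = 2 * i + 1" | "ytop w (Suc i) = 2 * i + 2"
    using ytop_cases[of "Suc i" w] by auto
  then show ?case
  proof cases
    case 1
    have "ple w (2 * i + 1) n \<longleftrightarrow> n \<le> 2 * i + 1" for n using Suc.prems by (simp add: ple_odd)
    then have "ple w (2 * Suc i + 2) n \<longleftrightarrow> n \<noteq> 2 * i + 2" if "n \<le> 2 * Suc i + 2" "n = 1 \<or> even n" for n
      unfolding pe 1 using that by presburger
    then show ?thesis by (intro exI[of _ "2 * i + 2"]) auto
  next
    case 2
    obtain e where e: "e \<le> 2 * i + 2" "e = 1 \<or> even e"
      "\<forall>n \<le> 2 * i + 2. n = 1 \<or> even n \<longrightarrow> (ple w (2 * i + 2) n \<longleftrightarrow> n \<noteq> e)"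
      using Suc by auto
    have "ple w (2 * Suc i + 2) n \<longleftrightarrow> n \<noteq> e" if n: "n \<le> 2 * Suc i + 2" "n = 1 \<or> even n" for n
    proof -
      have "n \<le> 2 * i + 2 \<or> n = 2 * Suc i + 2" using n by presburger
      then consider "n \<le> 2 * i + 2" | "n = 2 * Suc i + 2" by blast
      then show ?thesis
      proof cases
        case 3: 1
        then have "n \<noteq> 2 * Suc i + 2" by simp
        then show ?thesis unfolding pe 2 using e(3) 3 n(2) by blast
      next
        case 2
        then show ?thesis using e(1) by simp
      qed
    qed
    then show ?thesis using e by (intro exI[of _ e]) auto
  qed
qed

lemma vertex_of_eq_iff_hat_le:
  "vertex_of w x = vertex_of w y \<longleftrightarrow> (\<forall>q\<in>Q_elts w. hat_le w x q \<longleftrightarrow> hat_le w y q)"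
proof
  assume "vertex_of w x = vertex_of w y"
  then have "Poly_Mapping.lookup (vertex_of w x) q = Poly_Mapping.lookup (vertex_of w y) q" for q by simp
  then show "\<forall>q\<in>Q_elts w. hat_le w x q \<longleftrightarrow> hat_le w y q"
    unfolding lookup_vertex_of by (metis zero_neq_one)
qed (intro poly_mapping_eqI, auto simp: lookup_vertex_of)

lemma vertex_of_Elt_neq:
  assumes "a < b" "b \<le> 2 * length w + 3"
  shows "vertex_of w (Elt a) \<noteq> vertex_of w (Elt b)"
proof
  assume eq: "vertex_of w (Elt a) = vertex_of w (Elt b)"
  have eq: "ple w a n \<longleftrightarrow> ple w b n" if "n \<le> 2 * length w + 3" "n = 1 \<or> even n" for n
    using bspec[OF eq[unfolded vertex_of_eq_iff_hat_le], of "Elt n"] that assms by simp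
  \<comment> \<open>A meet-irreducible \<open>b\<close> would tell the two filters apart by itself.
    So \<open>b\<close> is the bottom \<open>2 * i + 3\<close> of a square; membership of
    \<open>2 * i + 2\<close> leaves only \<open>a = 2 * i + 2\<close>, and the element
    \<open>e\<close> excludes this case too.\<close>
  have "\<not> (b = 1 \<or> even b)" using eq[of b] assms ple_le[of w a b] by auto
  then obtain i where i: "b = 2 * i + 3" by (cases b rule: nat_shapes) auto
  then have il: "i \<le> length w" using assms by simp
  have pb: "ple w b n \<longleftrightarrow> n \<le> b" for n using i assms by (simp add: ple_odd)
  have "ple w a (2 * i + 2)" using eq[of "2 * i + 2"] pb i il by simp
  then have a: "a = 2 * i + 2" using ple_le[of w a "2 * i + 2"] assms i by simp
  obtain e where e: "e \<le> 2 * i + 2" "e = 1 \<or> even e" "\<not> ple w (2 * i + 2) e"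
    using missing_elt[OF il] by blast
  then show False using eq[of e] pb i il unfolding a by simp
qed

lemma inj_vertex_of: "inj_on (vertex_of w) (V0 w)"
proof (rule inj_onI)
  fix x y assume x: "x \<in> V0 w" and y: "y \<in> V0 w" and eq: "vertex_of w x = vertex_of w y"
  have q: "hat_le w x q \<longleftrightarrow> hat_le w y q" if "q \<in> Q_elts w" for q
    using eq that unfolding vertex_of_eq_iff_hat_le by blast
  show "x = y"
  proof (cases "\<exists>a b. x = Elt a \<and> y = Elt b")
    case True
    then obtain a b where "x = Elt a" "y = Elt b" by blast
    then show ?thesis using eq vertex_of_Elt_neq[of a b w] vertex_of_Elt_neq[of b a w] x y
      by (cases a b rule: linorder_cases) auto
  next
    case False
    then show ?thesis using q[of Zero_hat] q[of "Elt 0"] x y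
      by (cases x; cases y) (auto simp: ple_zero)
  qed
qed

text \<open>The largest number \<open>m\<close> in a filter nearly determines it. If
  \<open>m = 2 * i + 2\<close>, the filter contains all meet-irreducible elements above
  \<open>m\<close>, and at most one other element \<open>e\<close> with a smaller number is in
  doubt: the filter belongs to \<open>2 * i + 3\<close> or to \<open>2 * i + 2\<close> according to
  whether it contains \<open>e\<close>.\<close>

lemma filter_principal:
  assumes U: "U \<subseteq> Q_elts w" and upc: "\<And>p q. p \<in> U \<Longrightarrow> q \<in> Q_elts w \<Longrightarrow> hat_le w p q \<Longrightarrow> q \<in> U"
  shows "\<exists>x\<in>V0 w. U = {q \<in> Q_elts w. hat_le w x q}"
proof -
  consider "U = {}" | "Zero_hat \<in> U" | "Zero_hat \<notin> U" "U \<noteq> {}" by blast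
  then show ?thesis
  proof cases
    case 1
    then show ?thesis by (intro bexI[of _ One_hat]) auto
  next
    case 2
    then have "U = Q_elts w" using U upc[of Zero_hat] Q_subset_V0 by fastforce
    then show ?thesis using Q_subset_V0 by (intro bexI[of _ Zero_hat]) auto
  next
    case 3
    define N where "N = {n. Elt n \<in> U}"
    have UN: "U = Elt ` N"
    proof (intro equalityI subsetI)
      fix x assume x: "x \<in> U"
      have "x \<noteq> Zero_hat" "x \<noteq> One_hat" using x 3 U by auto
      then show "x \<in> Elt ` N" using x unfolding N_def by (cases x) auto
    qed (auto simp: N_def)
    have N: "n \<le> 2 * length w + 3" "n = 1 \<or> even n" if "n \<in> N" for n
      using that U unfolding N_def by auto
    have Nup: "n \<in> N" if "m \<in> N" "ple w m n" "n = 1 \<or> even n" for m n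
      using upc[of "Elt m" "Elt n"] that N[of m] ple_le[OF that(2)] unfolding N_def by simp
    have finN: "finite N" using N by (meson finite_nat_set_iff_bounded_le)
    have neN: "N \<noteq> {}" using 3 UN by auto
    define m where "m = Max N"
    have m: "m \<in> N" "\<And>n. n \<in> N \<Longrightarrow> n \<le> m" unfolding m_def using finN neN by auto
    have suff: ?thesis if "x \<le> 2 * length w + 3" "\<And>n. n = 1 \<or> even n \<Longrightarrow> n \<in> N \<longleftrightarrow> ple w x n" for x
    proof -
      have "U = {q \<in> Q_elts w. hat_le w (Elt x) q}"
      proof (intro equalityI subsetI)
        fix q assume "q \<in> U"
        then obtain n where "q = Elt n" "n \<in> N" using UN by blast
        then show "q \<in> {q \<in> Q_elts w. hat_le w (Elt x) q}" using that N by auto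
      next
        fix q assume q: "q \<in> {q \<in> Q_elts w. hat_le w (Elt x) q}"
        then obtain n where "q = Elt n" by (cases q) auto
        then show "q \<in> U" using q that unfolding UN by auto
      qed
      then show ?thesis using that(1) by (intro bexI[of _ "Elt x"]) auto
    qed
    show ?thesis
    proof (cases m rule: nat_shapes)
      case 1
      then have "N = {0}" using m by auto
      then show ?thesis using suff[of 0] by simp
    next
      case 2
      have "n \<in> N \<longleftrightarrow> n \<le> 1" for n
        using m(2)[of n] Nup[OF m(1), of n] unfolding 2 by (auto simp: ple_odd le_Suc_eq)
      then show ?thesis using suff[of 1] by (simp add: ple_odd)
    next
      case (3 i)
      have i: "i \<le> length w" using N(1)[OF m(1)] 3 by simp
      obtain e where e: "e \<le> 2 * i + 2" "e = 1 \<or> even e"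
        "\<And>n. n \<le> 2 * i + 2 \<Longrightarrow> n = 1 \<or> even n \<Longrightarrow> (ple w (2 * i + 2) n \<longleftrightarrow> n \<noteq> e)"
        using missing_elt[OF i] by blast
      have i': "2 * i + 2 \<le> 2 * length w + 3" "2 * i + 3 \<le> 2 * length w + 3" using i by auto
      show ?thesis
      proof (cases "e \<in> N")
        case True
        have "n \<in> N \<longleftrightarrow> ple w (2 * i + 3) n" if n: "n = 1 \<or> even n" for n
        proof -
          have "n \<noteq> 2 * i + 3" using n by auto
          then have "ple w (2 * i + 3) n \<longleftrightarrow> n \<le> 2 * i + 2" using ple_odd[of "2 * i + 3" w n] i' by auto
          moreover have "n \<in> N" if "n \<le> 2 * i + 2"
            using e(3)[OF that n] Nup[OF m(1), of n] n True unfolding 3 by blast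
          ultimately show ?thesis using m(2)[of n] unfolding 3 by blast
        qed
        then show ?thesis using suff[of "2 * i + 3"] i' by blast
      next
        case False
        have "n \<in> N \<longleftrightarrow> ple w (2 * i + 2) n" if n: "n = 1 \<or> even n" for n
        proof
          assume nN: "n \<in> N"
          then have "n \<le> 2 * i + 2" "n \<noteq> e" using m(2)[of n] 3 False by auto
          then show "ple w (2 * i + 2) n" using e(3) n by blast
        next
          assume "ple w (2 * i + 2) n"
          then show "n \<in> N" using Nup[OF m(1)] n unfolding 3 by blast
        qed
        then show ?thesis using suff[of "2 * i + 2"] i' by blast
      qed
    next
      case (4 i)
      then show ?thesis using N(2)[OF m(1)] by simp
    qed
  qed
qed

section \<open>Extreme points of the order polytope\<close>

lemma order_polytope_map:
  assumes x: "x \<in> order_polytope w" and y: "\<And>q. Poly_Mapping.lookup y q = f (Poly_Mapping.lookup x q)"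
    and f: "f 0 = 0" "\<And>t. 0 \<le> t \<Longrightarrow> t \<le> 1 \<Longrightarrow> 0 \<le> f t \<and> f t \<le> 1" "\<And>s t. s \<le> t \<Longrightarrow> f s \<le> f t"
  shows "y \<in> order_polytope w"
proof -
  have "Poly_Mapping.keys y \<subseteq> Poly_Mapping.keys x" using f(1) by (auto simp: in_keys_iff y)
  then show ?thesis using x f(2,3) unfolding order_polytope_def by (auto simp: y)
qed

lemma extreme_point_0_1:
  assumes x: "x extreme_point_of order_polytope w"
  shows "Poly_Mapping.lookup x q \<in> {0, 1}"
proof -
  let ?l = "Poly_Mapping.lookup"
  have xO: "x \<in> order_polytope w" using x unfolding extreme_point_of_def by blast
  \<comment> \<open>\<open>x\<close> is the midpoint of its images under two monotone maps of the unit interval that agree only at 0 and 1\<close>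
  define y where "y = Poly_Mapping.map (\<lambda>t. min 1 (2 * t)) x"
  define z where "z = Poly_Mapping.map (\<lambda>t. max 0 (2 * t - 1)) x"
  have ly: "?l y q = min 1 (2 * ?l x q)" for q
    unfolding y_def by transfer (simp add: when_def)
  have lz: "?l z q = max 0 (2 * ?l x q - 1)" for q
    unfolding z_def by transfer (simp add: when_def)
  have "y \<in> order_polytope w" by (rule order_polytope_map[OF xO ly]) auto
  moreover have "z \<in> order_polytope w" by (rule order_polytope_map[OF xO lz]) auto
  moreover have "x = (1 - 1/2) *\<^sub>R y + (1/2) *\<^sub>R z"
  proof (rule poly_mapping_eqI)
    fix q
    show "?l x q = ?l ((1 - 1/2) *\<^sub>R y + (1/2) *\<^sub>R z) q"
    proof (cases "2 * ?l x q \<le> 1")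
      case True
      then show ?thesis by (simp add: lookup_add ly lz)
    next
      case False
      then show ?thesis by (simp add: lookup_add ly lz) (simp add: field_simps)
    qed
  qed
  then have "x \<in> open_segment y z" if "y \<noteq> z"
    unfolding in_segment using that by (intro conjI exI[of _ "1/2"]) simp_all
  ultimately have "y = z" using x unfolding extreme_point_of_def by blast
  then have "min 1 (2 * ?l x q) = max 0 (2 * ?l x q - 1)" using ly lz by metis
  then show ?thesis by (auto simp: min_def max_def split: if_splits)
qed

text \<open>The coordinates of an extreme point are 0 or 1, so its support is a filter, and filters
  are principal. Conversely, a 0/1 point is extreme coordinate by coordinate, because 0 and 1 are
  extreme in the unit interval.\<close>

lemma polytope_vertices_eq: "polytope_vertices w = vertex_of w ` V0 w"
proof (intro equalityI subsetI)
  fix x assume "x \<in> polytope_vertices w"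
  then have x: "x extreme_point_of order_polytope w" unfolding polytope_vertices_def by simp
  then have xO: "x \<in> order_polytope w" unfolding extreme_point_of_def by blast
  define U where "U = {q \<in> Q_elts w. Poly_Mapping.lookup x q = 1}"
  have "\<exists>v\<in>V0 w. U = {q \<in> Q_elts w. hat_le w v q}"
  proof (rule filter_principal)
    fix p q assume "p \<in> U" "q \<in> Q_elts w" "hat_le w p q"
    then show "q \<in> U"
      using xO unfolding U_def order_polytope_def hat_less_def by (cases "p = q") force+
  qed (auto simp: U_def)
  then obtain v where v: "v \<in> V0 w" "U = {q \<in> Q_elts w. hat_le w v q}" by blast
  have "x = vertex_of w v"
  proof (rule poly_mapping_eqI)
    fix q
    have "q \<notin> Q_elts w \<Longrightarrow> Poly_Mapping.lookup x q = 0"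
      using xO unfolding order_polytope_def by (auto simp: in_keys_iff)
    then show "Poly_Mapping.lookup x q = Poly_Mapping.lookup (vertex_of w v) q"
      using extreme_point_0_1[OF x, of q] v(2) unfolding lookup_vertex_of U_def by auto
  qed
  then show "x \<in> vertex_of w ` V0 w" using v by blast
next
  fix x assume "x \<in> vertex_of w ` V0 w"
  then obtain v where v: "v \<in> V0 w" "x = vertex_of w v" by blast
  let ?l = "Poly_Mapping.lookup"
  have l: "?l x q = (if q \<in> Q_elts w \<and> hat_le w v q then 1 else 0)" for q
    unfolding v lookup_vertex_of ..
  have trans: "hat_le w v j" if "hat_le w v i" "hat_le w i j" for i j
  proof (cases "v = Zero_hat")
    case True
    then show ?thesis using that(2) by (simp add: hat_le_def)
  next
    case False
    then show ?thesis using that by (cases v; cases i; cases j) (auto simp: ple_def)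
  qed
  have xO: "x \<in> order_polytope w"
    unfolding order_polytope_def using trans by (auto simp: l in_keys_iff hat_less_def split: if_splits)
  moreover have "x \<notin> open_segment a b" if ab: "a \<in> order_polytope w" "b \<in> order_polytope w" for a b
  proof
    assume "x \<in> open_segment a b"
    then obtain u where u: "a \<noteq> b" "0 < u" "u < 1" "x = (1 - u) *\<^sub>R a + u *\<^sub>R b"
      by (auto simp: in_segment)
    have "?l a q = ?l b q" for q
    proof (cases "q \<in> Q_elts w")
      case False
      then have "?l a q = 0" "?l b q = 0"
        using ab unfolding order_polytope_def by (auto simp: in_keys_iff)
      then show ?thesis by simp
    next
      case True
      then have r: "0 \<le> ?l a q" "?l a q \<le> 1" "0 \<le> ?l b q" "?l b q \<le> 1"
        using ab unfolding order_polytope_def by auto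
      have e: "?l x q = (1 - u) * ?l a q + u * ?l b q"
        unfolding u(4) by (simp add: lookup_add)
      have u': "0 < 1 - u" using u by simp
      consider "?l x q = 0" | "?l x q = 1" unfolding l by presburger
      then show ?thesis
      proof cases
        case 1
        then have "(1 - u) * ?l a q = 0 \<and> u * ?l b q = 0"
          using e r u u' by (metis add_nonneg_eq_0_iff less_imp_le mult_nonneg_nonneg)
        then show ?thesis using u u' by simp
      next
        case 2
        then have "(1 - u) * (1 - ?l a q) + u * (1 - ?l b q) = 0" using e by (simp add: algebra_simps)
        moreover have "0 \<le> (1 - u) * (1 - ?l a q)" "0 \<le> u * (1 - ?l b q)" using r u by simp_all
        ultimately have "(1 - u) * (1 - ?l a q) = 0" "u * (1 - ?l b q) = 0" by linarith+
        then show ?thesis using u u' by simp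
      qed
    qed
    then show False using u(1) by (auto intro: poly_mapping_eqI)
  qed
  ultimately show "x \<in> polytope_vertices w" unfolding polytope_vertices_def extreme_point_of_def by blast
qed

section \<open>Ladders and elementary twists\<close>

lemma Sq_eq:
  assumes "i \<le> length w"
  shows "Sq w i = Elt ` {ytop w i, 2 * i + 1, 2 * i + 2, 2 * i + 3}"
proof -
  have "(THE y. covered_in w (P_elts w) (Elt (2 * i + 2)) y) = Elt (ytop w i)"
    unfolding covered_even_P[OF assms] by simp
  then show ?thesis unfolding Sq_def by auto
qed

text \<open>Label 1 is the only one that is covered by nothing. Labels 2 and 3 are told apart by
  what they cover: 3 covers both 4 and 5, but 2 covers only 4, which is why \<open>5 \<le> s\<close>
  is required. From 4 on, \<open>n\<close> is covered by \<open>n - 2\<close>, which leaves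
  \<open>n\<close> or \<open>n - 1\<close> as its image, and \<open>n - 1\<close> is already
  taken.\<close>

lemma ladder_graph_rigid:
  assumes s: "5 \<le> s" and f: "bij_betw f {1..s} {1..s}"
    and E: "\<And>a b. a \<in> {1..s} \<Longrightarrow> b \<in> {1..s} \<Longrightarrow>
      (f a = f b + 2 \<or> (odd (f b) \<and> f a = f b + 1)) \<longleftrightarrow> (a = b + 2 \<or> (odd b \<and> a = b + (1::nat)))"
    and n: "n \<in> {1..s}"
  shows "f n = n"
proof -
  have mem: "f a \<in> {1..s}" if "a \<in> {1..s}" for a using f that bij_betwE by blast
  have inj: "f a = f b \<longleftrightarrow> a = b" if "a \<in> {1..s}" "b \<in> {1..s}" for a b
    using f that unfolding bij_betw_def inj_on_def by blast
  have onto: "\<exists>a\<in>{1..s}. f a = b" if "b \<in> {1..s}" for b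
    using f that unfolding bij_betw_def by (metis imageE)
  have f1: "f 1 = 1"
  proof (rule ccontr)
    assume ne: "f 1 \<noteq> 1"
    have m1: "f 1 \<in> {1..s}" using mem s by simp
    define b where "b = (if f 1 = 2 then 1 else f 1 - 2)"
    have b: "b \<in> {1..s}" "f 1 = b + 2 \<or> (odd b \<and> f 1 = b + 1)"
      using m1 ne unfolding b_def by auto
    then obtain a where a: "a \<in> {1..s}" "f a = b" using onto by blast
    have "1 = a + 2 \<or> (odd a \<and> 1 = a + (1::nat))" using E[of 1 a] a b s by simp
    then show False using a(1) by auto
  qed
  have f3: "f 2 = 2 \<and> f 3 = 3"
  proof -
    have 2: "f 2 = 3 \<or> f 2 = 2" using E[of 2 1] f1 s by (simp add: numeral_eq_Suc)
    have 3: "f 3 = 3 \<or> f 3 = 2" using E[of 3 1] f1 s by (simp add: numeral_eq_Suc)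
    have "f 3 \<noteq> 2"
    proof
      assume "f 3 = 2"
      then have "f 4 = 4" "f 5 = 4" using E[of 4 3] E[of 5 3] s by simp_all
      then show False using inj[of 4 5] s by simp
    qed
    then show ?thesis using 2 3 inj[of 2 3] s by auto
  qed
  show ?thesis using n
  proof (induction n rule: less_induct)
    case (less n)
    consider "n = 1" | "n = 2" | "n = 3" | "n \<ge> 4" using less.prems by force
    then show ?case
    proof cases
      case 4
      define b where "b = n - 2"
      have b: "b \<in> {1..s}" "b < n" "n = b + 2" using 4 less.prems unfolding b_def by auto
      have fb: "f b = b" using less.IH b by simp
      have d: "f n = b + 2 \<or> (odd b \<and> f n = b + 1)" using E[of n b] b less.prems fb by simp
      have "f n \<noteq> b + 1"
      proof
        assume "f n = b + 1"
        moreover have "f (b + 1) = b + 1" using less.IH[of "b + 1"] b less.prems by simp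
        ultimately have "n = b + 1" using inj[of n "b + 1"] b less.prems by simp
        then show False using b by simp
      qed
      then show ?thesis using d b by simp
    qed (use f1 f3 in auto)
  qed
qed

text \<open>In terms of labels a ladder is the product of a chain with a two-element chain:
  \<open>b \<le> a \<and> (even a \<or> odd b)\<close> is its order, and its covers are the steps
  along the two rails and the rungs.\<close>

lemma ladder_cover_arith:
  fixes a b s :: nat
  assumes "a \<in> {1..s}" "b \<in> {1..s}"
  shows "(b \<le> a \<and> (even a \<or> odd b) \<and> a \<noteq> b \<and>
      \<not> (\<exists>z\<in>{1..s}. (z \<le> a \<and> (even a \<or> odd z) \<and> a \<noteq> z) \<and> (b \<le> z \<and> (even z \<or> odd b) \<and> z \<noteq> b)))
    \<longleftrightarrow> a = b + 2 \<or> (odd b \<and> a = b + 1)" (is "?l \<longleftrightarrow> ?r")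
proof
  assume l: ?l
  \<comment> \<open>The first element below \<open>b\<close> on the way to \<open>a\<close>: the
    other end of the rung if \<open>a\<close> and \<open>b\<close> are on different rails, the next
    element of the rail otherwise. It lies strictly between unless it is \<open>a\<close>.\<close>
  define z where "z = (if odd b \<and> even a then b + 1 else b + 2)"
  have "\<not> (z \<in> {1..s} \<and> (z \<le> a \<and> (even a \<or> odd z) \<and> a \<noteq> z) \<and> (b \<le> z \<and> (even z \<or> odd b) \<and> z \<noteq> b))"
    using l by blast
  then show ?r using l assms unfolding z_def by (cases "odd b"; cases "even a") (simp_all; presburger)+
next
  assume r: ?r
  have "\<not> ((z \<le> a \<and> (even a \<or> odd z) \<and> a \<noteq> z) \<and> (b \<le> z \<and> (even z \<or> odd b) \<and> z \<noteq> b))" for z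
    using r by presburger
  moreover have "b \<le> a \<and> (even a \<or> odd b) \<and> a \<noteq> b" using r by auto
  ultimately show ?l by blast
qed

text \<open>
  The ladder formed by the squares \<open>c, \<dots>, c'\<close>, where \<open>q\<close> is the middle element of square \<open>c\<close> shared with
  square \<open>c + 1\<close> and \<open>p\<close> is the other middle element.
\<close>

locale ladder_segment =
  fixes w :: word and c c' q :: nat
  assumes cc': "c \<le> c'" and c'k: "c' \<le> length w"
    and q: "q = 2 * c + 1 \<or> q = 2 * c + 2"
    and first_top: "c < c' \<Longrightarrow> ytop w (Suc c) = q"
    and inner_top: "\<And>i. c + 2 \<le> i \<Longrightarrow> i \<le> c' \<Longrightarrow> ytop w i = 2 * i"
begin

text \<open>The middle elements \<open>2 * c + 1\<close> and \<open>2 * c + 2\<close> have the sum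
  \<open>4 * c + 3\<close>.\<close>

definition "p = 4 * c + 3 - q"

definition "s = 2 * (c' - c) + 4"

text \<open>Explicit version of the labelling x_1, ..., x_s. Only the first three labels depend on
  the shape of the ladder; from 4 on, labels and numbers differ by the constant
  \<open>2 * c - 1\<close>.\<close>

definition label :: "nat \<Rightarrow> nat" where
  "label n = (if n = 1 then ytop w c else if n = 2 then p else if n = 3 then q else 2 * c + n - 1)"

text \<open>The exchange along rungs in terms of numbers: the first two rungs involve
  \<open>p\<close> and \<open>q\<close>, all further ones are \<open>2 * j + 2\<close> and
  \<open>2 * j + 3\<close>.\<close>

definition twist :: "nat \<Rightarrow> nat" where
  "twist n = (if n = ytop w c then p else if n = p then ytop w c else if n = q then 2 * c + 3
     else if n = 2 * c + 3 then q
     else if 2 * c + 4 \<le> n \<and> n \<le> 2 * c' + 3 then (if even n then n + 1 else n - 1) else n)"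

lemma p: "p = 2 * c + 1 \<and> q = 2 * c + 2 \<or> p = 2 * c + 2 \<and> q = 2 * c + 1"
  using q unfolding p_def by auto

lemma label_ge4: "4 \<le> n \<Longrightarrow> label n = 2 * c + n - 1"
  unfolding label_def by auto

lemma label_small: "label 1 = ytop w c" "label 2 = p" "label 3 = q"
  unfolding label_def by auto

lemma s_ge: "4 \<le> s" "even s" unfolding s_def by auto

lemma s_eq: "2 * c + s = 2 * c' + 4" using cc' unfolding s_def by auto

lemma label_inj: "inj_on label {1..s}"
proof (rule inj_onI)
  fix a b assume "a \<in> {1..s}" "b \<in> {1..s}" "label a = label b"
  moreover have "ytop w c \<le> 2 * c" by (rule ytop_le)
  ultimately show "a = b" using p unfolding label_def by (auto split: if_splits)
qed

lemma label_image: "label ` {1..s} = insert (ytop w c) {2 * c + 1..2 * c' + 3}"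
proof (intro equalityI subsetI)
  fix n assume "n \<in> label ` {1..s}"
  then obtain a where a: "a \<in> {1..s}" "n = label a" by blast
  then show "n \<in> insert (ytop w c) {2 * c + 1..2 * c' + 3}"
    using p s_eq s_ge cc' unfolding label_def by (auto split: if_splits)
next
  fix n assume n: "n \<in> insert (ytop w c) {2 * c + 1..2 * c' + 3}"
  consider "n = ytop w c" | "n = p" | "n = q" | "2 * c + 3 \<le> n" "n \<le> 2 * c' + 3" using n p by force
  then show "n \<in> label ` {1..s}"
  proof cases
    case 4
    then have "n = label (n + 1 - 2 * c)" "n + 1 - 2 * c \<in> {1..s}"
      using s_eq label_ge4[of "n + 1 - 2 * c"] by auto
    then show ?thesis by blast
  next
    case 1
    then show ?thesis using label_small(1) s_ge by (intro image_eqI[of _ _ 1]) auto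
  next
    case 2
    then show ?thesis using label_small(2) s_ge by (intro image_eqI[of _ _ 2]) auto
  next
    case 3
    then show ?thesis using label_small(3) s_ge by (intro image_eqI[of _ _ 3]) auto
  qed
qed

lemma ladder_eq: "(\<Union>j\<in>{c..c'}. Sq w j) = Elt ` label ` {1..s}"
proof (intro equalityI subsetI)
  fix x assume "x \<in> (\<Union>j\<in>{c..c'}. Sq w j)"
  then obtain j where j: "c \<le> j" "j \<le> c'" "x \<in> Elt ` {ytop w j, 2 * j + 1, 2 * j + 2, 2 * j + 3}"
    using Sq_eq[of _ w] c'k by (metis UN_E atLeastAtMost_iff le_trans)
  have "ytop w j = ytop w c \<or> 2 * c + 1 \<le> ytop w j \<and> ytop w j \<le> 2 * c' + 3"
    using ytop_ge[of j w] ytop_le[of w j] j by (cases "j = c") auto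
  then show "x \<in> Elt ` label ` {1..s}" using j unfolding label_image by auto
next
  fix x assume "x \<in> Elt ` label ` {1..s}"
  then obtain n where n: "x = Elt n" "n = ytop w c \<or> (2 * c + 1 \<le> n \<and> n \<le> 2 * c' + 3)"
    unfolding label_image by auto
  show "x \<in> (\<Union>j\<in>{c..c'}. Sq w j)"
  proof (cases "n = ytop w c")
    case True
    then have "x \<in> Sq w c" using Sq_eq[of c w] c'k cc' n by auto
    then show ?thesis using cc' by auto
  next
    case False
    \<comment> \<open>Square \<open>j\<close> contains \<open>n\<close>, except that the last
      element \<open>2 * c' + 3\<close> gives \<open>c' + 1\<close>; the minimum with
      \<open>c'\<close> corrects this.\<close>
    define j where "j = (n - 1) div 2"
    define j' where "j' = min j c'"
    have "c \<le> j'" "j' \<le> c'" "n = 2 * j' + 1 \<or> n = 2 * j' + 2 \<or> n = 2 * j' + 3"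
      using False n(2) cc' unfolding j'_def j_def by auto
    then have "x \<in> Sq w j'" using Sq_eq[of j' w] c'k n by auto
    then show ?thesis using \<open>c \<le> j'\<close> \<open>j' \<le> c'\<close> by auto
  qed
qed

lemma card_ladder: "card (Elt ` label ` {1..s}) = s"
  using card_image[OF label_inj] by (subst card_image) (auto simp: inj_on_def)

lemma label_le: "a \<in> {1..s} \<Longrightarrow> label a \<le> 2 * length w + 3"
proof -
  assume "a \<in> {1..s}"
  then have "label a \<in> insert (ytop w c) {2 * c + 1..2 * c' + 3}" unfolding label_image[symmetric] by (rule imageI)
  then show ?thesis using c'k ytop_le[of w c] cc' by auto
qed

lemma ple_middle:
  assumes "m = 2 * c + 1 \<or> m = 2 * c + 2"
  shows "ple w m n \<and> n \<in> insert (ytop w c) {2 * c + 1..} \<longleftrightarrow> n = m \<or> n = ytop w c"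
proof -
  have y: "ytop w c \<le> 2 * c" by (rule ytop_le)
  from assms show ?thesis
  proof
    assume m: "m = 2 * c + 1"
    have "ple w m n \<longleftrightarrow> n \<le> 2 * c + 1" unfolding m using cc' c'k by (simp add: ple_odd)
    then show ?thesis using y m by auto
  next
    assume m: "m = 2 * c + 2"
    have "ple w m n \<longleftrightarrow> n = m \<or> ple w (ytop w c) n" unfolding m using cc' c'k by (intro ple_even) auto
    then show ?thesis using y m ple_le[of w "ytop w c" n] by auto
  qed
qed

text \<open>Even labels from 4 on are odd numbers, which lie below everything with a smaller number.
  Odd labels from 5 on are even numbers, whose only cover has label \<open>a - 2\<close>; hence the
  induction.\<close>

lemma label_order:
  assumes "a \<in> {1..s}" "b \<in> {1..s}"
  shows "ple w (label a) (label b) \<longleftrightarrow> b \<le> a \<and> (even a \<or> odd b)"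
  using assms
proof (induction a rule: less_induct)
  case (less a)
  have y: "ytop w c \<le> 2 * c" by (rule ytop_le)
  have b: "label b \<in> insert (ytop w c) {2 * c + 1..}" using less.prems(2) label_image by auto
  have eq: "label d = label b \<longleftrightarrow> d = b" if "d \<in> {1..s}" for d
    using inj_on_eq_iff[OF label_inj that less.prems(2)] .
  have b1: "1 \<le> b" "b \<le> s" and a1: "1 \<le> a" "a \<le> s" using less.prems by auto
  have e1: "label b = ytop w c \<longleftrightarrow> b = 1" using eq[of 1] label_small(1) s_ge by force
  have e2: "label b = p \<longleftrightarrow> b = 2" using eq[of 2] label_small(2) s_ge by force
  have e3: "label b = q \<longleftrightarrow> b = 3" using eq[of 3] label_small(3) s_ge by force
  have "a = 1 \<or> a = 2 \<or> a = 3 \<or> 4 \<le> a \<and> even a \<or> 5 \<le> a \<and> odd a" using a1 by presburger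
  then consider "a = 1" | "a = 2" | "a = 3" | "4 \<le> a" "even a" | "5 \<le> a" "odd a" by blast
  then show ?case
  proof cases
    case 1
    have "ple w (label a) (label b) \<longleftrightarrow> label b = ytop w c"
      using 1 b y ple_le[of w "ytop w c" "label b"] label_small(1) by auto
    then show ?thesis unfolding e1 using 1 b1 by auto
  next
    case 2
    have "ple w (label a) (label b) \<longleftrightarrow> label b = p \<or> label b = ytop w c"
      using ple_middle[of p "label b"] p b unfolding 2 label_small by auto
    then show ?thesis unfolding e1 e2 using 2 b1 by auto
  next
    case 3
    have "ple w (label a) (label b) \<longleftrightarrow> label b = q \<or> label b = ytop w c"
      using ple_middle[of q "label b"] q b unfolding 3 label_small by auto
    moreover have "b \<le> 3 \<and> odd b \<longleftrightarrow> b = 3 \<or> b = 1" using b1 by presburger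
    ultimately show ?thesis unfolding e1 e3 using 3 by auto
  next
    case 4
    have la: "label a = 2 * c + a - 1" by (rule label_ge4[OF 4(1)])
    have "ple w (label a) (label b) \<longleftrightarrow> label b \<le> label a"
      unfolding la using 4 a1 s_eq c'k by (intro ple_odd) auto
    also have "\<dots> \<longleftrightarrow> b \<le> a"
    proof (cases "4 \<le> b")
      case True
      then show ?thesis unfolding la label_ge4[OF True] using 4 by auto
    next
      case False
      then have "label b \<le> 2 * c + 2" unfolding label_def using y p b1 by auto
      then show ?thesis unfolding la using 4 False by auto
    qed
    finally show ?thesis using 4 by auto
  next
    case 5
    define i where "i = c + (a - 3) div 2"
    have a: "a = 2 * (i - c) + 3" "c < i" using 5 unfolding i_def by presburger+
    have ic: "i \<le> c'" using a a1 s_eq by auto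
    have la: "label a = 2 * i + 2" using label_ge4[of a] 5 a by simp
    have t: "ytop w i = label (a - 2)"
    proof (cases "i = Suc c")
      case True
      then have "a - 2 = 3" using a by simp
      then show ?thesis using first_top ic True label_small(3) by simp
    next
      case False
      then have "4 \<le> a - 2" "c + 2 \<le> i" using a by auto
      then show ?thesis using inner_top[of i] ic label_ge4[of "a - 2"] a by simp
    qed
    have "ple w (label a) (label b) \<longleftrightarrow> label b = label a \<or> ple w (label (a - 2)) (label b)"
      using ple_even[of i w "label b"] ic c'k unfolding la t by simp
    also have "label b = label a \<longleftrightarrow> b = a" using eq[OF less.prems(1)] by auto
    also have "ple w (label (a - 2)) (label b) \<longleftrightarrow> b \<le> a - 2 \<and> (even (a - 2) \<or> odd b)"
      using 5 a1 less.prems(2) by (intro less.IH) auto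
    also have "b = a \<or> b \<le> a - 2 \<and> (even (a - 2) \<or> odd b) \<longleftrightarrow> b \<le> a \<and> (even a \<or> odd b)"
      using 5 by presburger
    finally show ?thesis .
  qed
qed

end

context ladder_segment begin

abbreviation "lad \<equiv> Elt ` label ` {1..s}"

lemma label_covers:
  assumes "a \<in> {1..s}" "b \<in> {1..s}"
  shows "covered_in w lad (Elt (label a)) (Elt (label b)) \<longleftrightarrow> a = b + 2 \<or> (odd b \<and> a = b + 1)"
proof -
  have less: "hat_less w (Elt (label d)) (Elt (label e)) \<longleftrightarrow> e \<le> d \<and> (even d \<or> odd e) \<and> d \<noteq> e"
    if "d \<in> {1..s}" "e \<in> {1..s}" for d e
    using label_le[OF that(1)] label_order[OF that] inj_on_eq_iff[OF label_inj that]
    by (auto simp: hat_less_def)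
  have "(\<exists>z\<in>lad. hat_less w (Elt (label a)) z \<and> hat_less w z (Elt (label b)))
    \<longleftrightarrow> (\<exists>z\<in>{1..s}. (z \<le> a \<and> (even a \<or> odd z) \<and> a \<noteq> z) \<and> (b \<le> z \<and> (even z \<or> odd b) \<and> z \<noteq> b))"
    unfolding image_image bex_simps(7) using less[OF assms(1)] less[OF _ assms(2)] by (intro bex_cong) auto
  then have "covered_in w lad (Elt (label a)) (Elt (label b)) \<longleftrightarrow>
     (b \<le> a \<and> (even a \<or> odd b) \<and> a \<noteq> b \<and>
      \<not> (\<exists>z\<in>{1..s}. (z \<le> a \<and> (even a \<or> odd z) \<and> a \<noteq> z) \<and> (b \<le> z \<and> (even z \<or> odd b) \<and> z \<noteq> b)))"
    unfolding covered_in_def less[OF assms] using assms by simp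
  then show ?thesis using ladder_cover_arith[OF assms] by simp
qed

lemma bij_label: "bij_betw (Elt \<circ> label) {1..s} lad"
  unfolding bij_betw_def
proof
  show "inj_on (Elt \<circ> label) {1..s}" by (rule comp_inj_on[OF label_inj]) (simp add: inj_on_def)
  show "(Elt \<circ> label) ` {1..s} = lad" by (simp only: image_comp)
qed

text \<open>Comparing any labelling with \<open>label\<close> gives an automorphism of the cover
  graph on the labels, and this graph is rigid. The lemma identifies the labelling selected by
  \<open>SOME\<close>.\<close>

lemma labeling_unique:
  assumes s: "5 \<le> s" and x: "bij_betw x {1..s} lad"
    and cv: "\<And>a b. a \<in> {1..s} \<Longrightarrow> b \<in> {1..s} \<Longrightarrow>
        covered_in w lad (x a) (x b) \<longleftrightarrow> a = b + 2 \<or> (odd b \<and> a = b + 1)"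
    and n: "n \<in> {1..s}"
  shows "x n = Elt (label n)"
proof -
  define f where "f = the_inv_into {1..s} (Elt \<circ> label) \<circ> x"
  have f: "bij_betw f {1..s} {1..s}"
    unfolding f_def using x bij_betw_the_inv_into[OF bij_label] by (rule bij_betw_trans)
  have fx: "Elt (label (f a)) = x a" if "a \<in> {1..s}" for a
  proof -
    have "x a \<in> lad" using bij_betwE[OF x] that by blast
    then have "(Elt \<circ> label) (the_inv_into {1..s} (Elt \<circ> label) (x a)) = x a"
      by (intro f_the_inv_into_f_bij_betw[OF bij_label])
    then show ?thesis unfolding f_def by (simp only: comp_def)
  qed
  have mem: "f a \<in> {1..s}" if "a \<in> {1..s}" for a using f that bij_betwE by blast
  have "f n = n"
    using s f _ n
  proof (rule ladder_graph_rigid)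
    fix a b assume ab: "a \<in> {1..s}" "b \<in> {1..s}"
    show "(f a = f b + 2 \<or> (odd (f b) \<and> f a = f b + 1)) \<longleftrightarrow> (a = b + 2 \<or> (odd b \<and> a = b + 1))"
      using label_covers[OF mem[OF ab(1)] mem[OF ab(2)]] cv[OF ab] fx ab by simp
  qed
  then show ?thesis using fx[OF n] by simp
qed

lemma twist_label:
  assumes "j \<in> {1..s}"
  shows "twist (label j) = label (if odd j then j + 1 else j - 1)"
proof -
  have y: "ytop w c \<le> 2 * c" by (rule ytop_le)
  have j: "1 \<le> j" "j \<le> s" using assms by auto
  have "j = 1 \<or> j = 2 \<or> j = 3 \<or> j = 4 \<or> 5 \<le> j" using j by auto
  then consider "j = 1" | "j = 2" | "j = 3" | "j = 4" | "5 \<le> j" by blast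
  then show ?thesis
  proof cases
    case 5
    have lj: "label j = 2 * c + j - 1" using 5 by (intro label_ge4) simp
    have r: "2 * c + 4 \<le> label j" "label j \<le> 2 * c' + 3" using 5 j s_eq lj by auto
    have t: "twist (label j) = (if even (label j) then label j + 1 else label j - 1)"
      using r y p unfolding twist_def by auto
    show ?thesis
    proof (cases "odd j")
      case True
      then show ?thesis unfolding t using label_ge4[of "j + 1"] 5 lj by auto
    next
      case False
      then show ?thesis unfolding t using label_ge4[of "j - 1"] 5 lj by auto
    qed
  qed (use p y in \<open>auto simp: twist_def label_def\<close>)
qed

lemma partner_mem:
  assumes "j \<in> {1..s}"
  shows "(if odd j then j + 1 else j - 1) \<in> {1..s}"
proof -
  have "1 \<le> j" "j \<le> s" "even s" using assms s_ge by auto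
  then show ?thesis by (cases "odd j") (simp_all, presburger+)
qed

lemma twist_outside: "n \<notin> label ` {1..s} \<Longrightarrow> twist n = n"
  unfolding label_image twist_def using p cc' by auto

lemma twist_twist [simp]: "twist (twist n) = n"
proof (cases "n \<in> label ` {1..s}")
  case True
  then obtain j where j: "j \<in> {1..s}" "n = label j" by blast
  show ?thesis using twist_label[OF j(1)] twist_label[OF partner_mem[OF j(1)]] j by auto
qed (simp add: twist_outside)

lemma twist_mem: "n \<in> label ` {1..s} \<Longrightarrow> twist n \<in> label ` {1..s}"
  using twist_outside[of "twist n"] by fastforce

lemma twist_le: "n \<le> 2 * length w + 3 \<Longrightarrow> twist n \<le> 2 * length w + 3"
  using twist_mem[of n] twist_outside[of n] label_le by fastforce

lemma twist_below: "n < ytop w c \<Longrightarrow> twist n = n"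
  using ytop_le[of w c] by (intro twist_outside, unfold label_image) auto

lemma twist_above: "2 * c' + 3 < n \<Longrightarrow> twist n = n"
  using ytop_le[of w c] cc' by (intro twist_outside, unfold label_image) auto

lemma twist_first [simp]: "twist (ytop w c) = p" "twist p = ytop w c" "twist q = 2 * c + 3" "twist (2 * c + 3) = q"
  using ytop_le[of w c] p unfolding twist_def by auto

lemma twist_rung: "c < i \<Longrightarrow> i \<le> c' \<Longrightarrow> twist (2 * i + 2) = 2 * i + 3" "c < i \<Longrightarrow> i \<le> c' \<Longrightarrow> twist (2 * i + 3) = 2 * i + 2"
  using ytop_le[of w c] p unfolding twist_def by auto

text \<open>A square after the first consists of two rungs, and its top together with
  \<open>2 * i + 1\<close> is the rung shared with the preceding square.\<close>

lemma twist_rung_top: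
  assumes "c < i" "i \<le> c'"
  shows "twist (ytop w i) = 2 * i + 1" "twist (2 * i + 1) = ytop w i"
proof -
  have "ytop w i = q \<and> 2 * i + 1 = 2 * c + 3 \<or> (\<exists>j. c < j \<and> j \<le> c' \<and> ytop w i = 2 * j + 2 \<and> 2 * i + 1 = 2 * j + 3)"
  proof (cases "i = Suc c")
    case True
    then show ?thesis using first_top assms by auto
  next
    case False
    then have "ytop w i = 2 * i" using inner_top[of i] assms by simp
    then show ?thesis using False assms by (intro disjI2 exI[of _ "i - 1"]) auto
  qed
  then show "twist (ytop w i) = 2 * i + 1" "twist (2 * i + 1) = ytop w i"
    using twist_rung twist_first(3,4) by metis+
qed

end

definition elt_map :: "(nat \<Rightarrow> nat) \<Rightarrow> elt \<Rightarrow> elt" where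
  "elt_map t v = (case v of Zero_hat \<Rightarrow> Zero_hat | One_hat \<Rightarrow> One_hat | Elt n \<Rightarrow> Elt (t n))"

lemma elt_map_simps [simp]: "elt_map t Zero_hat = Zero_hat" "elt_map t One_hat = One_hat" "elt_map t (Elt n) = Elt (t n)"
  by (simp_all add: elt_map_def)

context ladder_segment begin

lemma elementary_twist_eq:
  assumes lad: "ladder w r = lad" and lab: "\<And>n. n \<in> {1..s} \<Longrightarrow> ladder_labeling w r n = Elt (label n)"
  shows "elementary_twist w r = (\<lambda>v\<in>V0 w. elt_map twist v)"
proof (rule ext)
  fix v
  let ?x = "ladder_labeling w r"
  have img: "?x ` {1..s} = lad" using lab by (auto simp: image_image)
  have inj: "inj_on ?x {1..s}" 
  proof (rule inj_onI)
    fix a b assume ab: "a \<in> {1..s}" "b \<in> {1..s}" "?x a = ?x b"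
    have "Elt (label a) = Elt (label b)" using ab(3) unfolding lab[OF ab(1)] lab[OF ab(2)] .
    then have "label a = label b" by simp
    then show "a = b" using ab(1,2) by (rule inj_onD[OF label_inj])
  qed
  have card: "card (ladder w r) = s" unfolding lad by (rule card_ladder)
  show "elementary_twist w r v = (\<lambda>v\<in>V0 w. elt_map twist v) v"
  proof (cases "v \<in> V0 w")
    case True
    show ?thesis
    proof (cases "v \<in> lad")
      case T: True
      then obtain j where j: "j \<in> {1..s}" "v = ?x j" using img by blast
      have inv: "the_inv_into {1..s} ?x v = j" unfolding j(2) using the_inv_into_f_f[OF inj j(1)] .
      have m: "(if odd j then j + 1 else j - 1) \<in> {1..s}" by (rule partner_mem[OF j(1)])
      have "elementary_twist w r v = ?x (if odd j then j + 1 else j - 1)"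
        unfolding elementary_twist_def Let_def card img restrict_apply'[OF True] if_P[OF T] inv by simp
      also have "\<dots> = Elt (twist (label j))" unfolding twist_label[OF j(1)] using lab[OF m] by simp
      finally show ?thesis using True j lab[OF j(1)] by simp
    next
      case F: False
      have "elementary_twist w r v = v"
        unfolding elementary_twist_def Let_def card img restrict_apply'[OF True] if_not_P[OF F] ..
      moreover have "elt_map twist v = v"
      proof (cases v)
        case (Elt n)
        then have "n \<notin> label ` {1..s}" using F by blast
        then show ?thesis unfolding Elt using twist_outside by simp
      qed simp_all
      ultimately show ?thesis using True by simp
    qed
  qed (simp add: elementary_twist_def)
qed

end

text \<open>The sum of two square relations in which the common terms \<open>y\<close> and
  \<open>b\<close> occur on opposite sides and cancel.\<close>

lemma square_trans:
  fixes a :: "'a::ab_group_add"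
  assumes "a + y = b + d" "b + e = y + f"
  shows "a + e = d + f"
proof -
  have "a = b + d - y" "e = y + f - b" using assms by (simp_all add: algebra_simps)
  then show ?thesis by simp
qed

text \<open>Adds the surroundings of a ladder: the word turns at \<open>c\<close> and
  \<open>c'\<close> unless these are its ends, and it turns neither at \<open>c - 1\<close> nor at
  \<open>c' + 1\<close>. The conditions \<open>prev_top\<close> and \<open>next_top2\<close> keep
  the squares \<open>c - 2\<close> and \<open>c' + 2\<close> disjoint from the ladder. Only the
  empty word has \<open>c = c'\<close>.\<close>

locale snake_segment = ladder_segment +
  assumes nontrivial: "0 < length w \<Longrightarrow> c < c'"
    and next_top: "c' < length w \<Longrightarrow> ytop w (c' + 1) = 2 * c' + 1"
    and next_top2: "c' + 2 \<le> length w \<Longrightarrow> ytop w (c' + 2) = 2 * c' + 4"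
    and prev_top: "2 \<le> c \<Longrightarrow> ytop w c = 2 * c"
    and prev_q: "1 \<le> c \<Longrightarrow> q = 2 * c + 1"
begin

lemma twist_square:
  assumes i: "i \<le> length w"
  defines "v \<equiv> \<lambda>n. vertex_of w (Elt n)"
  shows "v (twist (2 * i + 3)) + v (twist (ytop w i)) = v (twist (2 * i + 1)) + v (twist (2 * i + 2))"
proof -
  have sq: "v (2 * j + 3) + v (ytop w j) = v (2 * j + 1) + v (2 * j + 2)" if "j \<le> length w" for j
    unfolding v_def using square_relation[OF that] .
  have yi: "ytop w i \<le> 2 * i" and yc: "ytop w c \<le> 2 * c" by (rule ytop_le)+
  consider "i + 2 \<le> c" | "i + 1 = c" | "i = c" | "c < i" "i \<le> c'" | "i = c' + 1" | "c' + 2 \<le> i" by linarith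
  then show ?thesis
  proof cases
    case 1
    then have "twist n = n" if "n \<le> 2 * i + 3" for n using prev_top that by (intro twist_below) simp
    then show ?thesis using sq[OF i] yi by simp
  next
    \<comment> \<open>The square before the ladder contains \<open>ytop w c\<close> and
      \<open>q = 2 * c + 1\<close>, which the twist moves to \<open>2 * c + 2\<close> and
      \<open>2 * c + 3\<close>. The new relation is the sum of those of squares \<open>i\<close> and
      \<open>c\<close>. Both positions of \<open>ytop w c\<close> among the middle elements of
      square \<open>i\<close> must be considered.\<close>
    case 2
    have q: "q = 2 * c + 1" "p = 2 * c + 2" using prev_q p 2 by auto
    have i3: "2 * i + 3 = q" using q 2 by simp
    have t1: "twist (2 * i + 3) = 2 * c + 3" unfolding i3 by (rule twist_first)
    have t2: "twist (ytop w i) = ytop w i" using yi ytop_ge[of c w] 2 by (intro twist_below) auto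
    have D: "ytop w c = 2 * i + 1 \<and> twist (2 * i + 1) = 2 * c + 2 \<and> twist (2 * i + 2) = 2 * i + 2
        \<or> ytop w c = 2 * i + 2 \<and> twist (2 * i + 2) = 2 * c + 2 \<and> twist (2 * i + 1) = 2 * i + 1"
      using ytop_cases[of c w] 2 q unfolding twist_def by auto
    have A1: "v (2 * c + 3) + v (ytop w c) = v (2 * c + 1) + v (2 * c + 2)"
      using i 2 cc' c'k by (intro sq) simp
    have c1: "2 * c + 1 = 2 * i + 3" using 2 by simp
    have A2: "v (2 * c + 1) + v (ytop w i) = v (2 * i + 1) + v (2 * i + 2)"
      unfolding c1 by (rule sq[OF i])
    from D show ?thesis
    proof (elim disjE conjE)
      assume y: "ytop w c = 2 * i + 1" "twist (2 * i + 1) = 2 * c + 2" "twist (2 * i + 2) = 2 * i + 2"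
      show ?thesis unfolding t1 t2 y(2,3) by (rule square_trans[OF A1]) (simp only: y(1) A2)
    next
      assume y: "ytop w c = 2 * i + 2" "twist (2 * i + 2) = 2 * c + 2" "twist (2 * i + 1) = 2 * i + 1"
      have "v (2 * c + 3) + v (ytop w i) = v (2 * c + 2) + v (2 * i + 1)"
        by (rule square_trans[OF A1], unfold y(1) A2, rule add.commute)
      then show ?thesis unfolding t1 t2 y(2,3) by (simp only: add.commute)
    qed
  next
    case 3
    have A: "v (2 * c + 3) + v (ytop w c) = v (2 * c + 1) + v (2 * c + 2)" using sq[of c] i 3 by simp
    from p show ?thesis unfolding 3 twist_first(1,4)
    proof (elim disjE conjE)
      assume "p = 2 * c + 1" "q = 2 * c + 2"
      then have e: "2 * c + 1 = p" "2 * c + 2 = q" by simp_all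
      show "v q + v p = v (twist (2 * c + 1)) + v (twist (2 * c + 2))"
        unfolding e twist_first using A[unfolded e] by (simp only: add.commute)
    next
      assume "p = 2 * c + 2" "q = 2 * c + 1"
      then have e: "2 * c + 1 = q" "2 * c + 2 = p" by simp_all
      show "v q + v p = v (twist (2 * c + 1)) + v (twist (2 * c + 2))"
        unfolding e twist_first using A[unfolded e] by (rule sym)
    qed
  next
    case 4
    then show ?thesis using sq[OF i] twist_rung[of i] twist_rung_top[of i] by (simp add: add.commute)
  next
    \<comment> \<open>The square after the ladder meets it in its top \<open>2 * c' + 1\<close> and
      in \<open>2 * c' + 3\<close>. These move to \<open>ytop w c'\<close> and
      \<open>2 * c' + 2\<close>, and the new relation is the sum of those of squares
      \<open>i\<close> and \<open>c'\<close>.\<close>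
    case 5
    then have l: "c' < length w" using i by simp
    then have l: "c < c'" "c' < length w" by (auto intro!: nontrivial)
    have t: "twist (2 * i + 3) = 2 * i + 3" "twist (2 * i + 2) = 2 * i + 2" using 5 by (auto intro: twist_above)
    have i1: "2 * i + 1 = 2 * c' + 3" using 5 by simp
    have t1: "twist (2 * i + 1) = 2 * c' + 2" unfolding i1 by (rule twist_rung(2)[OF l(1) le_refl])
    have yi': "ytop w i = 2 * c' + 1" using next_top[OF l(2)] unfolding 5 .
    have t2: "twist (ytop w i) = ytop w c'" unfolding yi' by (rule twist_rung_top(2)[OF l(1) le_refl])
    have B1: "v (2 * i + 3) + v (2 * c' + 1) = v (2 * c' + 3) + v (2 * i + 2)"
      using sq[OF i] unfolding i1 yi' .
    have B2: "v (2 * c' + 3) + v (ytop w c') = v (2 * c' + 1) + v (2 * c' + 2)"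
      using l by (intro sq) simp
    show ?thesis unfolding t t1 t2 square_trans[OF B1 B2] by (rule add.commute)
  next
    case 6
    \<comment> \<open>A second turn at \<open>c' + 1\<close> would make \<open>2 * c' + 3\<close>,
      an element of the ladder, the top of square \<open>c' + 2\<close>, and its relation would be
      destroyed.\<close>
    have "ytop w i > 2 * c' + 3"
    proof (cases "i = c' + 2")
      case True
      then show ?thesis using next_top2 i by simp
    next
      case False
      then show ?thesis using ytop_ge[of i w] 6 by simp
    qed
    moreover have "twist (2 * i + 3) = 2 * i + 3" "twist (2 * i + 2) = 2 * i + 2" "twist (2 * i + 1) = 2 * i + 1"
      using 6 by (auto intro: twist_above)
    ultimately show ?thesis using sq[OF i] twist_above by simp
  qed
qed

lemma twist_linear:
  "\<exists>g. linear g \<and> (\<forall>x\<in>V0 w. g (vertex_of w x) = vertex_of w (elt_map twist x))"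
  by (rule linear_extension) (simp_all only: elt_map_simps twist_square)

end

text \<open>
  Consecutive ladders share one square, on which their twists act as the two distinct fixed-point-free
  involutions generating a Klein four-group.
\<close>

lemma twist_commute:
  assumes "snake_segment w c c' q" "snake_segment w d d' q'" "c < c'" "c' \<le> d" "d = c' \<or> c' + 2 \<le> d"
  shows "ladder_segment.twist w c c' q (ladder_segment.twist w d d' q' n)
       = ladder_segment.twist w d d' q' (ladder_segment.twist w c c' q n)"
proof -
  interpret a: snake_segment w c c' q by fact
  interpret b: snake_segment w d d' q' by fact
  have yd: "2 * d - 1 \<le> ytop w d" "ytop w d \<le> 2 * d" by (rule ytop_ge ytop_le)+
  have q': "q' = 2 * d + 1" "b.p = 2 * d + 2" using b.prev_q b.p assms by auto
  \<comment> \<open>An involution that fixes every number above a bound maps the numbers up to the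
    bound among themselves.\<close>
  have ale: "a.twist n \<le> 2 * c' + 3" if "n \<le> 2 * c' + 3" for n
    using a.twist_above[of "a.twist n"] that by (metis a.twist_twist not_le)
  from assms(5) show ?thesis
  proof
    \<comment> \<open>The supports are separated: the first twist moves only numbers up to
      \<open>2 * c' + 3\<close>, the second only numbers from \<open>2 * d\<close> on, and
      \<open>2 * c' + 4 \<le> 2 * d\<close>.\<close>
    assume far: "c' + 2 \<le> d"
    then have y2: "ytop w d = 2 * d" using b.prev_top by simp
    have bge: "ytop w d \<le> b.twist n" if "ytop w d \<le> n" for n
      using b.twist_below[of "b.twist n"] that by (metis b.twist_twist not_le)
    show ?thesis
    proof (cases "n \<le> 2 * c' + 3")
      case True
      then have "b.twist n = n" "b.twist (a.twist n) = a.twist n"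
        using ale[OF True] far y2 by (auto intro!: b.twist_below)
      then show ?thesis by simp
    next
      case False
      then have an: "a.twist n = n" by (intro a.twist_above) simp
      show ?thesis
      proof (cases "n < ytop w d")
        case True
        then show ?thesis using an b.twist_below by simp
      next
        case False
        then have "a.twist (b.twist n) = b.twist n" using bge[of n] y2 far by (intro a.twist_above) simp
        then show ?thesis using an by simp
      qed
    qed
  next
    assume dc: "d = c'"
    have A: "a.twist (ytop w d) = 2 * d + 1" "a.twist (2 * d + 1) = ytop w d"
      "a.twist (2 * d + 2) = 2 * d + 3" "a.twist (2 * d + 3) = 2 * d + 2"
      using a.twist_rung_top[of d] a.twist_rung[of d] assms dc by auto
    have B: "b.twist (ytop w d) = 2 * d + 2" "b.twist (2 * d + 2) = ytop w d"
      "b.twist (2 * d + 1) = 2 * d + 3" "b.twist (2 * d + 3) = 2 * d + 1"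
    proof -
      have e: "2 * d + 1 = q'" "2 * d + 2 = b.p" using q' by simp_all
      show "b.twist (ytop w d) = 2 * d + 2" "b.twist (2 * d + 2) = ytop w d"
        "b.twist (2 * d + 1) = 2 * d + 3" "b.twist (2 * d + 3) = 2 * d + 1"
        unfolding e by (rule b.twist_first)+
    qed
    let ?D = "{ytop w d, 2 * d + 1, 2 * d + 2, 2 * d + 3}"
    have low: "b.twist n = n" if "n \<notin> ?D" "n \<le> 2 * d + 3" for n
      using that q' unfolding b.twist_def by auto
    have aD: "a.twist n \<in> ?D" if "n \<in> ?D" for n using that A by auto
    consider "n \<in> ?D" | "n \<notin> ?D" "n \<le> 2 * d + 3" | "2 * d + 3 < n" by linarith
    then show ?thesis
    proof cases
      case 1
      then have "n = ytop w d \<or> n = 2 * d + 1 \<or> n = 2 * d + 2 \<or> n = 2 * d + 3" by blast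
      then show ?thesis by (elim disjE) (simp_all only: A B)
    next
      case 2
      have "a.twist n \<notin> ?D" using aD[of "a.twist n"] 2 by (metis a.twist_twist)
      then show ?thesis using low[OF 2] low[of "a.twist n"] ale[of n] 2 dc by simp
    next
      case 3
      have "2 * d + 3 < b.twist n" using 3 yd q' unfolding b.twist_def by (auto, presburger)
      then show ?thesis using a.twist_above 3 dc by simp
    qed
  qed
qed

section \<open>Groups generated by commuting involutions\<close>

text \<open>The intended map from Z_2^t to the group; exponents are integers because these form the
  carrier type of \<open>integer_mod_group\<close>. The factors stand in increasing order of their
  indices.\<close>

fun sgnprod :: "('a, 'b) monoid_scheme \<Rightarrow> (nat \<Rightarrow> 'a) \<Rightarrow> nat \<Rightarrow> (nat \<Rightarrow> int) \<Rightarrow> 'a" where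
  "sgnprod G \<sigma> 0 x = \<one>\<^bsub>G\<^esub>"
| "sgnprod G \<sigma> (Suc n) x = sgnprod G \<sigma> n x \<otimes>\<^bsub>G\<^esub> (if x (Suc n) = 1 then \<sigma> (Suc n) else \<one>\<^bsub>G\<^esub>)"

context group begin

context
  fixes \<sigma> :: "nat \<Rightarrow> 'a" and t :: nat
  assumes cl: "\<And>r. r \<in> {1..t} \<Longrightarrow> \<sigma> r \<in> carrier G"
    and invol: "\<And>r. r \<in> {1..t} \<Longrightarrow> \<sigma> r \<otimes> \<sigma> r = \<one>"
    and comm: "\<And>r r'. r \<in> {1..t} \<Longrightarrow> r' \<in> {1..t} \<Longrightarrow> \<sigma> r \<otimes> \<sigma> r' = \<sigma> r' \<otimes> \<sigma> r"
begin

lemma sgnprod_closed: "n \<le> t \<Longrightarrow> sgnprod G \<sigma> n x \<in> carrier G"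
  by (induction n) (auto intro!: cl)

lemma sgnprod_commute:
  assumes "n \<le> t" "r \<in> {1..t}"
  shows "sgnprod G \<sigma> n x \<otimes> \<sigma> r = \<sigma> r \<otimes> sgnprod G \<sigma> n x"
  using assms(1)
proof (induction n)
  case 0
  then show ?case using cl[OF assms(2)] by simp
next
  case (Suc n)
  let ?f = "if x (Suc n) = 1 then \<sigma> (Suc n) else \<one>"
  have f: "?f \<in> carrier G" "?f \<otimes> \<sigma> r = \<sigma> r \<otimes> ?f" using cl[of "Suc n"] cl[OF assms(2)] comm[of "Suc n" r] assms(2) Suc.prems by auto
  have P: "sgnprod G \<sigma> n x \<in> carrier G" using Suc.prems by (intro sgnprod_closed) simp
  have "sgnprod G \<sigma> n x \<otimes> ?f \<otimes> \<sigma> r = sgnprod G \<sigma> n x \<otimes> \<sigma> r \<otimes> ?f"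
    using m_assoc[OF P f(1) cl[OF assms(2)]] m_assoc[OF P cl[OF assms(2)] f(1)] f(2) by simp
  also have "\<dots> = \<sigma> r \<otimes> (sgnprod G \<sigma> n x \<otimes> ?f)"
    using Suc f(1) P cl[OF assms(2)] by (simp add: m_assoc)
  finally show ?case by simp
qed

lemma sgnprod_mult:
  assumes "n \<le> t" "\<And>r. r \<in> {1..n} \<Longrightarrow> x r \<in> {0, 1} \<and> y r \<in> {0, 1} \<and> z r = (x r + y r) mod 2"
  shows "sgnprod G \<sigma> n z = sgnprod G \<sigma> n x \<otimes> sgnprod G \<sigma> n y"
  using assms
proof (induction n)
  case 0
  then show ?case by simp
next
  case (Suc n)
  let ?f = "\<lambda>x. if x (Suc n) = (1::int) then \<sigma> (Suc n) else \<one>"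
  have n: "n \<le> t" "Suc n \<in> {1..t}" using Suc.prems by auto
  have f: "?f x \<in> carrier G" for x using cl[OF n(2)] by auto
  have P: "sgnprod G \<sigma> n x \<in> carrier G" for x using n by (intro sgnprod_closed) simp
  have fc: "sgnprod G \<sigma> n y \<otimes> ?f x = ?f x \<otimes> sgnprod G \<sigma> n y"
    using sgnprod_commute[OF n, of y] P by auto
  have "x (Suc n) \<in> {0, 1} \<and> y (Suc n) \<in> {0, 1} \<and> z (Suc n) = (x (Suc n) + y (Suc n)) mod 2"
    using Suc.prems by simp
  then have fz: "?f z = ?f x \<otimes> ?f y" using invol[OF n(2)] cl[OF n(2)] by auto
  have "sgnprod G \<sigma> (Suc n) z = (sgnprod G \<sigma> n x \<otimes> sgnprod G \<sigma> n y) \<otimes> (?f x \<otimes> ?f y)"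
    using Suc.IH Suc.prems n fz by simp
  also have "\<dots> = sgnprod G \<sigma> n x \<otimes> (sgnprod G \<sigma> n y \<otimes> ?f x) \<otimes> ?f y"
    using P f by (simp add: m_assoc del: if_split_asm)
  also have "\<dots> = (sgnprod G \<sigma> n x \<otimes> ?f x) \<otimes> (sgnprod G \<sigma> n y \<otimes> ?f y)"
    unfolding fc using P f by (simp add: m_assoc)
  finally show ?case by simp
qed

lemma sgnprod_unit:
  assumes "n \<le> t" "r \<in> {1..t}"
  shows "sgnprod G \<sigma> n (\<lambda>i. if i = r then 1 else 0) = (if r \<le> n then \<sigma> r else \<one>)"
  using assms(1) cl[OF assms(2)] assms(2) by (induction n) (auto simp: le_Suc_eq)

lemma sgnprod_cong: "(\<And>r. r \<in> {1..n} \<Longrightarrow> x r = y r) \<Longrightarrow> sgnprod G \<sigma> n x = sgnprod G \<sigma> n y"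
  by (induction n) auto

lemma sgnprod_in_generate: "n \<le> t \<Longrightarrow> sgnprod G \<sigma> n x \<in> generate G (\<sigma> ` {1..t})"
proof (induction n)
  case 0
  then show ?case by (simp add: generate.one)
next
  case (Suc n)
  then have "Suc n \<in> {1..t}" by simp
  then have "(if x (Suc n) = 1 then \<sigma> (Suc n) else \<one>) \<in> generate G (\<sigma> ` {1..t})"
    by (simp add: generate.one generate.incl del: atLeastAtMost_iff)
  moreover have "sgnprod G \<sigma> n x \<in> generate G (\<sigma> ` {1..t})" using Suc by simp
  ultimately show ?case unfolding sgnprod.simps by (rule generate.eng[rotated])
qed

text \<open>Commuting involutions make \<open>sgnprod\<close> a homomorphism on exponents modulo 2.
  Its image contains the generators through the unit vectors, and the assumption \<open>ind\<close>
  states that its kernel is trivial.\<close>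

lemma subgroup_generated_involutions_iso:
  assumes ind: "\<And>x. (\<And>r. r \<in> {1..t} \<Longrightarrow> x r \<in> {0, 1}) \<Longrightarrow> sgnprod G \<sigma> t x = \<one> \<Longrightarrow> (\<And>r. r \<in> {1..t} \<Longrightarrow> x r = 0)"
  shows "subgroup_generated G (\<sigma> ` {1..t}) \<cong> product_group {1..t} (\<lambda>_. integer_mod_group 2)"
proof -
  let ?P = "product_group {1..t} (\<lambda>_. integer_mod_group 2)" and ?H = "subgroup_generated G (\<sigma> ` {1..t})"
  let ?\<phi> = "sgnprod G \<sigma> t"
  have sub: "carrier G \<inter> \<sigma> ` {1..t} = \<sigma> ` {1..t}" using cl by blast
  have carH: "carrier ?H = generate G (\<sigma> ` {1..t})" unfolding carrier_subgroup_generated sub ..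
  have carP: "x \<in> carrier ?P \<longleftrightarrow> x \<in> extensional {1..t} \<and> (\<forall>r\<in>{1..t}. x r \<in> {0, 1})" for x
  proof -
    have "carrier (integer_mod_group 2) = {0, 1}" by (auto simp: carrier_integer_mod_group)
    then show ?thesis unfolding carrier_product_group by (simp add: PiE_iff conj_commute)
  qed
  have grpP: "group ?P" by (intro product_group group_integer_mod_group)
  have grpH: "group ?H" by (rule group_subgroup_generated)
  have hom: "?\<phi> \<in> hom ?P ?H"
  proof (rule homI)
    fix x assume "x \<in> carrier ?P"
    then show "?\<phi> x \<in> carrier ?H" unfolding carH by (intro sgnprod_in_generate) simp
  next
    fix x y assume "x \<in> carrier ?P" "y \<in> carrier ?P"
    then have xy: "\<And>r. r \<in> {1..t} \<Longrightarrow> x r \<in> {0, 1}" "\<And>r. r \<in> {1..t} \<Longrightarrow> y r \<in> {0, 1}" unfolding carP by blast+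
    have "?\<phi> (x \<otimes>\<^bsub>?P\<^esub> y) = ?\<phi> x \<otimes> ?\<phi> y"
      by (rule sgnprod_mult) (use xy in \<open>auto simp: integer_mod_group_def\<close>)
    then show "?\<phi> (x \<otimes>\<^bsub>?P\<^esub> y) = ?\<phi> x \<otimes>\<^bsub>?H\<^esub> ?\<phi> y" by simp
  qed
  interpret h: group_hom ?P ?H ?\<phi>
    using grpP grpH hom by (intro group_hom.intro group_hom_axioms.intro)
  have inj: "inj_on ?\<phi> (carrier ?P)"
    unfolding h.inj_on_one_iff
  proof (intro ballI impI allI)
    fix x assume x: "x \<in> carrier ?P" "?\<phi> x = \<one>\<^bsub>?H\<^esub>"
    have "x r = 0" if "r \<in> {1..t}" for r
      by (rule ind[of x, OF _ _ that]) (use x carP in auto)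
    then show "x = \<one>\<^bsub>?P\<^esub>" using x(1) unfolding carP by (auto intro: extensionalityI)
  qed
  have "?\<phi> ` carrier ?P = carrier ?H"
  proof
    show "?\<phi> ` carrier ?P \<subseteq> carrier ?H" using h.hom_closed by blast
    have "subgroup (?\<phi> ` carrier ?P) ?H" by (rule h.img_is_subgroup)
    then have s: "subgroup (?\<phi> ` carrier ?P) G"
      using subgroup_subgroup_generated_iff by blast
    have "\<sigma> ` {1..t} \<subseteq> ?\<phi> ` carrier ?P"
    proof
      fix z assume "z \<in> \<sigma> ` {1..t}"
      then obtain r where r: "r \<in> {1..t}" "z = \<sigma> r" by blast
      let ?u = "\<lambda>i\<in>{1..t}. if i = r then 1 else (0::int)"
      have "?\<phi> ?u = ?\<phi> (\<lambda>i. if i = r then 1 else 0)" by (rule sgnprod_cong) simp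
      also have "\<dots> = z" using sgnprod_unit[OF le_refl r(1)] r by simp
      finally have "z = ?\<phi> ?u" ..
      moreover have "?u \<in> carrier ?P" unfolding carP by auto
      ultimately show "z \<in> ?\<phi> ` carrier ?P" by (rule image_eqI)
    qed
    then show "carrier ?H \<subseteq> ?\<phi> ` carrier ?P"
      unfolding carH using generate_subgroup_incl[OF _ s] by blast
  qed
  then have "?\<phi> \<in> iso ?P ?H" using hom inj unfolding iso_def bij_betw_def by blast
  then have "?P \<cong> ?H" by (rule is_isoI)
  then show ?thesis using group.iso_sym[OF grpP] by blast
qed

end

end

section \<open>The ladders of a snake word\<close>

definition turn :: "word \<Rightarrow> nat \<Rightarrow> bool" where
  "turn w c \<longleftrightarrow> 1 \<le> c \<and> c + 1 \<le> length w \<and> word_letter w c \<noteq> word_letter w (c + 1)"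

text \<open>With only two letters, two consecutive changes produce an alternating triple, which is
  one of the forbidden words.\<close>

lemma no_adjacent_turns:
  assumes w: "w \<in> \<V>" and t: "turn w c"
  shows "\<not> turn w (c + 1)"
proof
  assume t': "turn w (c + 1)"
  obtain d where d: "c = Suc d" using t unfolding turn_def by (cases c) auto
  have len: "d + 3 \<le> length w" using t' d unfolding turn_def by simp
  have ne: "w ! d \<noteq> w ! Suc d" "w ! Suc d \<noteq> w ! Suc (Suc d)"
    using t t' unfolding turn_def word_letter_def d by auto
  have "drop d w = [w ! d, w ! Suc d, w ! Suc (Suc d)] @ drop (d + 3) w"
    using len by (simp add: Cons_nth_drop_Suc numeral_eq_Suc)
  then have "w = take d w @ [w ! d, w ! Suc d, w ! Suc (Suc d)] @ drop (d + 3) w"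
    by (metis append_take_drop_id)
  then have "sublist [w ! d, w ! Suc d, w ! Suc (Suc d)] w"
    unfolding sublist_def by blast
  moreover have "[w ! d, w ! Suc d, w ! Suc (Suc d)] = [L, R, L] \<or> [w ! d, w ! Suc d, w ! Suc (Suc d)] = [R, L, R]"
    using ne by (cases "w ! d"; cases "w ! Suc d"; cases "w ! Suc (Suc d)") auto
  ultimately show False using w unfolding \<V>_def by auto
qed

lemma ytop_Suc:
  assumes "1 \<le> d"
  shows "ytop w (d + 1) = (if word_letter w d \<noteq> word_letter w (d + 1) then 2 * d + 1 else 2 * d + 2)"
  using assms unfolding ytop_def by auto

lemma finite_turn: "finite {c. turn w c}"
  by (rule finite_subset[of _ "{..length w}"]) (auto simp: turn_def)

lemma turns_eq: "turns w = sorted_list_of_set {c. turn w c}"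
  unfolding turns_def turn_def ..

lemma set_turns: "set (turns w) = {c. turn w c}"
  unfolding turns_eq using finite_turn by simp

lemma breakpoints_strict_sorted:
  assumes "w \<noteq> []"
  shows "sorted_wrt (<) (breakpoints w)"
  unfolding breakpoints_def using assms set_turns[of w]
  by (auto simp: sorted_wrt_append turn_def turns_eq)

lemma length_breakpoints: "length (breakpoints w) = num_ladders w + 1"
  unfolding breakpoints_def num_ladders_def by simp

lemma breakpoints_first: "breakpoints w ! 0 = 0"
  unfolding breakpoints_def by simp

lemma breakpoints_last: "breakpoints w ! num_ladders w = length w"
  unfolding breakpoints_def num_ladders_def by (simp add: nth_append)

lemma breakpoints_turn: "1 \<le> r \<Longrightarrow> r < num_ladders w \<Longrightarrow> turn w (breakpoints w ! r)"
proof -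
  assume r: "1 \<le> r" "r < num_ladders w"
  then have "breakpoints w ! r = turns w ! (r - 1)"
    unfolding breakpoints_def num_ladders_def by (cases r) (auto simp: nth_append)
  moreover have "turns w ! (r - 1) \<in> set (turns w)" using r unfolding num_ladders_def by (intro nth_mem) auto
  ultimately show ?thesis using set_turns by auto
qed

lemma turn_breakpoints: "turn w d \<Longrightarrow> \<exists>j. 1 \<le> j \<and> j < num_ladders w \<and> breakpoints w ! j = d"
proof -
  assume "turn w d"
  then have "d \<in> set (turns w)" using set_turns by auto
  then obtain i where "i < length (turns w)" "turns w ! i = d" by (auto simp: in_set_conv_nth)
  then show ?thesis unfolding breakpoints_def num_ladders_def
    by (intro exI[of _ "Suc i"]) (auto simp: nth_append)
qed

lemma breakpoints_less:
  "w \<noteq> [] \<Longrightarrow> i < j \<Longrightarrow> j \<le> num_ladders w \<Longrightarrow> breakpoints w ! i < breakpoints w ! j"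
  using sorted_wrt_nth_less[OF breakpoints_strict_sorted] length_breakpoints by simp

text \<open>At a breakpoint \<open>c > 0\<close> with a following square, the word turns and the
  next top is \<open>2 * c + 1\<close>. At \<open>c = 0\<close> the first letter decides. The value
  2 for the empty word reproduces the convention x_2 = 1, x_3 = 2.\<close>

definition shared_middle :: "word \<Rightarrow> nat \<Rightarrow> nat" where
  "shared_middle w c = (if c = 0 then (if w = [] then 2 else ytop w 1) else 2 * c + 1)"

text \<open>For a nonempty word the breakpoints between the two ends are exactly the turns. Hence no
  turn lies strictly inside a ladder, which gives the inner tops, and
  \<open>no_adjacent_turns\<close> at \<open>c\<close> and \<open>c'\<close> gives the straightness
  conditions outside it.\<close>

lemma snake_segment_breakpoints:
  assumes w: "w \<in> \<V>" and r: "1 \<le> r" "r \<le> num_ladders w"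
  defines "c \<equiv> breakpoints w ! (r - 1)" and "c' \<equiv> breakpoints w ! r"
  shows "snake_segment w c c' (shared_middle w c)"
proof (cases "w = []")
  case True
  have "num_ladders w = 1" using set_turns[of w] True unfolding num_ladders_def turn_def by simp
  then have "r = 1" using r by simp
  then have "c = 0" "c' = 0"
    using breakpoints_first breakpoints_last[of w] True \<open>num_ladders w = 1\<close> unfolding c_def c'_def by simp_all
  then show ?thesis unfolding shared_middle_def using True by unfold_locales auto
next
  case False
  then have len: "1 \<le> length w" by (cases w) auto
  have lt: "c < c'" unfolding c_def c'_def using r by (intro breakpoints_less[OF False]) auto
  have c'k: "c' \<le> length w"
    using breakpoints_less[OF False, of r "num_ladders w"] breakpoints_last[of w] r
    unfolding c'_def by (cases "r = num_ladders w") auto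
  have tc: "turn w c" if "1 \<le> c"
  proof -
    have "r \<noteq> 1" using that breakpoints_first[of w] unfolding c_def by auto
    then show ?thesis unfolding c_def using r by (intro breakpoints_turn) auto
  qed
  have tc': "turn w c'" if "c' < length w"
  proof -
    have "r \<noteq> num_ladders w" using that breakpoints_last[of w] unfolding c'_def by auto
    then show ?thesis unfolding c'_def using r by (intro breakpoints_turn) auto
  qed
  have between: "\<not> turn w d" if d: "c < d" "d < c'" for d
  proof
    assume "turn w d"
    then obtain j where j: "1 \<le> j" "j < num_ladders w" "breakpoints w ! j = d" using turn_breakpoints by blast
    consider "j \<le> r - 1" | "j = r" | "r < j" by linarith
    then show False
    proof cases
      case 1
      have "r - 1 \<le> num_ladders w" using r by simp
      then have "breakpoints w ! j \<le> c"
        unfolding c_def using 1 breakpoints_less[OF False, of j "r - 1"] by (cases "j = r - 1") auto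
      then show False using j d by simp
    next
      case 2
      then show False using j d unfolding c'_def by simp
    next
      case 3
      then show False using breakpoints_less[OF False, of r j] j d unfolding c'_def by simp
    qed
  qed
  have straight: "ytop w (d + 1) = 2 * d + 2" if "1 \<le> d" "d + 1 \<le> length w" "\<not> turn w d" for d
    using ytop_Suc[OF that(1), of w] that unfolding turn_def by auto
  have turned: "ytop w (d + 1) = 2 * d + 1" if "turn w d" for d
    using ytop_Suc[of d w] that unfolding turn_def by auto
  show ?thesis
  proof
    show "c \<le> c'" "c' \<le> length w" "0 < length w \<Longrightarrow> c < c'" using lt c'k by auto
    show "shared_middle w c = 2 * c + 1 \<or> shared_middle w c = 2 * c + 2"
      unfolding shared_middle_def using ytop_cases[of 1 w] False by auto
    show "ytop w (Suc c) = shared_middle w c"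
      unfolding shared_middle_def using False turned[OF tc] by (cases "c = 0") auto
    show "1 \<le> c \<Longrightarrow> shared_middle w c = 2 * c + 1" unfolding shared_middle_def by simp
    show "ytop w i = 2 * i" if i: "c + 2 \<le> i" "i \<le> c'" for i
    proof -
      have "\<not> turn w (i - 1)" using i by (intro between) auto
      then show ?thesis using straight[of "i - 1"] i c'k by auto
    qed
    show "ytop w (c' + 1) = 2 * c' + 1" if "c' < length w" by (rule turned[OF tc'[OF that]])
    show "ytop w (c' + 2) = 2 * c' + 4" if "c' + 2 \<le> length w"
    proof -
      have "\<not> turn w (c' + 1)" using that by (intro no_adjacent_turns[OF w] tc') simp
      then show ?thesis using straight[of "c' + 1"] that by simp
    qed
    show "ytop w c = 2 * c" if "2 \<le> c"
    proof -
      have "turn w c" using that by (intro tc) simp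
      then have "\<not> turn w (c - 1)" using no_adjacent_turns[OF w, of "c - 1"] that by auto
      then show ?thesis using straight[of "c - 1"] that lt c'k by auto
    qed
  qed
qed

section \<open>The elementary twists of a snake word\<close>

definition ladder_twist :: "word \<Rightarrow> nat \<Rightarrow> nat \<Rightarrow> nat" where
  "ladder_twist w r = ladder_segment.twist w (breakpoints w ! (r - 1)) (breakpoints w ! r)
     (shared_middle w (breakpoints w ! (r - 1)))"

context
  fixes w :: word
  assumes w: "w \<in> \<V>"
begin

text \<open>A ladder of a nonempty word has at least six elements, so the selected labelling is
  forced to be \<open>label\<close>. For the empty word the convention gives the same
  labels.\<close>

lemma elementary_twist_restrict:
  assumes r: "r \<in> {1..num_ladders w}"
  shows "elementary_twist w r = (\<lambda>v\<in>V0 w. elt_map (ladder_twist w r) v)"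
proof -
  let ?c = "breakpoints w ! (r - 1)" and ?c' = "breakpoints w ! r"
  interpret s: snake_segment w ?c ?c' "shared_middle w ?c"
    using snake_segment_breakpoints[OF w] r by simp
  have lad: "ladder w r = s.lad" unfolding ladder_def s.ladder_eq ..
  have card: "card (ladder w r) = s.s" unfolding lad by (rule s.card_ladder)
  have "ladder_labeling w r n = Elt (s.label n)" if n: "n \<in> {1..s.s}" for n
  proof (cases "w = []")
    case True
    have c: "?c = 0" "?c' = 0" using s.cc' s.c'k True by simp_all
    have q: "shared_middle w ?c = 2" unfolding shared_middle_def c using True by simp
    have p1: "s.p = 1" unfolding s.p_def unfolding q unfolding c by simp
    have s4: "s.s = 4" unfolding s.s_def unfolding c by simp
    have "s.label n = n - 1"
      unfolding s.label_def p1 unfolding q unfolding c using n[unfolded s4] by auto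
    then show ?thesis unfolding ladder_labeling_def using True by simp
  next
    case False
    have "?c < ?c'" using s.nontrivial False by simp
    then have s5: "5 \<le> s.s" unfolding s.s_def by simp
    have "is_ladder_labeling w r (Elt \<circ> s.label)"
      unfolding is_ladder_labeling_def card unfolding lad
      using s.bij_label s.label_covers by (simp add: comp_def)
    then have il: "is_ladder_labeling w r (ladder_labeling w r)"
      using False someI[of "is_ladder_labeling w r"] unfolding ladder_labeling_def by simp
    note l = il[unfolded is_ladder_labeling_def card, unfolded lad]
    show ?thesis by (rule s.labeling_unique[OF s5 conjunct1[OF l] _ n]) (use conjunct2[OF l] in blast)
  qed
  from s.elementary_twist_eq[OF lad this] show ?thesis unfolding ladder_twist_def .
qed

lemma ladder_twist_le: "r \<in> {1..num_ladders w} \<Longrightarrow> n \<le> 2 * length w + 3 \<Longrightarrow> ladder_twist w r n \<le> 2 * length w + 3"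
proof -
  assume r: "r \<in> {1..num_ladders w}" and n: "n \<le> 2 * length w + 3"
  interpret s: snake_segment w "breakpoints w ! (r - 1)" "breakpoints w ! r" "shared_middle w (breakpoints w ! (r - 1))"
    using snake_segment_breakpoints[OF w] r by simp
  show ?thesis unfolding ladder_twist_def using s.twist_le[OF n] .
qed

lemma ladder_twist_twist: "r \<in> {1..num_ladders w} \<Longrightarrow> ladder_twist w r (ladder_twist w r n) = n"
proof -
  assume r: "r \<in> {1..num_ladders w}"
  interpret s: snake_segment w "breakpoints w ! (r - 1)" "breakpoints w ! r" "shared_middle w (breakpoints w ! (r - 1))"
    using snake_segment_breakpoints[OF w] r by simp
  show ?thesis unfolding ladder_twist_def by (rule s.twist_twist)
qed

lemma ladder_twist_linear:
  "r \<in> {1..num_ladders w} \<Longrightarrow> \<exists>g. linear g \<and> (\<forall>x\<in>V0 w. g (vertex_of w x) = vertex_of w (elt_map (ladder_twist w r) x))"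
proof -
  assume r: "r \<in> {1..num_ladders w}"
  interpret s: snake_segment w "breakpoints w ! (r - 1)" "breakpoints w ! r" "shared_middle w (breakpoints w ! (r - 1))"
    using snake_segment_breakpoints[OF w] r by simp
  show ?thesis unfolding ladder_twist_def by (rule s.twist_linear)
qed

lemma ladder_twist_commute_less:
  assumes r: "r \<in> {1..num_ladders w}" "r' \<in> {1..num_ladders w}" "r < r'"
  shows "ladder_twist w r (ladder_twist w r' n) = ladder_twist w r' (ladder_twist w r n)"
proof -
  let ?c = "breakpoints w ! (r - 1)" and ?c' = "breakpoints w ! r"
    and ?d = "breakpoints w ! (r' - 1)" and ?d' = "breakpoints w ! r'"
  have ne: "w \<noteq> []"
  proof
    assume "w = []"
    then have "num_ladders w = 1" using set_turns[of w] unfolding num_ladders_def turn_def by simp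
    then show False using r by simp
  qed
  have 1: "?c < ?c'" using r by (intro breakpoints_less[OF ne]) auto
  have 2: "?c' \<le> ?d"
  proof (cases "r = r' - 1")
    case False
    then have "r < r' - 1" "r' - 1 \<le> num_ladders w" using r by auto
    then show ?thesis using breakpoints_less[OF ne] by (simp add: less_imp_le)
  qed simp
  \<comment> \<open>A distance of exactly 1 would make \<open>?c'\<close> and \<open>?d\<close>
    adjacent turns.\<close>
  have 3: "?d = ?c' \<or> ?c' + 2 \<le> ?d"
  proof (rule ccontr)
    assume "\<not> ?thesis"
    then have d: "?d = ?c' + 1" using 2 by linarith
    then have "r \<noteq> r' - 1" by auto
    then have "turn w ?c'" "turn w ?d" using r by (auto intro!: breakpoints_turn)
    then show False using no_adjacent_turns[OF w, of ?c'] d by simp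
  qed
  show ?thesis unfolding ladder_twist_def
    by (rule twist_commute[OF snake_segment_breakpoints[OF w] snake_segment_breakpoints[OF w] 1 2 3]) (use r in auto)
qed

lemma ladder_twist_commute:
  assumes r: "r \<in> {1..num_ladders w}" "r' \<in> {1..num_ladders w}"
  shows "ladder_twist w r (ladder_twist w r' n) = ladder_twist w r' (ladder_twist w r n)"
  using ladder_twist_commute_less[OF r] ladder_twist_commute_less[OF r(2,1)]
  by (cases r r' rule: linorder_cases) auto

text \<open>The witness for the independence of the twists: twist \<open>r\<close> moves the top of
  its first square to the middle element \<open>p\<close>, whereas later ladders contain only larger
  numbers than this top.\<close>

lemma ladder_twist_top:
  assumes r: "r \<in> {1..num_ladders w}"
  shows "ladder_twist w r (ytop w (breakpoints w ! (r - 1))) \<noteq> ytop w (breakpoints w ! (r - 1))"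
    and "r' \<in> {1..num_ladders w} \<Longrightarrow> r < r' \<Longrightarrow>
      ladder_twist w r' (ytop w (breakpoints w ! (r - 1))) = ytop w (breakpoints w ! (r - 1))"
proof -
  let ?c = "breakpoints w ! (r - 1)"
  interpret s: snake_segment w ?c "breakpoints w ! r" "shared_middle w ?c"
    using snake_segment_breakpoints[OF w] r by simp
  have y: "ytop w ?c \<le> 2 * ?c" by (rule ytop_le)
  have "s.twist (ytop w ?c) = s.p" by (rule s.twist_first)
  then show "ladder_twist w r (ytop w ?c) \<noteq> ytop w ?c" unfolding ladder_twist_def using s.p y by auto
  assume r': "r' \<in> {1..num_ladders w}" "r < r'"
  let ?d = "breakpoints w ! (r' - 1)"
  interpret b: snake_segment w ?d "breakpoints w ! r'" "shared_middle w ?d"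
    using snake_segment_breakpoints[OF w] r' by simp
  have ne: "w \<noteq> []"
  proof
    assume "w = []"
    then have "num_ladders w = 1" using set_turns[of w] unfolding num_ladders_def turn_def by simp
    then show False using r r' by simp
  qed
  have "?c < ?d" using r r' by (intro breakpoints_less[OF ne]) auto
  then have "ytop w ?c < ytop w ?d" using y ytop_ge[of ?d w] by linarith
  then show "ladder_twist w r' (ytop w ?c) = ytop w ?c" unfolding ladder_twist_def by (rule b.twist_below)
qed

section \<open>The twist group\<close>

lemma elt_map_V0: "r \<in> {1..num_ladders w} \<Longrightarrow> v \<in> V0 w \<Longrightarrow> elt_map (ladder_twist w r) v \<in> V0 w"
  by (cases v) (simp_all add: ladder_twist_le)

lemma elt_map_twist_twist: "r \<in> {1..num_ladders w} \<Longrightarrow> elt_map (ladder_twist w r) (elt_map (ladder_twist w r) v) = v"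
  by (cases v) (simp_all add: ladder_twist_twist)

lemma elementary_twist_Bij:
  assumes r: "r \<in> {1..num_ladders w}"
  shows "elementary_twist w r \<in> Bij (V0 w)"
proof -
  have "bij_betw (elementary_twist w r) (V0 w) (V0 w)"
    unfolding elementary_twist_restrict[OF r]
    by (rule bij_betw_byWitness[where f' = "elt_map (ladder_twist w r)"])
      (use elt_map_V0[OF r] elt_map_twist_twist[OF r] in auto)
  then show ?thesis unfolding Bij_def elementary_twist_restrict[OF r] by simp
qed

interpretation B: group "BijGroup (V0 w)" by (rule group_BijGroup)

lemma elementary_twist_mult:
  assumes r: "r \<in> {1..num_ladders w}" "r' \<in> {1..num_ladders w}"
  shows "elementary_twist w r \<otimes>\<^bsub>BijGroup (V0 w)\<^esub> elementary_twist w r'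
     = (\<lambda>v\<in>V0 w. elt_map (ladder_twist w r) (elt_map (ladder_twist w r') v))"
  using elementary_twist_Bij[OF r(1)] elementary_twist_Bij[OF r(2)] elt_map_V0[OF r(2)]
  unfolding BijGroup_def elementary_twist_restrict[OF r(1)] elementary_twist_restrict[OF r(2)]
  by (auto simp: compose_def restrict_def)

lemma twist_group_iso:
  "twist_group w \<cong> product_group {1..num_ladders w} (\<lambda>_. integer_mod_group 2)"
  unfolding twist_group_def
proof (rule B.subgroup_generated_involutions_iso)
  fix r assume r: "r \<in> {1..num_ladders w}"
  show "elementary_twist w r \<in> carrier (BijGroup (V0 w))"
    using elementary_twist_Bij[OF r] unfolding BijGroup_def by simp
  show "elementary_twist w r \<otimes>\<^bsub>BijGroup (V0 w)\<^esub> elementary_twist w r = \<one>\<^bsub>BijGroup (V0 w)\<^esub>"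
    unfolding elementary_twist_mult[OF r r] elt_map_twist_twist[OF r] by (simp add: BijGroup_def)
  fix r' assume r': "r' \<in> {1..num_ladders w}"
  have "elt_map (ladder_twist w r) (elt_map (ladder_twist w r') v) = elt_map (ladder_twist w r') (elt_map (ladder_twist w r) v)" for v
    by (cases v) (simp_all add: ladder_twist_commute[OF r r'])
  then show "elementary_twist w r \<otimes>\<^bsub>BijGroup (V0 w)\<^esub> elementary_twist w r'
      = elementary_twist w r' \<otimes>\<^bsub>BijGroup (V0 w)\<^esub> elementary_twist w r"
    unfolding elementary_twist_mult[OF r r'] elementary_twist_mult[OF r' r] by simp
next
  fix x :: "nat \<Rightarrow> int" and r0
  let ?G = "BijGroup (V0 w)" and ?\<sigma> = "elementary_twist w" and ?t = "num_ladders w"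
  assume x: "\<And>r. r \<in> {1..?t} \<Longrightarrow> x r \<in> {0, 1}" and one: "sgnprod ?G ?\<sigma> ?t x = \<one>\<^bsub>?G\<^esub>" and r0: "r0 \<in> {1..?t}"
  show "x r0 = 0"
  proof (rule ccontr)
    assume nz: "x r0 \<noteq> 0"
    \<comment> \<open>The product is evaluated at the top of the first square of the first ladder
      with a nonzero exponent. Factors on the right act first: those with larger index fix the top,
      factor \<open>r\<close> moves it, and those with smaller index are trivial. So the product
      cannot be the identity.\<close>
    define r where "r = (LEAST r. r \<in> {1..?t} \<and> x r \<noteq> 0)"
    have r: "r \<in> {1..?t}" "x r \<noteq> 0"
      using LeastI[of "\<lambda>r. r \<in> {1..?t} \<and> x r \<noteq> 0" r0] r0 nz unfolding r_def by blast+
    have below: "x i = 0" if "i \<in> {1..r - 1}" for i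
    proof -
      have "i < r" "i \<in> {1..?t}" using that r(1) by auto
      then show ?thesis using not_less_Least[of i "\<lambda>r. r \<in> {1..?t} \<and> x r \<noteq> 0"] unfolding r_def by blast
    qed
    have x1: "x r = 1" using x[OF r(1)] r(2) by auto
    let ?y = "ytop w (breakpoints w ! (r - 1))"
    have clos: "?\<sigma> i \<in> carrier ?G" if "i \<in> {1..?t}" for i
      using elementary_twist_Bij[OF that] unfolding BijGroup_def by simp
    have Pcl: "sgnprod ?G ?\<sigma> n x \<in> carrier ?G" if "n \<le> ?t" for n
      using that clos by (induction n) auto
    have mult_app: "(f \<otimes>\<^bsub>?G\<^esub> g) v = f (g v)" if "f \<in> carrier ?G" "g \<in> carrier ?G" "v \<in> V0 w" for f g v
      using that unfolding BijGroup_def by (simp add: compose_def)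
    have yV: "Elt ?y \<in> V0 w"
    proof -
      interpret s: snake_segment w "breakpoints w ! (r - 1)" "breakpoints w ! r" "shared_middle w (breakpoints w ! (r - 1))"
        using snake_segment_breakpoints[OF w] r by simp
      show ?thesis using ytop_le[of w "breakpoints w ! (r - 1)"] s.cc' s.c'k by simp
    qed
    have "sgnprod ?G ?\<sigma> n x (Elt ?y) = Elt (ladder_twist w r ?y)" if "r \<le> n" "n \<le> ?t" for n
      using that
    proof (induction n rule: dec_induct)
      case base
      have "sgnprod ?G ?\<sigma> m x = \<one>\<^bsub>?G\<^esub>" if "m \<le> r - 1" for m
        using that below by (induction m) auto
      then have "sgnprod ?G ?\<sigma> (r - 1) x = \<one>\<^bsub>?G\<^esub>" by simp
      moreover obtain m where m: "r = Suc m" using r(1) by (cases r) auto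
      ultimately have "sgnprod ?G ?\<sigma> r x = \<one>\<^bsub>?G\<^esub> \<otimes>\<^bsub>?G\<^esub> ?\<sigma> r" using x1 by simp
      then have "sgnprod ?G ?\<sigma> r x = ?\<sigma> r" using B.l_one[OF clos[OF r(1)]] by simp
      then show ?case using yV unfolding elementary_twist_restrict[OF r(1)] by simp
    next
      case (step n)
      let ?f = "if x (Suc n) = 1 then ?\<sigma> (Suc n) else \<one>\<^bsub>?G\<^esub>"
      have n: "Suc n \<in> {1..?t}" using step by simp
      have f: "?f \<in> carrier ?G" using clos[OF n] by simp
      have "?f (Elt ?y) = Elt ?y"
        using yV ladder_twist_top(2)[OF r(1) n] step(1) unfolding elementary_twist_restrict[OF n]
        by (simp add: BijGroup_def)
      then have "sgnprod ?G ?\<sigma> (Suc n) x (Elt ?y) = sgnprod ?G ?\<sigma> n x (Elt ?y)"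
        using mult_app[OF Pcl f yV] step by simp
      then show ?case using step by simp
    qed
    from this[of ?t] have "Elt ?y = Elt (ladder_twist w r ?y)"
      using r(1) yV unfolding one by (simp add: BijGroup_def)
    then show False using ladder_twist_top(1)[OF r(1)] by simp
  qed
qed

lemma carrier_twist_group: "carrier (twist_group w) = generate (BijGroup (V0 w)) (elementary_twist w ` {1..num_ladders w})"
proof -
  have "elementary_twist w ` {1..num_ladders w} \<subseteq> carrier (BijGroup (V0 w))"
    using elementary_twist_Bij unfolding BijGroup_def by auto
  then show ?thesis unfolding twist_group_def carrier_subgroup_generated by (simp add: Int_absorb1)
qed

lemma elementary_twist_linear:
  assumes "r \<in> {1..num_ladders w}"
  shows "\<exists>g. linear g \<and> (\<forall>x\<in>V0 w. g (vertex_of w x) = vertex_of w (elementary_twist w r x))"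
  using ladder_twist_linear[OF assms] unfolding elementary_twist_restrict[OF assms] by simp

lemma twist_induced_linear:
  assumes "\<tau> \<in> carrier (twist_group w)"
  shows "\<tau> \<in> Bij (V0 w) \<and> (\<exists>g. linear g \<and> (\<forall>x\<in>V0 w. g (vertex_of w x) = vertex_of w (\<tau> x)))"
  using assms unfolding carrier_twist_group
proof (induction rule: generate.induct)
  case one
  have e: "\<one>\<^bsub>BijGroup (V0 w)\<^esub> = (\<lambda>x\<in>V0 w. x)" by (simp add: BijGroup_def)
  have "\<forall>x\<in>V0 w. vertex_of w x = vertex_of w ((\<lambda>x\<in>V0 w. x) x)" by simp
  then show ?case unfolding e using id_Bij[of "V0 w"] linear_ident by blast
next
  case (incl h)
  then obtain r where r: "r \<in> {1..num_ladders w}" "h = elementary_twist w r" by blast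
  show ?case unfolding r(2) using elementary_twist_Bij[OF r(1)] elementary_twist_linear[OF r(1)] by blast
next
  case (inv h)
  then obtain r where r: "r \<in> {1..num_ladders w}" "h = elementary_twist w r" by blast
  \<comment> \<open>A generator is its own inverse, so this case reduces to that of a
    generator.\<close>
  have "h \<otimes>\<^bsub>BijGroup (V0 w)\<^esub> h = \<one>\<^bsub>BijGroup (V0 w)\<^esub>"
    unfolding r(2) elementary_twist_mult[OF r(1) r(1)] elt_map_twist_twist[OF r(1)] by (simp add: BijGroup_def)
  moreover have "h \<in> carrier (BijGroup (V0 w))"
    using elementary_twist_Bij[OF r(1)] r(2) unfolding BijGroup_def by simp
  ultimately have "inv\<^bsub>BijGroup (V0 w)\<^esub> h = h" by (intro B.inv_equality)
  then show ?case
    unfolding r(2) using elementary_twist_Bij[OF r(1)] elementary_twist_linear[OF r(1)] by simp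
next
  case (eng h1 h2)
  then obtain g1 g2 where g: "linear g1" "\<forall>x\<in>V0 w. g1 (vertex_of w x) = vertex_of w (h1 x)"
    "linear g2" "\<forall>x\<in>V0 w. g2 (vertex_of w x) = vertex_of w (h2 x)" by blast
  have b: "h1 \<in> Bij (V0 w)" "h2 \<in> Bij (V0 w)" using eng by auto
  have m: "h1 \<otimes>\<^bsub>BijGroup (V0 w)\<^esub> h2 = compose (V0 w) h1 h2" using b unfolding BijGroup_def by simp
  have h2: "h2 x \<in> V0 w" if "x \<in> V0 w" for x using Bij_imp_funcset[OF b(2)] that by auto
  have "linear (g1 \<circ> g2)" by (rule linear_compose[OF g(3,1)])
  moreover have "\<forall>x\<in>V0 w. (g1 \<circ> g2) (vertex_of w x) = vertex_of w (compose (V0 w) h1 h2 x)"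
    using g(2,4) h2 by (simp add: compose_def)
  ultimately show ?case unfolding m using compose_Bij[OF b] by blast
qed

section \<open>Twists as symmetries of the vertices and their triangulations\<close>

lemma group_twist_group: "group (twist_group w)"
  unfolding twist_group_def by (rule B.group_subgroup_generated)

lemma twist_vertex_vertex_of: "x \<in> V0 w \<Longrightarrow> twist_vertex w \<tau> (vertex_of w x) = vertex_of w (\<tau> x)"
  unfolding twist_vertex_def by (simp add: the_inv_into_f_f[OF inj_vertex_of])

lemma twist_in_V0: "\<tau> \<in> carrier (twist_group w) \<Longrightarrow> x \<in> V0 w \<Longrightarrow> \<tau> x \<in> V0 w"
  using twist_induced_linear[of \<tau>] Bij_imp_funcset[of \<tau> "V0 w"] by auto

lemma twist_mult_apply:
  assumes "\<tau> \<in> carrier (twist_group w)" "\<upsilon> \<in> carrier (twist_group w)" "x \<in> V0 w"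
  shows "(\<tau> \<otimes>\<^bsub>twist_group w\<^esub> \<upsilon>) x = \<tau> (\<upsilon> x)"
  using assms twist_induced_linear[of \<tau>] twist_induced_linear[of \<upsilon>]
  unfolding twist_group_def by (simp add: BijGroup_def compose_def)

lemma twist_one_apply: "x \<in> V0 w \<Longrightarrow> \<one>\<^bsub>twist_group w\<^esub> x = x"
  unfolding twist_group_def by (simp add: BijGroup_def)

lemma twist_vertex_mult:
  assumes "\<tau> \<in> carrier (twist_group w)" "\<upsilon> \<in> carrier (twist_group w)" "a \<in> polytope_vertices w"
  shows "twist_vertex w (\<tau> \<otimes>\<^bsub>twist_group w\<^esub> \<upsilon>) a = twist_vertex w \<tau> (twist_vertex w \<upsilon> a)"
proof -
  obtain x where x: "x \<in> V0 w" "a = vertex_of w x" using assms(3) unfolding polytope_vertices_eq by blast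
  show ?thesis unfolding x(2)
    by (simp add: twist_vertex_vertex_of x(1) twist_in_V0[OF assms(2)] twist_mult_apply[OF assms(1,2)])
qed

lemma twist_vertex_one: "a \<in> polytope_vertices w \<Longrightarrow> twist_vertex w \<one>\<^bsub>twist_group w\<^esub> a = a"
  unfolding polytope_vertices_eq by (auto simp: twist_vertex_vertex_of twist_one_apply)

lemma twist_vertex_in: "\<tau> \<in> carrier (twist_group w) \<Longrightarrow> a \<in> polytope_vertices w \<Longrightarrow> twist_vertex w \<tau> a \<in> polytope_vertices w"
  unfolding polytope_vertices_eq by (auto simp: twist_vertex_vertex_of twist_in_V0)

text \<open>The map \<open>g'\<close> is induced by the inverse twist and is not an inverse of
  \<open>g\<close> on the whole space, since a linear extension is determined only on the span of
  the vertices.\<close>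

lemma twist_linear_symmetry:
  assumes \<tau>: "\<tau> \<in> carrier (twist_group w)"
  obtains g g' where "linear_symmetry (polytope_vertices w) g g'"
    "\<And>a. a \<in> polytope_vertices w \<Longrightarrow> twist_vertex w \<tau> a = g a"
proof -
  interpret T: group "twist_group w" by (rule group_twist_group)
  let ?A = "polytope_vertices w"
  have lin: "\<exists>g. linear g \<and> (\<forall>a\<in>?A. twist_vertex w \<upsilon> a = g a)" if "\<upsilon> \<in> carrier (twist_group w)" for \<upsilon>
    using twist_induced_linear[OF that] unfolding polytope_vertices_eq by (auto simp: twist_vertex_vertex_of)
  let ?i = "inv\<^bsub>twist_group w\<^esub> \<tau>"
  have i: "?i \<in> carrier (twist_group w)" using \<tau> by simp
  obtain g where g: "linear g" "\<forall>a\<in>?A. twist_vertex w \<tau> a = g a" using lin[OF \<tau>] by blast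
  obtain g' where g': "linear g'" "\<forall>a\<in>?A. twist_vertex w ?i a = g' a" using lin[OF i] by blast
  have 1: "g a \<in> ?A" if "a \<in> ?A" for a using twist_vertex_in[OF \<tau> that] g(2) that by simp
  have 2: "g' a \<in> ?A" if "a \<in> ?A" for a using twist_vertex_in[OF i that] g'(2) that by simp
  have 3: "g' (g a) = a" if "a \<in> ?A" for a
    using twist_vertex_mult[OF i \<tau> that] twist_vertex_one[OF that] g(2) g'(2) 1[OF that] that \<tau> by simp
  have 4: "g (g' a) = a" if "a \<in> ?A" for a
    using twist_vertex_mult[OF \<tau> i that] twist_vertex_one[OF that] g(2) g'(2) 2[OF that] that \<tau> by simp
  have "linear_symmetry ?A g g'" using g(1) g'(1) 1 2 3 4 unfolding linear_symmetry_def by simp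
  then show thesis using g(2) by (intro that) simp_all
qed

lemma twist_triangulation_mult:
  assumes "\<tau> \<in> carrier (twist_group w)" "\<upsilon> \<in> carrier (twist_group w)" "T \<subseteq> Pow (polytope_vertices w)"
  shows "twist_triangulation w (\<tau> \<otimes>\<^bsub>twist_group w\<^esub> \<upsilon>) T = twist_triangulation w \<tau> (twist_triangulation w \<upsilon> T)"
  unfolding twist_triangulation_def image_image
proof (rule image_cong[OF refl], rule image_cong[OF refl])
  fix S a assume "S \<in> T" "a \<in> S"
  then have "a \<in> polytope_vertices w" using assms(3) by blast
  then show "twist_vertex w (\<tau> \<otimes>\<^bsub>twist_group w\<^esub> \<upsilon>) a = twist_vertex w \<tau> (twist_vertex w \<upsilon> a)"
    by (rule twist_vertex_mult[OF assms(1,2)])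
qed

lemma twist_triangulation_one:
  assumes "T \<subseteq> Pow (polytope_vertices w)"
  shows "twist_triangulation w \<one>\<^bsub>twist_group w\<^esub> T = T"
proof -
  have "twist_vertex w \<one>\<^bsub>twist_group w\<^esub> ` S = S" if "S \<in> T" for S
  proof -
    have "twist_vertex w \<one>\<^bsub>twist_group w\<^esub> ` S = id ` S"
      using that assms twist_vertex_one by (intro image_cong refl) auto
    then show ?thesis by simp
  qed
  then show ?thesis unfolding twist_triangulation_def by simp
qed

lemma twist_preserves:
  assumes \<tau>: "\<tau> \<in> carrier (twist_group w)"
  shows "triangulation_of (polytope_vertices w) T \<Longrightarrow> triangulation_of (polytope_vertices w) (twist_triangulation w \<tau> T)"
    and "regular_triangulation (polytope_vertices w) T \<Longrightarrow> regular_triangulation (polytope_vertices w) (twist_triangulation w \<tau> T)"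
    and "flip_adjacent (polytope_vertices w) T U \<Longrightarrow>
      flip_adjacent (polytope_vertices w) (twist_triangulation w \<tau> T) (twist_triangulation w \<tau> U)"
proof -
  let ?A = "polytope_vertices w"
  obtain g g' where g: "linear_symmetry ?A g g'" and eq: "\<And>a. a \<in> ?A \<Longrightarrow> twist_vertex w \<tau> a = g a"
    using twist_linear_symmetry[OF \<tau>] by blast
  interpret linear_symmetry ?A g g' by (rule g)
  have im: "twist_triangulation w \<tau> T = (`) g ` T" if "triangulation_of ?A T" for T
    unfolding twist_triangulation_def
  proof (rule image_cong[OF refl], rule image_cong[OF refl])
    fix S a assume "S \<in> T" "a \<in> S"
    then have "a \<in> ?A" using triangulation_Pow[OF that] by blast
    then show "twist_vertex w \<tau> a = g a" by (rule eq)
  qed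
  show "triangulation_of ?A (twist_triangulation w \<tau> T)" if "triangulation_of ?A T"
    unfolding im[OF that] by (rule triangulation_image[OF that])
  show "regular_triangulation ?A (twist_triangulation w \<tau> T)" if r: "regular_triangulation ?A T"
  proof -
    have "triangulation_of ?A T" using r unfolding regular_triangulation_def by simp
    then show ?thesis using regular_image[OF r] im by simp
  qed
  show "flip_adjacent ?A (twist_triangulation w \<tau> T) (twist_triangulation w \<tau> U)" if f: "flip_adjacent ?A T U"
  proof -
    have "triangulation_of ?A T" "triangulation_of ?A U" using f unfolding flip_adjacent_def by simp_all
    then show ?thesis using flip_adjacent_image[OF f] im by simp
  qed
qed

end

section \<open>The action on the flip graph component\<close>

theorem corollary5p18:
  fixes w :: word and C :: "(elt \<Rightarrow>\<^sub>0 real) set set set"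
  assumes "w \<in> \<V>"
    and "flip_graph_component (polytope_vertices w) C"
    and "{T. regular_triangulation (polytope_vertices w) T} \<subseteq> C"
  shows "twist_group w \<cong> product_group {1..num_ladders w} (\<lambda>_. integer_mod_group 2)
    \<and> group_action (twist_group w) C (\<lambda>\<tau>. \<lambda>T\<in>C. twist_triangulation w \<tau> T)
    \<and> (\<forall>\<tau>\<in>carrier (twist_group w). \<forall>T1\<in>C. \<forall>T2\<in>C.
         flip_adjacent (polytope_vertices w) (twist_triangulation w \<tau> T1) (twist_triangulation w \<tau> T2)
           \<longleftrightarrow> flip_adjacent (polytope_vertices w) T1 T2)"
proof -
  let ?A = "polytope_vertices w" and ?G = "twist_group w"
  let ?tw = "twist_triangulation w"
  note w = assms(1)
  interpret G: group ?G by (rule group_twist_group[OF w])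
  have sym: "flip_adjacent ?A U T" if "flip_adjacent ?A T U" for T U
    using that unfolding flip_adjacent_def by (elim conjE) (intro conjI; simp add: disj_commute)
  then have rsym: "(flip_adjacent ?A)\<^sup>*\<^sup>* U T" if "(flip_adjacent ?A)\<^sup>*\<^sup>* T U" for T U
    using that by (metis sympD sympI symp_rtranclp)
  obtain T0 where T0: "triangulation_of ?A T0" "C = {S. (flip_adjacent ?A)\<^sup>*\<^sup>* T0 S}"
    using assms(2) unfolding flip_graph_component_def by blast
  have tri: "triangulation_of ?A T" if "T \<in> C" for T
  proof -
    have "(flip_adjacent ?A)\<^sup>*\<^sup>* T0 T" using that T0(2) by simp
    then show ?thesis by (induction rule: rtranclp_induct) (simp_all add: T0(1) flip_adjacent_def)
  qed
  have Pow: "T \<subseteq> Pow ?A" if "T \<in> C" for T using triangulation_Pow[OF tri[OF that]] .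
  have reach: "(flip_adjacent ?A)\<^sup>*\<^sup>* S T" if "S \<in> C" "T \<in> C" for S T
    using that rsym[of T0 S] unfolding T0(2) by (auto intro: rtranclp_trans)
  have closed: "T \<in> C" if "S \<in> C" "(flip_adjacent ?A)\<^sup>*\<^sup>* S T" for S T
    using that unfolding T0(2) by (auto intro: rtranclp_trans)
  have "finite ?A" unfolding polytope_vertices_eq by simp
  then obtain T1 where T1: "regular_triangulation ?A T1" using exists_regular_triangulation by blast
  \<comment> \<open>Twisting a flip path from \<open>T1\<close> to \<open>T\<close> step by step
    connects the twisted ends, so it is enough that \<open>C\<close> contains the twisted
    \<open>T1\<close>, which is regular.\<close>
  have twC: "?tw \<tau> T \<in> C" if \<tau>: "\<tau> \<in> carrier ?G" and T: "T \<in> C" for \<tau> T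
  proof -
    have "T1 \<in> C" "?tw \<tau> T1 \<in> C" using T1 twist_preserves(2)[OF w \<tau> T1] assms(3) by auto
    moreover have "(flip_adjacent ?A)\<^sup>*\<^sup>* (?tw \<tau> T1) (?tw \<tau> T)" if "(flip_adjacent ?A)\<^sup>*\<^sup>* T1 T"
      using that
    proof (induction rule: rtranclp_induct)
      case (step y z)
      then show ?case using twist_preserves(3)[OF w \<tau> step(2)] by (meson rtranclp.rtrancl_into_rtrancl)
    qed simp
    ultimately show ?thesis using reach closed T by blast
  qed
  have mult: "?tw (\<tau> \<otimes>\<^bsub>?G\<^esub> \<upsilon>) T = ?tw \<tau> (?tw \<upsilon> T)" if "\<tau> \<in> carrier ?G" "\<upsilon> \<in> carrier ?G" "T \<in> C" for \<tau> \<upsilon> T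
    by (rule twist_triangulation_mult[OF w that(1,2) Pow[OF that(3)]])
  have one: "?tw \<one>\<^bsub>?G\<^esub> T = T" if "T \<in> C" for T
    by (rule twist_triangulation_one[OF w Pow[OF that]])
  have inv: "?tw (inv\<^bsub>?G\<^esub> \<tau>) (?tw \<tau> T) = T" "?tw \<tau> (?tw (inv\<^bsub>?G\<^esub> \<tau>) T) = T"
    if "\<tau> \<in> carrier ?G" "T \<in> C" for \<tau> T
    using mult[of "inv\<^bsub>?G\<^esub> \<tau>" \<tau> T] mult[of \<tau> "inv\<^bsub>?G\<^esub> \<tau>" T] one[OF that(2)] that by simp_all
  have bij: "(\<lambda>T\<in>C. ?tw \<tau> T) \<in> Bij C" if \<tau>: "\<tau> \<in> carrier ?G" for \<tau>
  proof -
    have "bij_betw (\<lambda>T\<in>C. ?tw \<tau> T) C C"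
      by (rule bij_betw_byWitness[where f' = "?tw (inv\<^bsub>?G\<^esub> \<tau>)"])
        (use \<tau> inv twC[OF \<tau>] twC[of "inv\<^bsub>?G\<^esub> \<tau>"] in auto)
    then show ?thesis unfolding Bij_def by simp
  qed
  have action: "group_action ?G C (\<lambda>\<tau>. \<lambda>T\<in>C. ?tw \<tau> T)"
  proof (intro group_action.intro group_hom.intro group_hom_axioms.intro homI)
    show "group ?G" by (rule group_twist_group[OF w])
    show "group (BijGroup C)" by (rule group_BijGroup)
    fix \<tau> \<upsilon> assume \<tau>: "\<tau> \<in> carrier ?G"
    show "(\<lambda>T\<in>C. ?tw \<tau> T) \<in> carrier (BijGroup C)" using bij[OF \<tau>] unfolding BijGroup_def by simp
    assume \<upsilon>: "\<upsilon> \<in> carrier ?G"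
    have "(\<lambda>T\<in>C. ?tw \<tau> T) \<otimes>\<^bsub>BijGroup C\<^esub> (\<lambda>T\<in>C. ?tw \<upsilon> T) = compose C (\<lambda>T\<in>C. ?tw \<tau> T) (\<lambda>T\<in>C. ?tw \<upsilon> T)"
      using bij[OF \<tau>] bij[OF \<upsilon>] unfolding BijGroup_def by (simp only: monoid.simps restrict_apply')
    also have "\<dots> = (\<lambda>T\<in>C. ?tw (\<tau> \<otimes>\<^bsub>?G\<^esub> \<upsilon>) T)"
      using mult[OF \<tau> \<upsilon>] twC[OF \<upsilon>] unfolding compose_def by (intro restrict_ext) simp
    finally show "(\<lambda>T\<in>C. ?tw (\<tau> \<otimes>\<^bsub>?G\<^esub> \<upsilon>) T) = (\<lambda>T\<in>C. ?tw \<tau> T) \<otimes>\<^bsub>BijGroup C\<^esub> (\<lambda>T\<in>C. ?tw \<upsilon> T)"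
      by (rule HOL.sym)
  qed
  have adj: "flip_adjacent ?A (?tw \<tau> T) (?tw \<tau> U) \<longleftrightarrow> flip_adjacent ?A T U"
    if \<tau>: "\<tau> \<in> carrier ?G" and TU: "T \<in> C" "U \<in> C" for \<tau> T U
  proof
    \<comment> \<open>The converse is the preservation of adjacency by the inverse twist.\<close>
    assume "flip_adjacent ?A (?tw \<tau> T) (?tw \<tau> U)"
    from twist_preserves(3)[OF w G.inv_closed[OF \<tau>] this] show "flip_adjacent ?A T U"
      unfolding inv(1)[OF \<tau> TU(1)] inv(1)[OF \<tau> TU(2)] .
  qed (rule twist_preserves(3)[OF w \<tau>])
  show ?thesis using twist_group_iso[OF w] action adj by blast
qed

end
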